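(* Let $p,q$ be relatively prime integers with $2<p<q$ and let $h$ be an integer with $4<h<p+q-2$. For $1\le i\le h+4$ let $l_i=\frac{i-1}{h+4-i}$ and $m_i=\frac{i}{h+4-i}$ (with $x/0=+\infty$), and let $\frac{a_i}{b_i}=\mathrm{Left}_{h+3}(m_i)$ and $\frac{c_i}{d_i}=\mathrm{Right}_{h+3}(m_i)$ (reduced fractions). If $0<\frac pq<1/\lceil h/2\rceil$, then $L(h,p,q)=\lceil\frac{h+1}{2}\rceil p+q-((h+1)\bmod 2)$. Otherwise, letting $i$ be an index with $1\le i\le h+3$ and $l_i\le \frac pq\le l_{i+1}$, $$L(h,p,q)=\begin{cases}(h+4-i)\cdot p & \text{if } l_i\le \frac pq\le \frac{a_i}{b_i},\\ a_iq+d_ip & \text{if } \frac{a_i}{b_i}<\frac pq<\frac{c_i}{d_i},\\ i\cdot q & \text{if } \frac{c_i}{d_i}\le\frac pq\le l_{i+1}.\end{cases}$$ Moreover, for a given $h$ this representation (the fractions $l_i$, $\frac{a_i}{b_i}$, $\frac{c_i}{d_i}$ for all $i$, together with the corresponding linear expressions) has size $\mathcal O(h)$ and can be computed in $\mathcal O(h\log h)$ time.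
   Context: A partial word is a sequence over $\Sigma\cup\{\diamondsuit\}$, where $\diamondsuit\notin\Sigma$ is a hole; $a\approx b$ if $a=b$ or one of them is $\diamondsuit$. A positive integer $r$ is a (strong) period of a partial word $X$ if there is $P\in\Sigma^r$ with $X[i]\approx P[i\bmod r]$ for all positions $i$. $L(h,p,q)$ is the least integer $n_0$ such that every partial word with at most $h$ holes having periods $p,q$ and length at least $n_0$ has period $\gcd(p,q)$. Let $\mathcal F=\{\frac ab: a,b\in\mathbb Z_{\ge0},\gcd(a,b)=1\}$ (including $\frac10=+\infty$), $\mathcal F_k=\{\frac ab\in\mathcal F: a+b\le k\}$, and for real $x>0$: $\mathrm{Left}_k(x)=\max\{y\in\mathcal F_k: y\le x\}$, $\mathrm{Right}_k(x)=\min\{y\in\mathcal F_k: y\ge x\}$. Running time is measured with unit-cost arithmetic operations. *)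

theory Defs
  imports Complex_Main "HOL-Library.Extended_Real" "HOL-Library.Landau_Symbols"
begin

section \<open>Partial words and the threshold function\<close>

text \<open>A partial word over the alphabet \<open>\<Sigma>\<close> is a list over \<open>\<Sigma>\<close> extended by \<open>None\<close>,
  which plays the role of the hole. Positions are counted from 0.\<close>

definition partial_words :: "'a set \<Rightarrow> 'a option list set" where
  "partial_words \<Sigma> = lists (insert None (Some ` \<Sigma>))"

definition holes :: "'a option list \<Rightarrow> nat" where
  "holes X = count_list X None"

definition compatible :: "'a option \<Rightarrow> 'a option \<Rightarrow> bool" (infix "\<approx>" 50) where
  "a \<approx> b \<longleftrightarrow> a = b \<or> a = None \<or> b = None"

text \<open>Strong periods; \<open>r\<close> is not required to be at most the length of \<open>X\<close>.\<close>

definition has_period :: "'a set \<Rightarrow> 'a option list \<Rightarrow> nat \<Rightarrow> bool" where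
  "has_period \<Sigma> X r \<longleftrightarrow>
     0 < r \<and> (\<exists>P \<in> lists \<Sigma>. length P = r \<and> (\<forall>i < length X. X ! i \<approx> Some (P ! (i mod r))))"

definition threshold :: "'a set \<Rightarrow> nat \<Rightarrow> nat \<Rightarrow> nat \<Rightarrow> nat" where
  "threshold \<Sigma> h p q =
     (LEAST n. \<forall>X \<in> partial_words \<Sigma>.
        holes X \<le> h \<and> has_period \<Sigma> X p \<and> has_period \<Sigma> X q \<and> n \<le> length X
        \<longrightarrow> has_period \<Sigma> X (gcd p q))"


section \<open>Fractions\<close>

text \<open>A fraction is a pair of numerator and denominator, not necessarily reduced; a zero
  denominator gives the value \<open>\<infinity>\<close>.\<close>

type_synonym frac = "nat \<times> nat"

definition fval :: "frac \<Rightarrow> ereal" where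
  "fval x = (if snd x = 0 then \<infinity> else ereal (real (fst x) / real (snd x)))"

definition Fracs :: "frac set" where
  "Fracs = {(a, b). gcd a b = 1}"

definition Fracs_upto :: "nat \<Rightarrow> frac set" where
  "Fracs_upto k = {(a, b) \<in> Fracs. a + b \<le> k}"

text \<open>\<^const>\<open>fval\<close> is injective on \<^const>\<open>Fracs\<close>, so for \<open>k \<ge> 1\<close> the maximiser and the
  minimiser below are unique.\<close>

definition Left :: "nat \<Rightarrow> ereal \<Rightarrow> frac" where
  "Left k x = (ARG_MAX fval y. y \<in> Fracs_upto k \<and> fval y \<le> x)"

definition Right :: "nat \<Rightarrow> ereal \<Rightarrow> frac" where
  "Right k x = (ARG_MIN fval y. y \<in> Fracs_upto k \<and> x \<le> fval y)"

definition l_frac :: "nat \<Rightarrow> nat \<Rightarrow> frac" where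
  "l_frac h i = (i - 1, h + 4 - i)"

definition m_frac :: "nat \<Rightarrow> nat \<Rightarrow> frac" where
  "m_frac h i = (i, h + 4 - i)"

definition left_frac :: "nat \<Rightarrow> nat \<Rightarrow> frac" where
  "left_frac h i = Left (h + 3) (fval (m_frac h i))"

definition right_frac :: "nat \<Rightarrow> nat \<Rightarrow> frac" where
  "right_frac h i = Right (h + 3) (fval (m_frac h i))"


section \<open>The representation of the threshold function for a given number of holes\<close>

text \<open>The representation is a sequence of natural numbers. A fraction is written as numerator,
  denominator. The linear expression \<open>\<alpha> * p + \<beta> * q - \<gamma>\<close> is written as \<open>\<alpha>, \<beta>, \<gamma>\<close>.\<close>

definition frac_cells :: "frac \<Rightarrow> nat list" where
  "frac_cells x = [fst x, snd x]"

definition linear_cells :: "nat \<Rightarrow> nat \<Rightarrow> nat \<Rightarrow> nat list" where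
  "linear_cells \<alpha> \<beta> \<gamma> = [\<alpha>, \<beta>, \<gamma>]"

text \<open>The piece \<open>p / q < 1 / \<lceil>h / 2\<rceil>\<close>: its right end and its linear expression.\<close>

definition first_piece :: "nat \<Rightarrow> nat list" where
  "first_piece h =
     frac_cells (1, nat \<lceil>real h / 2\<rceil>) @
     linear_cells (nat \<lceil>(real h + 1) / 2\<rceil>) 1 ((h + 1) mod 2)"

definition fractions_at :: "nat \<Rightarrow> nat \<Rightarrow> nat list" where
  "fractions_at h i =
     frac_cells (l_frac h i) @ frac_cells (left_frac h i) @ frac_cells (right_frac h i)"

text \<open>The three linear expressions on the interval from \<open>l\<^sub>i\<close> to \<open>l\<^sub>i\<^sub>+\<^sub>1\<close>, from left to right:
  \<open>(h + 4 - i) * p\<close>, \<open>a\<^sub>i * q + d\<^sub>i * p\<close> and \<open>i * q\<close>.\<close>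

definition expressions_at :: "nat \<Rightarrow> nat \<Rightarrow> nat list" where
  "expressions_at h i =
     linear_cells (h + 4 - i) 0 0 @
     linear_cells (snd (right_frac h i)) (fst (left_frac h i)) 0 @
     linear_cells 0 i 0"

text \<open>There are \<open>h + 4\<close> indices \<open>i\<close> but only \<open>h + 3\<close> intervals between consecutive \<open>l\<^sub>i\<close>.\<close>

definition representation :: "nat \<Rightarrow> nat list" where
  "representation h =
     first_piece h @
     concat (map (\<lambda>i. fractions_at h i @ expressions_at h i) [1..<h + 4]) @
     fractions_at h (h + 4)"


section \<open>Random access machine programs with unit-cost arithmetic\<close>

text \<open>A program uses finitely many registers and an unbounded indirectly addressed memory, both
  holding natural numbers. Subtraction is truncated, and division by 0 follows the HOL
  convention.\<close>

datatype operand = Const nat | Reg nat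

datatype arith_op = Add | Sub | Mul | Div | Mod

datatype test = Less operand operand | Equal operand operand

datatype com =
    Arith nat arith_op operand operand
  | Load nat operand
  | Store operand operand
  | Skip
  | Seq com com
  | If test com com
  | While test com

type_synonym state = "(nat \<Rightarrow> nat) \<times> (nat \<Rightarrow> nat)"

fun opd_val :: "operand \<Rightarrow> (nat \<Rightarrow> nat) \<Rightarrow> nat" where
  "opd_val (Const n) r = n"
| "opd_val (Reg x) r = r x"

fun arith_val :: "arith_op \<Rightarrow> nat \<Rightarrow> nat \<Rightarrow> nat" where
  "arith_val Add a b = a + b"
| "arith_val Sub a b = a - b"
| "arith_val Mul a b = a * b"
| "arith_val Div a b = a div b"
| "arith_val Mod a b = a mod b"

fun test_val :: "test \<Rightarrow> (nat \<Rightarrow> nat) \<Rightarrow> bool" where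
  "test_val (Less a b) r \<longleftrightarrow> opd_val a r < opd_val b r"
| "test_val (Equal a b) r \<longleftrightarrow> opd_val a r = opd_val b r"

text \<open>\<open>exec c s t s'\<close>: started in state \<open>s\<close>, the program \<open>c\<close> terminates in state \<open>s'\<close> after
  exactly \<open>t\<close> unit-cost steps. Each arithmetic operation, memory access, \<open>Skip\<close> and evaluation of
  a test is one step.\<close>

inductive exec :: "com \<Rightarrow> state \<Rightarrow> nat \<Rightarrow> state \<Rightarrow> bool" where
  Arith: "exec (Arith x f a b) (r, m) 1 (r(x := arith_val f (opd_val a r) (opd_val b r)), m)"
| Load: "exec (Load x a) (r, m) 1 (r(x := m (opd_val a r)), m)"
| Store: "exec (Store a b) (r, m) 1 (r, m(opd_val a r := opd_val b r))"
| Skip: "exec Skip s 1 s"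
| Seq: "exec c1 s1 t1 s2 \<Longrightarrow> exec c2 s2 t2 s3 \<Longrightarrow> exec (Seq c1 c2) s1 (t1 + t2) s3"
| IfTrue: "test_val b (fst s) \<Longrightarrow> exec c1 s t s' \<Longrightarrow> exec (If b c1 c2) s (Suc t) s'"
| IfFalse: "\<not> test_val b (fst s) \<Longrightarrow> exec c2 s t s' \<Longrightarrow> exec (If b c1 c2) s (Suc t) s'"
| WhileFalse: "\<not> test_val b (fst s) \<Longrightarrow> exec (While b c) s 1 s"
| WhileTrue: "test_val b (fst s1) \<Longrightarrow> exec c s1 t1 s2 \<Longrightarrow> exec (While b c) s2 t2 s3
    \<Longrightarrow> exec (While b c) s1 (Suc (t1 + t2)) s3"

definition initial_state :: "nat \<Rightarrow> state" where
  "initial_state n = ((\<lambda>_. 0)(0 := n), \<lambda>_. 0)"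

text \<open>On input \<open>n\<close> (in register 0), \<open>c\<close> writes \<open>out\<close> to the memory cells from address 0 on,
  within \<open>t\<close> steps.\<close>

definition computes_within :: "com \<Rightarrow> nat \<Rightarrow> nat list \<Rightarrow> nat \<Rightarrow> bool" where
  "computes_within c n out t \<longleftrightarrow>
     (\<exists>t' r m. t' \<le> t \<and> exec c (initial_state n) t' (r, m) \<and> (\<forall>j < length out. m j = out ! j))"

end

(*
  Write position j of a word as the cell in row j mod p and column j mod q. If the word has the
  periods p and q but not 1, fix a letter c that occurs and colour a row or column True if its
  period letter is c: every cell whose row and column differ in colour is a hole, and both colours
  occur on the other cells. So n >= L(h, p, q) iff every such two-colouring of the rows and columns
  has more than h mismatched cells among 0, ..., n - 1.

  The cheapest colourings are of two kinds. A cross isolates one cell and costs the length of its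
  row plus the length of its column minus 2. A cut arranges the rows on a cycle with step q and
  changes colour at two places of the cycle; its cost is about 2 * (n - q) / p, and at least
  this much if two rows or more have each colour, because each pair v, v + q of cells of one column
  whose rows have different colours contains a mismatch. Cuts win exactly for
  p / q < 1 / ceiling (h / 2). Otherwise the threshold is the least n at which all crosses
  cost more than h. A cell with a short row and a short column exists iff p / q lies suitably with
  respect to a splitting of i / (h + 4 - i) as a mediant, which brings in the neighbours of that
  fraction in the Farey series of order h + 3. In one family of lengths for even h the cut bound
  falls short by one, and a third disjoint pair of cells at distance q or 3 * q makes up for it.

  The neighbours of i / (h + 4 - i) are read off from the inverse of i modulo h + 4, so one run of
  the Euclidean algorithm for each i computes the representation.
*)

theory Submission
  imports Defs "HOL-Number_Theory.Cong" "HOL-Real_Asymp.Real_Asymp"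
begin

subsection \<open>Words as two-coloured rows and columns\<close>

text \<open>The number of True rows decides which bound applies. With a single True (or False) row,
  a further True column costs at least as much as it saves once all columns have two cells, so no
  colouring beats a cross; with two or more rows of each colour the cut bound holds whatever the
  columns are. For \<open>n <= p * q\<close> a row and a column meet at most once, which the cross
  bound relies on. Origin of h + 4: a length is too short if some cell has row plus column at most h
  + 2, and this happens when its row is one short of h + 4 - i and its column one short of i. A
  reduced fraction with sum h + 4 lies just outside the Farey series of order h + 3 and is the
  mediant of its two neighbours there; one that is not reduced has its value in the series, its
  neighbours coincide, and the middle case is empty. An obstacle: cutting a bad word shorter may
  lose one of its two letters, so it is not evident that the bad lengths form an initial segment.
  This must be shown before L can be found from the lengths n and n - 1 alone.\<close>

definition mismatches :: "nat \<Rightarrow> nat \<Rightarrow> nat \<Rightarrow> (nat \<Rightarrow> bool) \<Rightarrow> (nat \<Rightarrow> bool) \<Rightarrow> nat set" where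
  "mismatches p q n \<alpha> \<beta> = {j. j < n \<and> \<alpha> (j mod p) \<noteq> \<beta> (j mod q)}"

text \<open>The two agreeing cells of opposite colours are two distinct letters, which is what a
  word without period 1 has. Without them a constant colouring would have no mismatch at
  all.\<close>

definition separable :: "nat \<Rightarrow> nat \<Rightarrow> nat \<Rightarrow> nat \<Rightarrow> bool" where
  "separable p q n h \<longleftrightarrow> (\<exists>\<alpha> \<beta>. (\<exists>j<n. \<alpha> (j mod p) \<and> \<beta> (j mod q)) \<and>
     (\<exists>j<n. \<not> \<alpha> (j mod p) \<and> \<not> \<beta> (j mod q)) \<and> card (mismatches p q n \<alpha> \<beta>) \<le> h)"

lemma finite_mismatches [simp]: "finite (mismatches p q n \<alpha> \<beta>)"
  unfolding mismatches_def by simp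

lemma mismatches_Not: "mismatches p q n (\<lambda>x. \<not> \<alpha> x) (\<lambda>y. \<not> \<beta> y) = mismatches p q n \<alpha> \<beta>"
  unfolding mismatches_def by auto

lemma holes_eq_card: "holes X = card {j. j < length X \<and> X ! j = None}"
  unfolding holes_def count_list_eq_length_filter length_filter_conv_card by (metis (no_types, opaque_lifting))

text \<open>A position that is not a hole determines both of its period letters, so they agree there
  and every mismatch is a hole.\<close>

lemma not_separable_imp_period_1:
  assumes ns: "\<not> separable p q (length X) h" and X: "X \<in> partial_words \<Sigma>"
    and h: "holes X \<le> h" and per: "has_period \<Sigma> X p" "has_period \<Sigma> X q" and \<Sigma>: "z \<in> \<Sigma>"
  shows "has_period \<Sigma> X 1"
proof (rule ccontr)
  assume no: "\<not> has_period \<Sigma> X 1"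
  have single: "\<exists>j<length X. X ! j \<noteq> None \<and> X ! j \<noteq> Some c" if "c \<in> \<Sigma>" for c
  proof (rule ccontr)
    assume "\<not> ?thesis"
    hence "\<forall>j<length X. X ! j \<approx> Some c" unfolding compatible_def by auto
    hence "has_period \<Sigma> X 1" unfolding has_period_def using that
      by (auto intro!: bexI[of _ "[c]"])
    with no show False by simp
  qed
  have sym: "c \<in> \<Sigma>" if "j < length X" "X ! j = Some c" for j c
  proof -
    have "Some c \<in> set X" using that nth_mem[of j X] by simp
    moreover have "set X \<subseteq> insert None (Some ` \<Sigma>)" using X unfolding partial_words_def by auto
    ultimately show ?thesis by blast
  qed
  \<comment> \<open>A word of holes only would have period 1 with the letter \<open>z\<close>. Hence
    some letter \<open>c\<close> occurs, and by the same argument a second one.\<close>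
  from single[OF \<Sigma>] obtain j c where j: "j < length X" "X ! j = Some c" by auto
  from single[OF sym[OF j]] obtain j' c' where j': "j' < length X" "X ! j' = Some c'" "c' \<noteq> c" by auto
  from per obtain P Q where PQ: "\<And>i. i < length X \<Longrightarrow> X ! i \<approx> Some (P ! (i mod p))"
    "\<And>i. i < length X \<Longrightarrow> X ! i \<approx> Some (Q ! (i mod q))" unfolding has_period_def by blast
  define \<alpha> where "\<alpha> x \<longleftrightarrow> P ! x = c" for x
  define \<beta> where "\<beta> x \<longleftrightarrow> Q ! x = c" for x
  have "mismatches p q (length X) \<alpha> \<beta> \<subseteq> {i. i < length X \<and> X ! i = None}"
    using PQ unfolding mismatches_def \<alpha>_def \<beta>_def compatible_def by fastforce
  hence "card (mismatches p q (length X) \<alpha> \<beta>) \<le> card {i. i < length X \<and> X ! i = None}"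
    by (rule card_mono[rotated]) simp
  hence "card (mismatches p q (length X) \<alpha> \<beta>) \<le> h" using h unfolding holes_eq_card by linarith
  moreover have "\<alpha> (j mod p)" "\<beta> (j mod q)"
    using PQ[OF j(1)] unfolding j(2) compatible_def \<alpha>_def \<beta>_def by simp_all
  moreover have "\<not> \<alpha> (j' mod p)" "\<not> \<beta> (j' mod q)"
    using PQ[OF j'(1)] j'(3) unfolding j'(2) compatible_def \<alpha>_def \<beta>_def by auto
  ultimately show False using ns j(1) j'(1) unfolding separable_def by blast
qed

lemma separable_imp_word:
  assumes sep: "separable p q n h" and pq: "0 < p" "0 < q" and xy: "x \<in> \<Sigma>" "y \<in> \<Sigma>" "x \<noteq> y"
  obtains X where "X \<in> partial_words \<Sigma>" "length X = n" "holes X \<le> h"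
    "has_period \<Sigma> X p" "has_period \<Sigma> X q" "\<not> has_period \<Sigma> X 1"
proof -
  from sep obtain \<alpha> \<beta> i j where ij: "i < n" "\<alpha> (i mod p)" "\<beta> (i mod q)"
    "j < n" "\<not> \<alpha> (j mod p)" "\<not> \<beta> (j mod q)" and h: "card (mismatches p q n \<alpha> \<beta>) \<le> h"
    unfolding separable_def by blast
  define col where "col b = (if b then x else y)" for b
  define X where "X = map (\<lambda>v. if \<alpha> (v mod p) \<noteq> \<beta> (v mod q) then None
    else Some (col (\<alpha> (v mod p)))) [0..<n]"
  have len: "length X = n" unfolding X_def by simp
  have nth: "X ! v = (if \<alpha> (v mod p) \<noteq> \<beta> (v mod q) then None else Some (col (\<alpha> (v mod p))))"
    if "v < n" for v using that unfolding X_def by simp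
  have "X \<in> partial_words \<Sigma>"
    unfolding partial_words_def X_def col_def using xy by (auto simp: in_lists_conv_set)
  moreover have "{v. v < length X \<and> X ! v = None} = mismatches p q n \<alpha> \<beta>"
    unfolding mismatches_def len by (auto simp: nth split: if_splits)
  hence "holes X \<le> h" unfolding holes_eq_card using h by simp
  moreover have "has_period \<Sigma> X p"
    unfolding has_period_def using pq xy
    by (intro conjI bexI[of _ "map (\<lambda>v. col (\<alpha> v)) [0..<p]"])
      (auto simp: len nth compatible_def col_def in_lists_conv_set)
  moreover have "has_period \<Sigma> X q"
    unfolding has_period_def using pq xy
    by (intro conjI bexI[of _ "map (\<lambda>v. col (\<beta> v)) [0..<q]"])
      (auto simp: len nth compatible_def col_def in_lists_conv_set)
  moreover have "\<not> has_period \<Sigma> X 1"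
  proof
    assume "has_period \<Sigma> X 1"
    then obtain c where "\<forall>v<n. X ! v \<approx> Some c" unfolding has_period_def len by auto
    hence "X ! i \<approx> Some c" "X ! j \<approx> Some c" using ij by auto
    thus False using ij xy by (auto simp: nth compatible_def col_def)
  qed
  ultimately show ?thesis using len by (intro that)
qed

text \<open>In a separation of length \<open>n + 1\<close> exactly one of the agreeing cells is cell
  \<open>n\<close>, say the False one. Dropping cell \<open>n\<close> shows that no earlier cell
  agrees on False; dropping cell 0 by a shift keeps the False cell and shows that no later cell
  agrees on True. So the cells 1 to \<open>n - 1\<close> are all mismatches, more than
  \<open>h\<close>.\<close>

lemma not_separable_Suc:
  assumes ns: "\<not> separable p q n h" and n: "h + 2 \<le> n" and pq: "0 < p" "0 < q"
  shows "\<not> separable p q (Suc n) h"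
proof
  assume "separable p q (Suc n) h"
  then obtain \<alpha> \<beta> i j where ij: "i < Suc n" "\<alpha> (i mod p)" "\<beta> (i mod q)"
    "j < Suc n" "\<not> \<alpha> (j mod p)" "\<not> \<beta> (j mod q)" and h: "card (mismatches p q (Suc n) \<alpha> \<beta>) \<le> h"
    unfolding separable_def by blast
  have main: False if ij: "i < n" "\<alpha> (i mod p)" "\<beta> (i mod q)"
     "\<not> \<alpha> (n mod p)" "\<not> \<beta> (n mod q)" and h: "card (mismatches p q (Suc n) \<alpha> \<beta>) \<le> h"
    for \<alpha> \<beta> :: "nat \<Rightarrow> bool" and i
  proof -
    have "mismatches p q n \<alpha> \<beta> \<subseteq> mismatches p q (Suc n) \<alpha> \<beta>" unfolding mismatches_def by auto
    hence "card (mismatches p q n \<alpha> \<beta>) \<le> h" using h card_mono by (meson finite_mismatches le_trans)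
    hence no0: "\<alpha> (v mod p) \<or> \<beta> (v mod q)" if "v < n" for v
      using ns ij that unfolding separable_def by blast
    define \<alpha>' where "\<alpha>' x = \<alpha> (Suc x mod p)" for x
    define \<beta>' where "\<beta>' x = \<beta> (Suc x mod q)" for x
    have [simp]: "\<alpha>' (v mod p) = \<alpha> (Suc v mod p)" "\<beta>' (v mod q) = \<beta> (Suc v mod q)" for v
      unfolding \<alpha>'_def \<beta>'_def by (simp_all add: mod_Suc_eq)
    have sub: "Suc ` mismatches p q n \<alpha>' \<beta>' \<subseteq> mismatches p q (Suc n) \<alpha> \<beta>"
      unfolding mismatches_def by auto
    have "card (mismatches p q n \<alpha>' \<beta>') \<le> h"
      using card_mono[OF finite_mismatches sub] h by (simp add: card_image)
    moreover have "n - 1 < n" "\<not> \<alpha>' ((n - 1) mod p)" "\<not> \<beta>' ((n - 1) mod q)" using ij n by auto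
    ultimately have no1: "\<not> (\<alpha>' (v mod p) \<and> \<beta>' (v mod q))" if "v < n" for v
      using ns that unfolding separable_def by blast
    have "{1..<n} \<subseteq> mismatches p q (Suc n) \<alpha> \<beta>"
    proof
      fix v assume "v \<in> {1..<n}"
      hence v: "v < n" "v - 1 < n" "Suc (v - 1) = v" by auto
      show "v \<in> mismatches p q (Suc n) \<alpha> \<beta>"
        using no0[OF v(1)] no1[OF v(2)] v unfolding mismatches_def by auto
    qed
    from card_mono[OF finite_mismatches this] show False using h n by simp
  qed
  have "card (mismatches p q n \<alpha> \<beta>) \<le> h"
  proof -
    have "mismatches p q n \<alpha> \<beta> \<subseteq> mismatches p q (Suc n) \<alpha> \<beta>" unfolding mismatches_def by auto
    thus ?thesis using h card_mono by (meson finite_mismatches le_trans)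
  qed
  hence "\<not> (i < n \<and> j < n)" using ns ij unfolding separable_def by blast
  moreover have "i \<noteq> j" using ij by auto
  ultimately consider "i < n" "j = n" | "j < n" "i = n" using ij by linarith
  thus False
  proof cases
    case 1
    thus ?thesis using main[OF _ ij(2,3) _ _ h] ij(5,6) by simp
  next
    case 2
    have "card (mismatches p q (Suc n) (\<lambda>x. \<not> \<alpha> x) (\<lambda>y. \<not> \<beta> y)) \<le> h"
      using h by (simp add: mismatches_Not)
    from main[OF 2(1) ij(5,6) _ _ this] show ?thesis using ij(2,3) 2(2) by simp
  qed
qed

text \<open>By \<open>not_separable_Suc\<close> one non-separable length excludes all longer ones,
  so the minimum is certified by \<open>n\<close> and \<open>n - 1\<close> alone.\<close>

lemma threshold_eqI:
  assumes cop: "coprime p q" and pq: "0 < p" "0 < q" and xy: "x \<in> \<Sigma>" "y \<in> \<Sigma>" "x \<noteq> y"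
    and n: "h + 2 \<le> n" and ns: "\<not> separable p q n h" and sep: "separable p q (n - 1) h"
  shows "threshold \<Sigma> h p q = n"
  unfolding threshold_def
proof (rule Least_equality, intro ballI impI)
  fix X assume X: "X \<in> partial_words \<Sigma>"
    and A: "holes X \<le> h \<and> has_period \<Sigma> X p \<and> has_period \<Sigma> X q \<and> n \<le> length X"
  have "\<not> separable p q m h" if "n \<le> m" for m
    using that
  proof (induction m rule: dec_induct)
    case base
    show ?case by (rule ns)
  next
    case (step m)
    show ?case by (rule not_separable_Suc[OF step.IH _ pq]) (use n step.hyps in linarith)
  qed
  thus "has_period \<Sigma> X (gcd p q)"
    using not_separable_imp_period_1[OF _ X, of p q h x] A cop xy by (simp add: coprime_iff_gcd_eq_1[symmetric])
next
  fix m assume m: "\<forall>X\<in>partial_words \<Sigma>. holes X \<le> h \<and> has_period \<Sigma> X p \<and>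
    has_period \<Sigma> X q \<and> m \<le> length X \<longrightarrow> has_period \<Sigma> X (gcd p q)"
  obtain X where "X \<in> partial_words \<Sigma>" "length X = n - 1" "holes X \<le> h"
    "has_period \<Sigma> X p" "has_period \<Sigma> X q" "\<not> has_period \<Sigma> X 1"
    using separable_imp_word[OF sep pq xy] by blast
  with m cop have "\<not> m \<le> n - 1" by auto
  thus "n \<le> m" by simp
qed

subsection \<open>Cells, crosses and cuts\<close>

text \<open>The count is the ceiling of (n - x) / p; adding \<open>p - 1\<close> before subtracting
  \<open>x\<close> avoids truncation when \<open>x\<close> exceeds \<open>n\<close>.\<close>

lemma card_residue_class:
  assumes "x < p"
  shows "card {v. v < n \<and> v mod p = x} = (n + p - 1 - x) div p"
proof -
  have "{v. v < n \<and> v mod p = x} = (\<lambda>s. x + s * p) ` {..<(n + p - 1 - x) div p}"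
  proof (intro equalityI subsetI)
    fix v assume "v \<in> {v. v < n \<and> v mod p = x}"
    hence v: "v < n" "v = x + (v div p) * p" by auto
    hence "(v div p + 1) * p \<le> n + p - 1 - x" by (simp add: algebra_simps) 
    hence "v div p + 1 \<le> (n + p - 1 - x) div p" using assms by (simp add: less_eq_div_iff_mult_less_eq)
    thus "v \<in> (\<lambda>s. x + s * p) ` {..<(n + p - 1 - x) div p}" using v(2)
      by (intro image_eqI[of _ _ "v div p"]) auto
  next
    fix v assume "v \<in> (\<lambda>s. x + s * p) ` {..<(n + p - 1 - x) div p}"
    then obtain s where s: "v = x + s * p" "s < (n + p - 1 - x) div p" by auto
    hence "s + 1 \<le> (n + p - 1 - x) div p" by simp
    hence "(s + 1) * p \<le> n + p - 1 - x" using assms by (simp add: less_eq_div_iff_mult_less_eq)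
    thus "v \<in> {v. v < n \<and> v mod p = x}" using s assms by (simp add: algebra_simps)
  qed
  moreover have "inj_on (\<lambda>s. x + s * p) {..<(n + p - 1 - x) div p}"
    using assms by (auto simp: inj_on_def)
  ultimately show ?thesis by (simp add: card_image)
qed

lemma card_residue_class_ge:
  assumes "x < p"
  shows "n div p \<le> card {v. v < n \<and> v mod p = x}"
  unfolding card_residue_class[OF assms] by (rule div_le_mono) (use assms in linarith)

definition class_size :: "nat \<Rightarrow> nat \<Rightarrow> nat \<Rightarrow> nat" where
  "class_size p n j = card {v. v < n \<and> v mod p = j mod p}"

text \<open>The summands are the cells of the class before \<open>j\<close>, those after
  \<open>j\<close>, and \<open>j\<close> itself.\<close>

lemma class_size_eq:
  assumes "0 < p" "j < n"
  shows "class_size p n j = j div p + (n - 1 - j) div p + 1"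
proof -
  have "j mod p < p" using assms by simp
  have eq: "n + p - 1 - j mod p = (n - 1 - j) + (j div p + 1) * p"
  proof -
    have "j div p * p + j mod p = j" "(j div p + 1) * p = j div p * p + p" by simp_all
    thus ?thesis using assms \<open>j mod p < p\<close> by linarith
  qed
  show ?thesis unfolding class_size_def card_residue_class[OF \<open>j mod p < p\<close>] eq
    by (subst div_mult_self1) (use assms in simp_all)
qed

lemma class_size_ge:
  assumes "0 < p" shows "n div p \<le> class_size p n j"
  unfolding class_size_def by (rule card_residue_class_ge) (use assms in simp)

text \<open>Chinese remainder theorem: among the first \<open>p * q\<close> positions a row and a
  column share at most one cell.\<close>

lemma eq_of_mod_eq:
  fixes p q v w :: nat
  assumes "coprime p q" "v mod p = w mod p" "v mod q = w mod q" "v < p * q" "w < p * q"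
  shows "v = w"
proof -
  have "[v = w] (mod p * q)"
    using assms(1-3) coprime_cong_mult_nat[of v w p q] unfolding Cong.cong_def by blast
  thus ?thesis using assms(4,5) unfolding Cong.cong_def by simp
qed

text \<open>Only the row and the column of \<open>j\<close> are True, so the mismatches are among
  their other cells. The agreeing False cell is a neighbour of \<open>j\<close>, which lies in
  another row and another column because both periods exceed 1.\<close>

lemma separable_cross:
  assumes pq: "1 < p" "1 < q" and j: "j < n" "2 \<le> n"
    and deg: "class_size p n j + class_size q n j \<le> h + 2"
  shows "separable p q n h"
proof -
  define D where "D r = {v. v < n \<and> v mod r = j mod r}" for r
  have fin: "finite (D r)" and jD: "j \<in> D r" for r unfolding D_def using j by auto
  have card: "card (D r - {j}) = class_size r n j - 1" for r
    using jD fin unfolding class_size_def D_def[symmetric] by simp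
  have pos: "0 < class_size r n j" for r
    using jD[of r] fin[of r] unfolding class_size_def D_def[symmetric] by (auto simp: card_gt_0_iff)
  have "mismatches p q n (\<lambda>x. x = j mod p) (\<lambda>y. y = j mod q) \<subseteq> (D p - {j}) \<union> (D q - {j})"
    unfolding mismatches_def D_def by auto
  hence "card (mismatches p q n (\<lambda>x. x = j mod p) (\<lambda>y. y = j mod q)) \<le> card (D p - {j}) + card (D q - {j})"
    using card_mono card_Un_le fin by (meson finite_Diff finite_UnI le_trans)
  also have "\<dots> \<le> h" using deg pos[of p] pos[of q] unfolding card by linarith
  finally have "card (mismatches p q n (\<lambda>x. x = j mod p) (\<lambda>y. y = j mod q)) \<le> h" .
  moreover have "\<exists>v<n. v mod p \<noteq> j mod p \<and> v mod q \<noteq> j mod q"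
  proof (cases "Suc j < n")
    case True
    have "Suc j mod r \<noteq> j mod r" if "1 < r" for r using that by (auto simp: mod_Suc)
    with True pq show ?thesis by blast
  next
    case False
    hence "Suc (j - 1) = j" "j - 1 < n" using j by auto
    moreover have "Suc (j - 1) mod r \<noteq> (j - 1) mod r" if "1 < r" for r using that by (auto simp: mod_Suc)
    ultimately show ?thesis using pq by metis
  qed
  ultimately show ?thesis unfolding separable_def using j(1)
    by (intro exI[of _ "\<lambda>x. x = j mod p"] exI[of _ "\<lambda>y. y = j mod q"]) auto
qed

text \<open>The cells \<open>v\<close> and \<open>\<pi> v\<close> lie in one column but in rows of
  different colours, so one of them is a mismatch whatever \<beta> is. Disjointness of the pairs
  makes the choice \<phi> injective.\<close>

lemma card_le_mismatches:
  assumes inj: "inj_on \<pi> S" and disj: "\<pi> ` S \<inter> S = {}"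
    and S: "\<And>v. v \<in> S \<Longrightarrow> v < n \<and> \<pi> v < n \<and> \<pi> v mod q = v mod q \<and> \<alpha> (\<pi> v mod p) \<noteq> \<alpha> (v mod p)"
  shows "card S \<le> card (mismatches p q n \<alpha> \<beta>)"
proof -
  let ?C = "mismatches p q n \<alpha> \<beta>"
  define \<phi> where "\<phi> v = (if v \<in> ?C then v else \<pi> v)" for v
  have "inj_on \<phi> S"
    using inj disj unfolding inj_on_def \<phi>_def by (auto split: if_splits)
  moreover have "\<phi> ` S \<subseteq> ?C"
  proof
    fix w assume "w \<in> \<phi> ` S"
    then obtain v where v: "v \<in> S" "w = \<phi> v" by auto
    from S[OF v(1)] have v': "v < n" "\<pi> v < n" "\<pi> v mod q = v mod q" "\<alpha> (\<pi> v mod p) \<noteq> \<alpha> (v mod p)"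
      by auto
    show "w \<in> ?C"
    proof (cases "v \<in> ?C")
      case False
      hence "\<alpha> (v mod p) = \<beta> (v mod q)" using v' unfolding mismatches_def by auto
      thus ?thesis using v(2) False v' unfolding \<phi>_def mismatches_def by auto
    qed (use v in \<open>simp add: \<phi>_def\<close>)
  qed
  ultimately show ?thesis by (rule card_inj_on_le) simp
qed

section \<open>Counting mismatches column by column\<close>

lemma card_fibres:
  assumes "0 < (q::nat)" "finite S"
  shows "card S = (\<Sum>y<q. card {j \<in> S. j mod q = y})"
proof -
  have "S = (\<Union>y\<in>{..<q}. {j \<in> S. j mod q = y})" using assms by auto
  also have "card \<dots> = (\<Sum>y<q. card {j \<in> S. j mod q = y})"
    using assms by (subst card_UN_disjoint) auto
  finally show ?thesis .
qed

text \<open>Compared with colouring every column \<open>False\<close>, colouring the column \<open>y\<close> with \<open>True\<close>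
  costs its length minus twice the number of its \<open>True\<close> rows, of which there are at most
  \<open>card {x. x < p \<and> \<alpha> x}\<close>.\<close>

lemma mismatches_small_side:
  assumes cop: "coprime p q" and pq: "0 < p" "0 < q" and n: "n \<le> p * q"
    and u: "card {x. x < p \<and> \<alpha> x} = u" and deg: "2 * u \<le> n div q" and y: "\<beta> (j mod q)"
  shows "card {v. v < n \<and> \<alpha> (v mod p)} + class_size q n j \<le> card (mismatches p q n \<alpha> \<beta>) + 2 * u"
proof -
  define m where "m y = card {v \<in> mismatches p q n \<alpha> \<beta>. v mod q = y}" for y
  define e where "e y = card {v \<in> {v. v < n \<and> \<alpha> (v mod p)}. v mod q = y}" for y
  define d where "d y = card {v. v < n \<and> v mod q = y}" for y
  have e_le: "e y \<le> u" for y
  proof -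
    have "inj_on (\<lambda>v. v mod p) {v \<in> {v. v < n \<and> \<alpha> (v mod p)}. v mod q = y}"
      by (rule inj_onI) (use n in \<open>auto intro!: eq_of_mod_eq[OF cop]\<close>)
    moreover have "(\<lambda>v. v mod p) ` {v \<in> {v. v < n \<and> \<alpha> (v mod p)}. v mod q = y} \<subseteq> {x. x < p \<and> \<alpha> x}"
      using pq by auto
    ultimately show ?thesis unfolding e_def u[symmetric] by (intro card_inj_on_le) auto
  qed
  have d_ge: "2 * u \<le> d y" if "y < q" for y
    using deg card_residue_class_ge[OF that, of n] unfolding d_def by linarith
  have m_eq: "m y = (if \<beta> y then d y - e y else e y)" for y
  proof (cases "\<beta> y")
    case True
    have split: "{v \<in> mismatches p q n \<alpha> \<beta>. v mod q = y}
      = {v. v < n \<and> v mod q = y} - {v \<in> {v. v < n \<and> \<alpha> (v mod p)}. v mod q = y}"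
      unfolding mismatches_def using True by auto
    thus ?thesis unfolding m_def d_def e_def using True by (subst split, subst card_Diff_subset) auto
  next
    case False
    hence "{v \<in> mismatches p q n \<alpha> \<beta>. v mod q = y} = {v \<in> {v. v < n \<and> \<alpha> (v mod p)}. v mod q = y}"
      unfolding mismatches_def by auto
    thus ?thesis unfolding m_def e_def using False by simp
  qed
  \<comment> \<open>Since \<open>e y <= u\<close> and \<open>2 * u <= d y\<close>, colouring a
    column True never costs less than leaving it False.\<close>
  have m_ge: "e y \<le> m y" if "y < q" for y using m_eq[of y] d_ge[OF that] e_le[of y] by auto
  define y0 where "y0 = j mod q"
  have y0: "y0 < q" unfolding y0_def using pq by simp
  have m0: "e y0 + d y0 \<le> m y0 + 2 * u"
    using m_eq[of y0] y e_le[of y0] d_ge[OF y0] unfolding y0_def[symmetric] by auto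
  have "card {v. v < n \<and> \<alpha> (v mod p)} = (\<Sum>y<q. e y)"
    unfolding e_def by (rule card_fibres) (use pq in auto)
  also have "\<dots> = e y0 + (\<Sum>y\<in>{..<q} - {y0}. e y)" using y0 by (simp add: sum.remove)
  also have "\<dots> \<le> e y0 + (\<Sum>y\<in>{..<q} - {y0}. m y)" using m_ge by (intro add_left_mono sum_mono) auto
  finally have "card {v. v < n \<and> \<alpha> (v mod p)} + d y0 \<le> m y0 + 2 * u + (\<Sum>y\<in>{..<q} - {y0}. m y)"
    using m0 by linarith
  also have "\<dots> = (\<Sum>y<q. m y) + 2 * u" using y0 by (simp add: sum.remove)
  also have "(\<Sum>y<q. m y) = card (mismatches p q n \<alpha> \<beta>)"
    unfolding m_def by (rule card_fibres[symmetric]) (use pq in auto)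
  finally show ?thesis unfolding d_def y0_def class_size_def .
qed

lemma card_rows_ge:
  assumes "0 < p"
  shows "card {x. x < p \<and> \<alpha> x} * (n div p) \<le> card {v. v < n \<and> \<alpha> (v mod p)}"
proof -
  have "card {x. x < p \<and> \<alpha> x} * (n div p) = (\<Sum>x\<in>{x. x < p \<and> \<alpha> x}. n div p)" by simp
  also have "\<dots> \<le> (\<Sum>x\<in>{x. x < p \<and> \<alpha> x}. card {v. v < n \<and> v mod p = x})"
    by (intro sum_mono card_residue_class_ge) auto
  also have "\<dots> = card (\<Union>x\<in>{x. x < p \<and> \<alpha> x}. {v. v < n \<and> v mod p = x})"
    by (subst card_UN_disjoint) auto
  also have "(\<Union>x\<in>{x. x < p \<and> \<alpha> x}. {v. v < n \<and> v mod p = x}) = {v. v < n \<and> \<alpha> (v mod p)}"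
    using assms by auto
  finally show ?thesis .
qed

section \<open>Colour changes along the cycle of rows\<close>

lemma adjacent_change:
  fixes g :: "nat \<Rightarrow> bool"
  assumes "a \<le> s" "s < b" "g s" "a \<le> t" "t < b" "\<not> g t"
  obtains k where "a \<le> k" "Suc k < b" "g k \<noteq> g (Suc k)"
proof -
  have ex: "\<exists>k. s \<le> k \<and> Suc k \<le> t \<and> g k \<noteq> g (Suc k)" if "s < t" "g s \<noteq> g t" for s t
  proof (rule ccontr)
    assume no: "\<not> ?thesis"
    have "g k = g s" if "s \<le> k" "k \<le> t" for k
      using that
    proof (induction k rule: dec_induct)
      case (step k)
      thus ?case using no by auto
    qed simp
    from this[of t] that show False by simp
  qed
  show ?thesis
  proof (cases s t rule: linorder_cases)
    case less
    with ex[OF less] assms obtain k where "s \<le> k" "Suc k \<le> t" "g k \<noteq> g (Suc k)" by blast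
    thus ?thesis using assms by (intro that[of k]) simp_all
  next
    case greater
    with ex[OF greater] assms obtain k where "t \<le> k" "Suc k \<le> s" "g k \<noteq> g (Suc k)" by blast
    thus ?thesis using assms by (intro that[of k]) simp_all
  qed (use assms in simp)
qed

text \<open>The rows are arranged on a cycle in which consecutive rows differ by \<open>q\<close>.\<close>

lemma orbit_inj:
  assumes "coprime p q" "s < p" "t < p" "(b + s * q) mod p = (b + t * q) mod p"
  shows "s = (t::nat)"
proof -
  have "[b + s * q = b + t * q] (mod p)" using assms(4) unfolding Cong.cong_def .
  hence "[s * q = t * q] (mod p)" by (simp add: cong_add_lcancel_nat)
  hence "[s = t] (mod p)" using assms(1) cong_mult_rcancel_nat coprime_commute by blast
  thus ?thesis using assms(2,3) unfolding Cong.cong_def by simp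
qed

lemma orbit_bij:
  assumes "coprime p q" "0 < (p::nat)"
  shows "bij_betw (\<lambda>t. (b + t * q) mod p) {..<p} {..<p}"
proof -
  have inj: "inj_on (\<lambda>t. (b + t * q) mod p) {..<p}"
    by (rule inj_onI, rule orbit_inj[OF assms(1)]) simp_all
  moreover have "(\<lambda>t. (b + t * q) mod p) ` {..<p} = {..<p}"
  proof (rule card_subset_eq)
    show "(\<lambda>t. (b + t * q) mod p) ` {..<p} \<subseteq> {..<p}" using assms(2) by auto
  qed (simp_all add: card_image[OF inj])
  ultimately show ?thesis unfolding bij_betw_def by simp
qed

lemma orbit_surj:
  assumes "coprime p q" "x < (p::nat)"
  obtains t where "t < p" "(b + t * q) mod p = x"
proof -
  have "(\<lambda>t. (b + t * q) mod p) ` {..<p} = {..<p}"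
    using orbit_bij[OF assms(1), of b] assms(2) unfolding bij_betw_def by simp
  with assms(2) have "x \<in> (\<lambda>t. (b + t * q) mod p) ` {..<p}" by simp
  thus ?thesis using that by auto
qed

lemma change_base:
  assumes cop: "coprime p q" and xy: "x < (p::nat)" "\<alpha> x" "y < p" "\<not> \<alpha> y"
  obtains b where "\<alpha> (b mod p) \<noteq> \<alpha> ((b + q) mod p)"
proof -
  obtain s where s: "s < p" "(0 + s * q) mod p = x" using orbit_surj[OF cop xy(1)] .
  obtain t where t: "t < p" "(0 + t * q) mod p = y" using orbit_surj[OF cop xy(3)] .
  obtain k where "\<alpha> ((k * q) mod p) \<noteq> \<alpha> ((Suc k * q) mod p)"
    using adjacent_change[of 0 s p "\<lambda>k. \<alpha> ((k * q) mod p)" t] s t xy by auto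
  thus ?thesis using that[of "k * q"] by (simp add: add.commute)
qed

lemma card_two_residue_classes:
  assumes "x < p" "y < p" "x \<noteq> (y::nat)"
  shows "card {v. v < n \<and> (v mod p = x \<or> v mod p = y)} = (n + p - 1 - x) div p + (n + p - 1 - y) div p"
proof -
  have "{v. v < n \<and> (v mod p = x \<or> v mod p = y)} = {v. v < n \<and> v mod p = x} \<union> {v. v < n \<and> v mod p = y}"
    by auto
  moreover have "{v. v < n \<and> v mod p = x} \<inter> {v. v < n \<and> v mod p = y} = {}" using assms by auto
  ultimately show ?thesis
    by (simp add: card_Un_disjoint card_residue_class[OF assms(1)] card_residue_class[OF assms(2)])
qed

text \<open>Each cell below \<open>n - q\<close> in one of the two rows gives a pair
  \<open>v\<close>, \<open>v + q\<close>. Pairs overlap only if the second cell of one is the first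
  cell of another. This is excluded if all second cells lie at or beyond \<open>n - q\<close>, or if
  neither changing row follows the other on the cycle.\<close>

lemma mismatches_two_changes:
  assumes q: "0 < q"
    and xy: "x < p" "y < p" "x \<noteq> y" "\<alpha> x \<noteq> \<alpha> ((x + q) mod p)" "\<alpha> y \<noteq> \<alpha> ((y + q) mod p)"
    and disj: "n \<le> 2 * q \<or> ((x + q) mod p \<noteq> y \<and> (y + q) mod p \<noteq> x)"
  shows "(n - q + p - 1 - x) div p + (n - q + p - 1 - y) div p \<le> card (mismatches p q n \<alpha> \<beta>)"
proof -
  let ?S = "{v. v < n - q \<and> (v mod p = x \<or> v mod p = y)}"
  have step: "(v + q) mod p = (w + q) mod p" if "v mod p = w" for v w
    using that by (metis mod_add_left_eq)
  have shift: "((v + q) mod p = (x + q) mod p \<and> v mod p = x) \<or> ((v + q) mod p = (y + q) mod p \<and> v mod p = y)"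
    if "v \<in> ?S" for v using that step[of v x] step[of v y] by blast
  have "card ?S \<le> card (mismatches p q n \<alpha> \<beta>)"
  proof (rule card_le_mismatches[where \<pi> = "\<lambda>v. v + q"])
    have x_fix: "(x + q) mod p \<noteq> x" "(y + q) mod p \<noteq> y" using xy by auto
    have "v + q \<notin> ?S" if v: "v \<in> ?S" for v
      using disj
    proof
      assume "n \<le> 2 * q" thus ?thesis by simp
    next
      assume "(x + q) mod p \<noteq> y \<and> (y + q) mod p \<noteq> x"
      thus ?thesis using x_fix shift[OF v] by auto
    qed
    thus "(\<lambda>v. v + q) ` ?S \<inter> ?S = {}" by blast
    show "v < n \<and> v + q < n \<and> (v + q) mod q = v mod q \<and> \<alpha> ((v + q) mod p) \<noteq> \<alpha> (v mod p)"
      if v: "v \<in> ?S" for v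
    proof -
      have "v + q < n" using v by auto
      thus ?thesis using shift[OF v] xy(4,5) by auto
    qed
  qed (simp add: inj_on_def)
  thus ?thesis using card_two_residue_classes[OF xy(1-3), of "n - q"] by simp
qed

text \<open>A closed cycle cannot have exactly one colour change: after the change between the
  indices 0 and 1 the colour must return before the cycle closes at index \<open>p\<close>.\<close>

lemma two_changes:
  assumes cop: "coprime p q" and z: "z < (p::nat)" "\<alpha> z" "z' < p" "\<not> \<alpha> z'" 
  obtains x y where "x < p" "y < p" "x \<noteq> y" "\<alpha> x \<noteq> \<alpha> ((x + q) mod p)" "\<alpha> y \<noteq> \<alpha> ((y + q) mod p)"
proof -
  obtain b where b: "\<alpha> (b mod p) \<noteq> \<alpha> ((b + q) mod p)" using change_base[OF cop z] .
  define g where "g t = \<alpha> ((b + t * q) mod p)" for t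
  have g01: "g 0 \<noteq> g 1" unfolding g_def using b by simp
  have gp: "g p = g 0" unfolding g_def by simp
  have p: "1 < p" using b by (cases "p = 1") (use z in auto)
  obtain k where k: "1 \<le> k" "Suc k < Suc p" "g k \<noteq> g (Suc k)"
  proof (cases "g 0")
    case True
    thus thesis using adjacent_change[of 1 p "Suc p" g 1] g01 gp p that by auto
  next
    case False
    thus thesis using adjacent_change[of 1 1 "Suc p" g p] g01 gp p that by auto
  qed
  let ?x = "b mod p" and ?y = "(b + k * q) mod p"
  have "?x \<noteq> ?y"
    using orbit_inj[OF cop, of 0 k b] k p by auto
  thus ?thesis using that[of ?x ?y] b k z unfolding g_def by (simp add: mod_simps add.commute add.left_commute)
qed

lemma card_filter_between:
  assumes "finite A" "0 < card {s \<in> A. P s}" "card {s \<in> A. P s} < card A"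
  obtains s s' where "s \<in> A" "P s" "s' \<in> A" "\<not> P s'"
proof -
  have "{s \<in> A. P s} \<noteq> {}" using assms(2) by (metis card.empty less_irrefl)
  moreover have "{s \<in> A. P s} \<noteq> A" using assms(3) by (metis less_irrefl)
  ultimately show ?thesis using that by blast
qed

text \<open>Counted from a change, the rows with index 0 and 1 use up one row of each colour. With
  two rows of each colour, both colours still occur at the indices 2 to \<open>p - 1\<close>, so
  another change lies inside that range and shares no row with the first. The count
  \<open>u - 1\<close> is exported for finding a third pair.\<close>

lemma disjoint_changes:
  assumes cop: "coprime p q" and u: "card {x. x < (p::nat) \<and> \<alpha> x} = u" "2 \<le> u" "u + 2 \<le> p"
  obtains b t where "2 \<le> t" "Suc t < p"
    "\<alpha> (b mod p) \<noteq> \<alpha> ((b + q) mod p)" "\<alpha> ((b + t * q) mod p) \<noteq> \<alpha> ((b + Suc t * q) mod p)"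
    "card {s \<in> {2..<p}. \<alpha> ((b + s * q) mod p)} = u - 1"
proof -
  have "card {x. x < p \<and> \<alpha> x} \<noteq> 0" using u by simp
  then obtain z where z: "z < p" "\<alpha> z" by (auto simp: card_eq_0_iff)
  have "{x. x < p \<and> \<alpha> x} \<noteq> {..<p}" using u by (metis card_lessThan add_leD1 add_le_same_cancel1 not_numeral_le_zero)
  then obtain z' where z': "z' < p" "\<not> \<alpha> z'" by auto
  obtain b where b: "\<alpha> (b mod p) \<noteq> \<alpha> ((b + q) mod p)" using change_base[OF cop z z'] .
  define g where "g t = \<alpha> ((b + t * q) mod p)" for t
  have g01: "g 0 \<noteq> g 1" unfolding g_def using b by simp
  have "0 < p" using z by simp
  note bij = orbit_bij[OF cop \<open>0 < p\<close>, of b]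
  have "(\<lambda>t. (b + t * q) mod p) ` {t \<in> {..<p}. g t} = {x \<in> {..<p}. \<alpha> x}"
    using bij_betw_imp_surj_on[OF bij] unfolding g_def by auto
  moreover have "inj_on (\<lambda>t. (b + t * q) mod p) {t \<in> {..<p}. g t}"
    by (rule inj_on_subset[OF bij_betw_imp_inj_on[OF bij]]) auto
  ultimately have "card {t \<in> {..<p}. g t} = card {x \<in> {..<p}. \<alpha> x}" by (metis card_image)
  hence cu: "card {t \<in> {..<p}. g t} = u" using u(1) by simp
  obtain k where k: "{t \<in> {..<p}. g t} = insert k {t \<in> {2..<p}. g t}" "k < 2"
  proof (cases "g 0")
    case True
    have "{t \<in> {..<p}. g t} = insert 0 {t \<in> {2..<p}. g t}"
      using True g01 \<open>0 < p\<close> by (auto simp: numeral_2_eq_2 Suc_le_eq) (metis One_nat_def Suc_lessI neq0_conv)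
    thus ?thesis using that by simp
  next
    case False
    have "{t \<in> {..<p}. g t} = insert 1 {t \<in> {2..<p}. g t}"
      using False g01 u by (auto simp: numeral_2_eq_2 Suc_le_eq) (metis One_nat_def Suc_lessI neq0_conv)
    thus ?thesis using that by simp
  qed
  have c2: "card {t \<in> {2..<p}. g t} = u - 1"
    using k(2) cu unfolding k(1) by (subst (asm) card_insert_disjoint) auto
  have "0 < card {t \<in> {2..<p}. g t}" "card {t \<in> {2..<p}. g t} < card {2..<p}"
    unfolding c2 using u by simp_all
  then obtain s s' where "s \<in> {2..<p}" "g s" "s' \<in> {2..<p}" "\<not> g s'"
    by (rule card_filter_between[OF finite_atLeastLessThan])
  hence s: "2 \<le> s" "s < p" "g s" and s': "2 \<le> s'" "s' < p" "\<not> g s'" by simp_all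
  obtain t where "2 \<le> t" "Suc t < p" "g t \<noteq> g (Suc t)" using adjacent_change[OF s s'] .
  thus ?thesis using that[of t b] b c2 unfolding g_def by simp
qed

lemma mismatches_middle:
  assumes cop: "coprime p q" and q: "0 < q" and u: "card {x. x < p \<and> \<alpha> x} = u" "2 \<le> u" "u + 2 \<le> p"
  shows "2 * ((n - q) div p) \<le> card (mismatches p q n \<alpha> \<beta>)"
proof -
  obtain b t where t: "2 \<le> t" "Suc t < p"
    "\<alpha> (b mod p) \<noteq> \<alpha> ((b + q) mod p)" "\<alpha> ((b + t * q) mod p) \<noteq> \<alpha> ((b + Suc t * q) mod p)"
    using disjoint_changes[OF cop u] by metis
  let ?x = "\<lambda>t. (b + t * q) mod p"
  have step: "(?x s + q) mod p = ?x (Suc s)" for s by (simp add: mod_simps add.commute add.left_commute)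
  have p: "0 < p" using t by simp
  have ne: "?x s = ?x s' \<longleftrightarrow> s = s'" if "s < p" "s' < p" for s s' using orbit_inj[OF cop that] by auto
  have ge: "(n - q) div p \<le> (n - q + p - 1 - ?x s) div p" for s
    by (rule div_le_mono) (use mod_less_divisor[OF p, of "b + s * q"] in linarith)
  have "\<alpha> (?x 0) \<noteq> \<alpha> ((?x 0 + q) mod p)" unfolding step using t(3) by simp
  moreover have "\<alpha> (?x t) \<noteq> \<alpha> ((?x t + q) mod p)" unfolding step using t(4) by simp
  moreover have "?x 0 \<noteq> ?x t" by (subst ne) (use t in auto)
  moreover have "(?x 0 + q) mod p \<noteq> ?x t" unfolding step by (subst ne) (use t in auto)
  moreover have "(?x t + q) mod p \<noteq> ?x 0" unfolding step by (subst ne) (use t in auto)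
  ultimately have "(n - q + p - 1 - ?x 0) div p + (n - q + p - 1 - ?x t) div p \<le> card (mismatches p q n \<alpha> \<beta>)"
    using p by (intro mismatches_two_changes[OF q]) auto
  thus ?thesis using ge[of 0] ge[of t] by linarith
qed

text \<open>Deleting two disjoint pairs of adjacent rows of different colours from the cycle leaves a
  word in which the colour changes again, between rows at distance 1 or 3 on the cycle.\<close>

lemma mismatches_middle_strict:
  assumes cop: "coprime p q" and q: "0 < q" and u: "card {x. x < p \<and> \<alpha> x} = u" "3 \<le> u" "u + 3 \<le> p"
    and n: "3 * q + p \<le> n"
  shows "2 * ((n - q) div p) < card (mismatches p q n \<alpha> \<beta>)"
proof -
  have u2: "2 \<le> u" "u + 2 \<le> p" using u by auto
  obtain b t where t: "2 \<le> t" "Suc t < p"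
    "\<alpha> (b mod p) \<noteq> \<alpha> ((b + q) mod p)" "\<alpha> ((b + t * q) mod p) \<noteq> \<alpha> ((b + Suc t * q) mod p)"
    and card: "card {s \<in> {2..<p}. \<alpha> ((b + s * q) mod p)} = u - 1"
    by (rule disjoint_changes[OF cop u(1) u2])
  define x where "x t = (b + t * q) mod p" for t
  define g where "g t = \<alpha> (x t)" for t
  have p: "0 < p" using t by simp
  have xp: "x s < p" for s unfolding x_def using p by simp
  have ne: "x s = x s' \<longleftrightarrow> s = s'" if "s < p" "s' < p" for s s'
    unfolding x_def using orbit_inj[OF cop that] by auto
  have step: "(v + d * q) mod p = x (s + d)" if "v mod p = x s" for v s d
  proof -
    have "(v + d * q) mod p = (x s + d * q) mod p" using that by (metis mod_add_left_eq)
    thus ?thesis unfolding x_def by (simp add: mod_add_left_eq add_mult_distrib add.assoc)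
  qed
  have g01: "g 0 \<noteq> g 1" and gt: "g t \<noteq> g (Suc t)" using t unfolding g_def x_def by simp_all
  let ?R = "{2..<p} - {t, Suc t}"
  obtain k where k: "k \<in> {t, Suc t}" "{s \<in> {2..<p}. g s} = insert k {s \<in> ?R. g s}"
  proof (cases "g t")
    case True
    thus ?thesis using gt t by (intro that[of t]) auto
  next
    case False
    thus ?thesis using gt t by (intro that[of "Suc t"]) auto
  qed
  have "card {s \<in> {2..<p}. g s} = Suc (card {s \<in> ?R. g s})"
    unfolding k(2) by (rule card_insert_disjoint) (use k(1) in auto)
  hence cR: "card {s \<in> ?R. g s} = u - 2" using card unfolding g_def x_def by simp
  have "card ?R = card {2..<p} - card {t, Suc t}" by (rule card_Diff_subset) (use t in auto)
  hence "card ?R = p - 4" using t by simp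
  \<comment> \<open>The two deleted pairs contain two rows of each colour; \<open>3 <= u\<close> and
    \<open>u + 3 <= p\<close> leave both colours among the rest.\<close>
  hence "0 < card {s \<in> ?R. g s}" "card {s \<in> ?R. g s} < card ?R"
    unfolding cR using u(2,3) by simp_all
  then obtain s s' where s: "s \<in> ?R" "g s" "s' \<in> ?R" "\<not> g s'"
    by (rule card_filter_between[OF finite_Diff[OF finite_atLeastLessThan]])
  \<comment> \<open>\<open>r\<close> lists the remaining indices in increasing order, jumping over
    \<open>t\<close> and \<open>t + 1\<close>. Successive ones are at distance 1, or 3 across the
    gap.\<close>
  define r where "r k = (if k < t then k else k + 2)" for k
  define r' where "r' k = (if k < t then k else k - 2)" for k
  have r': "r (r' k) = k" "2 \<le> r' k" "r' k < p - 2" if "k \<in> ?R" for k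
    using that t unfolding r_def r'_def by auto
  obtain k where k: "2 \<le> k" "Suc k < p - 2" "g (r k) \<noteq> g (r (Suc k))"
    using adjacent_change[of 2 "r' s" "p - 2" "\<lambda>k. g (r k)" "r' s'"] r'[OF s(1)] r'[OF s(3)] s by auto
  define d where "d = r (Suc k) - r k"
  have rk: "r k \<in> ?R" "r (Suc k) \<in> ?R" "r k + d = r (Suc k)" "d \<in> {1, 3}"
    using k t unfolding r_def d_def by auto
  \<comment> \<open>Below \<open>n - 3 * q\<close> a shift by \<open>q\<close> or by
    \<open>3 * q\<close> stays inside the word, so \<open>?S2\<close> suits both distances; one cell
    in it is enough for strictness.\<close>
  let ?S1 = "{v. v < n - q \<and> (v mod p = x 0 \<or> v mod p = x t)}" and ?S2 = "{v. v < n - 3 * q \<and> v mod p = x (r k)}"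
  define \<pi> where "\<pi> v = (if v mod p = x (r k) then v + d * q else v + q)" for v
  have rne: "r k \<noteq> 0" "r k \<noteq> 1" "r k \<noteq> t" "r k \<noteq> Suc t" "r k < p"
    "r (Suc k) \<noteq> 0" "r (Suc k) \<noteq> 1" "r (Suc k) \<noteq> t" "r (Suc k) \<noteq> Suc t" "r (Suc k) < p" "r k \<noteq> r (Suc k)"
    using rk by auto
  have mp: "\<pi> v mod p = x 1" if "v mod p = x 0" for v
    using step[OF that, of 1] that rne p by (simp add: \<pi>_def ne)
  have mp': "\<pi> v mod p = x (Suc t)" if "v mod p = x t" for v
    using step[OF that, of 1] that rne t by (simp add: \<pi>_def ne)
  have mp'': "\<pi> v mod p = x (r (Suc k))" if "v mod p = x (r k)" for v
    using step[OF that, of d] that rk(3) by (simp add: \<pi>_def)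
  have P: "0 < p" "1 < p" "t < p" "Suc t < p" "r k < p" "r (Suc k) < p" using t rne by simp_all
  have x: "x 0 \<noteq> x 1" "x 0 \<noteq> x t" "x 0 \<noteq> x (Suc t)" "x 1 \<noteq> x t" "x 1 \<noteq> x (Suc t)" "x t \<noteq> x (Suc t)"
    "x 0 \<noteq> x (r k)" "x 1 \<noteq> x (r k)" "x t \<noteq> x (r k)" "x (Suc t) \<noteq> x (r k)"
    "x 0 \<noteq> x (r (Suc k))" "x 1 \<noteq> x (r (Suc k))" "x t \<noteq> x (r (Suc k))" "x (Suc t) \<noteq> x (r (Suc k))"
    "x (r k) \<noteq> x (r (Suc k))"
    using rne t P by (simp_all add: ne)
  have "card (?S1 \<union> ?S2) \<le> card (mismatches p q n \<alpha> \<beta>)"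
  proof (rule card_le_mismatches[where \<pi> = \<pi>])
    show "inj_on \<pi> (?S1 \<union> ?S2)"
    proof (rule inj_onI)
      fix v w assume vw: "v \<in> ?S1 \<union> ?S2" "w \<in> ?S1 \<union> ?S2" "\<pi> v = \<pi> w"
      have "v mod p = x (r k) \<longleftrightarrow> w mod p = x (r k)"
        using vw mp[of v] mp'[of v] mp''[of v] mp[of w] mp'[of w] mp''[of w] x by auto
      thus "v = w" using vw(3) unfolding \<pi>_def by (auto split: if_splits)
    qed
    show "\<pi> ` (?S1 \<union> ?S2) \<inter> (?S1 \<union> ?S2) = {}"
    proof -
      have "\<pi> v \<notin> ?S1 \<union> ?S2" if "v \<in> ?S1 \<union> ?S2" for v
        using that mp[of v] mp'[of v] mp''[of v] x by auto
      thus ?thesis by blast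
    qed
    show "v < n \<and> \<pi> v < n \<and> \<pi> v mod q = v mod q \<and> \<alpha> (\<pi> v mod p) \<noteq> \<alpha> (v mod p)"
      if "v \<in> ?S1 \<union> ?S2" for v
    proof -
      have "\<alpha> (\<pi> v mod p) \<noteq> \<alpha> (v mod p)"
        using that mp[of v] mp'[of v] mp''[of v] g01 gt k(3) unfolding g_def by force
      moreover have "\<pi> v < n"
      proof (cases "v mod p = x (r k)")
        case True
        hence "v < n - 3 * q" using that x(7,9) by auto
        moreover have "d * q \<le> 3 * q" using rk(4) by auto
        ultimately have "v + d * q < n" by linarith
        thus ?thesis using True unfolding \<pi>_def by simp
      next
        case False
        hence "v < n - q" using that by auto
        hence "v + q < n" by linarith
        thus ?thesis using False unfolding \<pi>_def by simp
      qed
      moreover have "\<pi> v mod q = v mod q" unfolding \<pi>_def by simp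
      ultimately show ?thesis using that by auto
    qed
  qed
  moreover have "card (?S1 \<union> ?S2) = card ?S1 + card ?S2"
    by (rule card_Un_disjoint) (use x in auto)
  moreover have "1 \<le> card ?S2"
  proof -
    have "1 \<le> (n - 3 * q) div p" using n p by (simp add: Suc_le_eq div_greater_zero_iff)
    thus ?thesis using card_residue_class_ge[OF xp, of "n - 3 * q" "r k"] by linarith
  qed
  moreover have "2 * ((n - q) div p) \<le> card ?S1"
  proof -
    have "(n - q) div p \<le> (n - q + p - 1 - x s) div p" for s
      by (rule div_le_mono) (use xp[of s] in linarith)
    from this[of 0] this[of t] show ?thesis
      using card_two_residue_classes[OF xp[of 0] xp[of t] x(2), of "n - q"] by linarith
  qed
  ultimately show ?thesis by linarith
qed

text \<open>\<open>cross\<close> settles the colourings with a single \<open>True\<close> or a single \<open>False\<close> row.\<close>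

lemma not_separableI:
  assumes cop: "coprime p q" and pq: "2 < p" "p < q" and n: "2 * q \<le> n" "n \<le> p * q"
    and cross: "\<And>j. j < n \<Longrightarrow> h + 3 \<le> class_size p n j + class_size q n j"
    and middle: "\<And>\<alpha> \<beta>. 2 \<le> card {x. x < p \<and> \<alpha> x} \<Longrightarrow> card {x. x < p \<and> \<alpha> x} + 2 \<le> p \<Longrightarrow>
      \<exists>j<n. \<alpha> (j mod p) \<and> \<beta> (j mod q) \<Longrightarrow> \<exists>j<n. \<not> \<alpha> (j mod p) \<and> \<not> \<beta> (j mod q) \<Longrightarrow>
      h < card (mismatches p q n \<alpha> \<beta>)"
  shows "\<not> separable p q n h"
proof
  assume "separable p q n h"
  then obtain \<alpha> \<beta> i j where ij: "i < n" "\<alpha> (i mod p)" "\<beta> (i mod q)"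
    "j < n" "\<not> \<alpha> (j mod p)" "\<not> \<beta> (j mod q)" and h: "card (mismatches p q n \<alpha> \<beta>) \<le> h"
    unfolding separable_def by blast
  have p: "0 < p" "0 < q" using pq by auto
  have single: "h < card (mismatches p q n \<alpha> \<beta>)"
    if one: "card {x. x < p \<and> \<alpha> x} = 1" and i: "i < n" "\<alpha> (i mod p)" "\<beta> (i mod q)"
    for \<alpha> \<beta> :: "nat \<Rightarrow> bool" and i
  proof -
    from one obtain x0 where "{x. x < p \<and> \<alpha> x} = {x0}" by (rule card_1_singletonE)
    hence set: "x < p \<and> \<alpha> x \<longleftrightarrow> x = x0" for x by blast
    hence "\<alpha> (v mod p) \<longleftrightarrow> v mod p = i mod p" for v
      using set[of "v mod p"] set[of "i mod p"] i p by auto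
    hence "card {v. v < n \<and> \<alpha> (v mod p)} = class_size p n i" unfolding class_size_def by simp
    moreover have "2 * 1 \<le> n div q" using n p by (simp add: less_eq_div_iff_mult_less_eq)
    ultimately show ?thesis
      using mismatches_small_side[where \<beta> = \<beta> and j = i, OF cop p n(2) one _ i(3)] cross[OF i(1)] by auto
  qed
  have "finite {x. x < p \<and> \<alpha> x}" "i mod p \<in> {x. x < p \<and> \<alpha> x}" using p ij by auto
  hence "card {x. x < p \<and> \<alpha> x} \<noteq> 0" by auto
  moreover have "finite {x. x < p \<and> \<not> \<alpha> x}" "j mod p \<in> {x. x < p \<and> \<not> \<alpha> x}" using p ij by auto
  hence "card {x. x < p \<and> \<not> \<alpha> x} \<noteq> 0" by auto
  moreover have "card {x. x < p \<and> \<alpha> x} + card {x. x < p \<and> \<not> \<alpha> x} = p"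
  proof -
    have "{..<p} = {x. x < p \<and> \<alpha> x} \<union> {x. x < p \<and> \<not> \<alpha> x}" by auto
    moreover have "card \<dots> = card {x. x < p \<and> \<alpha> x} + card {x. x < p \<and> \<not> \<alpha> x}"
      by (rule card_Un_disjoint) auto
    ultimately show ?thesis by (metis card_lessThan)
  qed
  ultimately consider "card {x. x < p \<and> \<alpha> x} = 1" | "card {x. x < p \<and> \<not> \<alpha> x} = 1"
    | "2 \<le> card {x. x < p \<and> \<alpha> x}" "card {x. x < p \<and> \<alpha> x} + 2 \<le> p" by linarith
  thus False
  proof cases
    case 1
    thus ?thesis using single[of \<alpha> i \<beta>] ij h by simp
  next
    case 2
    thus ?thesis using single[of "\<lambda>x. \<not> \<alpha> x" j "\<lambda>y. \<not> \<beta> y"] ij h by (simp add: mismatches_Not)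
  next
    case 3
    thus ?thesis using middle[of \<alpha> \<beta>] ij h by auto
  qed
qed

text \<open>Exactly two rows of one colour leave no third pair, so the count by columns takes over:
  two rows of at least \<open>k + 1\<close> cells and a column of at least 4 give
  \<open>2 * (k + 1) + 4 - 4 > 2 * k\<close>. The four cells come from
  \<open>3 <= k\<close>.\<close>

lemma middle_strict:
  assumes cop: "coprime p q" and pq: "2 < p" "p < q" and n: "n \<le> p * q" "(k + 1) * q \<le> n" "3 \<le> k"
    and u: "2 \<le> card {x. x < p \<and> \<alpha> x}" "card {x. x < p \<and> \<alpha> x} + 2 \<le> p"
    and ij: "i < n" "\<alpha> (i mod p)" "\<beta> (i mod q)" "j < n" "\<not> \<alpha> (j mod p)" "\<not> \<beta> (j mod q)"
  shows "2 * k < card (mismatches p q n \<alpha> \<beta>)"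
proof -
  have p: "0 < p" "0 < q" using pq by auto
  have "k * q \<le> n - q" using n by simp
  have "k * p \<le> k * q" using pq by simp
  hence "k * p \<le> n - q" using \<open>k * q \<le> n - q\<close> by linarith
  hence np: "k \<le> (n - q) div p" using p by (simp add: less_eq_div_iff_mult_less_eq)
  have "(k + 1) * p \<le> (k + 1) * q" using pq by (intro mult_le_mono2) simp
  hence A: "k + 1 \<le> n div p" using n p by (subst less_eq_div_iff_mult_less_eq) linarith+
  have "4 * q \<le> (k + 1) * q" using n(3) by (intro mult_le_mono1) simp
  hence q4: "4 * q \<le> n" using n by linarith
  have two: "2 * k < card (mismatches p q n \<alpha> \<beta>)"
    if "card {x. x < p \<and> \<alpha> x} = 2" "i < n" "\<beta> (i mod q)" for \<alpha> \<beta> :: "nat \<Rightarrow> bool" and i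
  proof -
    have "4 \<le> n div q" using q4 p by (simp add: less_eq_div_iff_mult_less_eq)
    moreover have "card {v. v < n \<and> \<alpha> (v mod p)} + class_size q n i \<le> card (mismatches p q n \<alpha> \<beta>) + 2 * 2"
      using mismatches_small_side[where \<beta> = \<beta> and j = i, OF cop p n(1) that(1) _ that(3)] \<open>4 \<le> n div q\<close> by simp
    ultimately show ?thesis
      using card_rows_ge[OF p(1), of \<alpha> n] class_size_ge[OF p(2), of n i] that A by simp
  qed
  have compl: "card {x. x < p \<and> \<alpha> x} + card {x. x < p \<and> \<not> \<alpha> x} = p"
  proof -
    have "{..<p} = {x. x < p \<and> \<alpha> x} \<union> {x. x < p \<and> \<not> \<alpha> x}" by auto
    moreover have "card \<dots> = card {x. x < p \<and> \<alpha> x} + card {x. x < p \<and> \<not> \<alpha> x}"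
      by (rule card_Un_disjoint) auto
    ultimately show ?thesis by (metis card_lessThan)
  qed
  consider "card {x. x < p \<and> \<alpha> x} = 2" | "card {x. x < p \<and> \<not> \<alpha> x} = 2"
    | "3 \<le> card {x. x < p \<and> \<alpha> x}" "card {x. x < p \<and> \<alpha> x} + 3 \<le> p" using u compl by linarith
  thus ?thesis
  proof cases
    case 1
    thus ?thesis using two[of \<alpha> i \<beta>] ij by simp
  next
    case 2
    thus ?thesis using two[of "\<lambda>x. \<not> \<alpha> x" j "\<lambda>y. \<not> \<beta> y"] ij by (simp add: mismatches_Not)
  next
    case 3
    have "3 * q + p \<le> n" using q4 pq by linarith
    from mismatches_middle_strict[OF cop p(2) refl 3 this] show ?thesis using np
      by (meson le_less_trans mult_le_mono2)
  qed
qed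

subsection \<open>Neighbouring fractions\<close>

text \<open>Cross multiplication is also right for zero denominators, except for 0 / 0, whose cross
  products all vanish.\<close>

lemma fval_le_iff:
  assumes "0 < fst u + snd u" "0 < fst v + snd v"
  shows "fval u \<le> fval v \<longleftrightarrow> fst u * snd v \<le> fst v * snd u"
proof (cases "snd u = 0 \<or> snd v = 0")
  case True
  thus ?thesis using assms unfolding fval_def by auto
next
  case False
  have "fval u \<le> fval v \<longleftrightarrow> real (fst u) * real (snd v) \<le> real (fst v) * real (snd u)"
    using False unfolding fval_def by (simp add: field_simps)
  thus ?thesis by (simp flip: of_nat_mult)
qed

lemma fval_less_iff:
  assumes "0 < fst u + snd u" "0 < fst v + snd v"
  shows "fval u < fval v \<longleftrightarrow> fst u * snd v < fst v * snd u"
  using fval_le_iff[OF assms(2,1)] by (simp add: not_le[symmetric])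

lemma Fracs_upto_iff: "x \<in> Fracs_upto k \<longleftrightarrow> coprime (fst x) (snd x) \<and> fst x + snd x \<le> k"
  unfolding Fracs_upto_def Fracs_def coprime_iff_gcd_eq_1 by (cases x) simp

lemma Fracs_upto_pos: "x \<in> Fracs_upto k \<Longrightarrow> 0 < fst x + snd x"
  unfolding Fracs_upto_iff by (rule ccontr) simp

lemma fval_inj:
  assumes "x \<in> Fracs_upto k" "y \<in> Fracs_upto k" "fval x = fval y"
  shows "x = y"
proof -
  note pos = assms(1,2)[THEN Fracs_upto_pos]
  have "fst x * snd y = fst y * snd x"
    using fval_le_iff[OF pos] fval_le_iff[OF pos(2,1)] assms(3) by simp
  moreover have "coprime (fst x) (snd x)" "coprime (fst y) (snd y)" using assms by (simp_all add: Fracs_upto_iff)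
  ultimately show ?thesis using coprime_crossproduct_nat by (auto simp: prod_eq_iff)
qed

lemma Left_eqI:
  assumes "x \<in> Fracs_upto k" "fval x \<le> \<xi>"
    and max: "\<And>y. y \<in> Fracs_upto k \<Longrightarrow> fval y \<le> \<xi> \<Longrightarrow> fval y \<le> fval x"
  shows "Left k \<xi> = x"
  unfolding Left_def arg_max_def
proof (rule some_equality)
  show "is_arg_max fval (\<lambda>y. y \<in> Fracs_upto k \<and> fval y \<le> \<xi>) x"
    using assms unfolding is_arg_max_def by (auto simp: not_less)
  fix z assume z: "is_arg_max fval (\<lambda>y. y \<in> Fracs_upto k \<and> fval y \<le> \<xi>) z"
  hence "z \<in> Fracs_upto k" "fval z \<le> \<xi>" "fval x \<le> fval z"
    using assms(1,2) unfolding is_arg_max_def by (blast, blast, meson not_less)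
  thus "z = x" using max[of z] by (intro fval_inj[OF _ assms(1)]) simp_all
qed

lemma Right_eqI:
  assumes "x \<in> Fracs_upto k" "\<xi> \<le> fval x"
    and min: "\<And>y. y \<in> Fracs_upto k \<Longrightarrow> \<xi> \<le> fval y \<Longrightarrow> fval x \<le> fval y"
  shows "Right k \<xi> = x"
  unfolding Right_def arg_min_def
proof (rule some_equality)
  show "is_arg_min fval (\<lambda>y. y \<in> Fracs_upto k \<and> \<xi> \<le> fval y) x"
    using assms unfolding is_arg_min_def by (auto simp: not_less)
  fix z assume z: "is_arg_min fval (\<lambda>y. y \<in> Fracs_upto k \<and> \<xi> \<le> fval y) z"
  hence "z \<in> Fracs_upto k" "\<xi> \<le> fval z" "fval z \<le> fval x"
    using assms(1,2) unfolding is_arg_min_def by (blast, blast, meson not_less)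
  thus "z = x" using min[of z] by (intro fval_inj[OF _ assms(1)]) simp_all
qed

text \<open>Reduction divides the sum \<open>N + 1\<close> by at least 2, so the reduced form
  belongs to \<open>Fracs_upto N\<close> and is the neighbour on both sides. The case
  \<open>A = 0\<close>, with reduced form 1 / 0, is included.\<close>

lemma Left_Right_not_coprime:
  assumes "0 < i" "\<not> coprime i A" "i + A = Suc N"
  shows "Left N (fval (i, A)) = (i div gcd i A, A div gcd i A)"
    and "Right N (fval (i, A)) = (i div gcd i A, A div gcd i A)"
proof -
  define g where "g = gcd i A"
  define x y where "x = i div g" and "y = A div g"
  have xy: "i = x * g" "A = y * g" unfolding x_def y_def g_def by simp_all
  have g: "2 \<le> g"
  proof -
    have "g \<noteq> 0" using assms(1) unfolding g_def by simp
    moreover have "g \<noteq> 1" using assms(2) unfolding g_def coprime_iff_gcd_eq_1 .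
    ultimately show ?thesis by linarith
  qed
  have cop: "coprime x y"
    unfolding x_def y_def g_def using assms by (intro div_gcd_coprime) auto
  have "0 < x" using assms(1) xy(1) by (cases x) simp_all
  have "Suc N = (x + y) * g" using assms(3) xy by (simp add: algebra_simps)
  moreover have "(x + y) * 2 \<le> (x + y) * g" using g by (rule mult_le_mono2)
  ultimately have "(x + y) * 2 \<le> Suc N" by simp
  hence le: "x + y \<le> N" using \<open>0 < x\<close> by (cases "x + y \<le> N") simp_all
  have mem: "(x, y) \<in> Fracs_upto N" using cop le unfolding Fracs_upto_iff by simp
  have eq: "fval (x, y) = fval (i, A)"
  proof (rule antisym)
    show "fval (x, y) \<le> fval (i, A)" "fval (i, A) \<le> fval (x, y)"
      unfolding xy using \<open>0 < x\<close> g by (subst fval_le_iff; simp)+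
  qed
  show "Left N (fval (i, A)) = (i div gcd i A, A div gcd i A)"
    unfolding g_def[symmetric] x_def[symmetric] y_def[symmetric]
    by (rule Left_eqI[OF mem]) (simp_all add: eq)
  show "Right N (fval (i, A)) = (i div gcd i A, A div gcd i A)"
    unfolding g_def[symmetric] x_def[symmetric] y_def[symmetric]
    by (rule Right_eqI[OF mem]) (simp_all add: eq)
qed

text \<open>A fraction \<open>x / y\<close> strictly between the neighbours \<open>a / b\<close> and \<open>c / d\<close> is
  \<open>(l * c + m * a) / (l * d + m * b)\<close> with positive integers \<open>l\<close> and \<open>m\<close>.\<close>

lemma between_neighbours:
  fixes a b c d x y :: nat
  assumes det: "b * c = a * d + 1" and xy: "a * y < x * b" "x * d < c * y"
  shows "a + b + c + d \<le> x + y"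
proof -
  define l m where "l = int x * b - int a * y" and "m = int c * y - int x * d"
  have det': "int b * c = int a * d + 1" using arg_cong[OF det, of int] by simp
  have lm: "1 \<le> l" "1 \<le> m" using xy unfolding l_def m_def
    by (simp_all add: of_nat_mult[symmetric] less_imp_of_nat_less del: of_nat_mult)
  have "int x = int x * (int b * c - int a * d)" using det' by simp
  also have "\<dots> = l * c + m * a" unfolding l_def m_def by (simp add: algebra_simps)
  finally have x: "int x = l * c + m * a" .
  have "int y = int y * (int b * c - int a * d)" using det' by simp
  also have "\<dots> = l * d + m * b" unfolding l_def m_def by (simp add: algebra_simps)
  finally have y: "int y = l * d + m * b" .
  have "int c \<le> l * c" "int a \<le> m * a" "int d \<le> l * d" "int b \<le> m * b"
    using lm mult_right_mono[of 1 l] mult_right_mono[of 1 m] by fastforce+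
  hence "int (a + b + c + d) \<le> int (x + y)" unfolding of_nat_add x y by linarith
  thus ?thesis by linarith
qed

lemma det_coprime:
  fixes a b c d :: nat
  assumes "b * c = a * d + 1"
  shows "coprime a b" "coprime c d"
proof -
  have "g = 1" if "g dvd a \<and> g dvd b \<or> g dvd c \<and> g dvd d" for g :: nat
  proof -
    have "g dvd b * c" "g dvd a * d" using that by auto
    hence "g dvd 1" using assms by (metis dvd_add_right_iff)
    thus ?thesis by simp
  qed
  note * = this
  show "coprime a b" "coprime c d" by (rule coprimeI; use * in force)+
qed

text \<open>\<open>i / A\<close> is the mediant of \<open>a / b\<close> and \<open>c / d\<close>. A
  fraction strictly between these two has sum at least \<open>a + b + c + d = N + 1\<close>, so
  \<open>Fracs_upto N\<close> contains none.\<close>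

lemma Left_Right_neighbours:
  assumes det: "b * c = a * d + 1" and i: "a + c = i" "b + d = A" "i + A = Suc N"
  shows "Left N (fval (i, A)) = (a, b)" and "Right N (fval (i, A)) = (c, d)"
proof -
  have pos: "0 < b" "0 < c" using det by (auto intro: gr0I)
  have mem: "(a, b) \<in> Fracs_upto N" "(c, d) \<in> Fracs_upto N"
    using det_coprime[OF det] i pos unfolding Fracs_upto_iff by auto
  have mlr: "a * A \<le> i * b" "i * d \<le> c * A" using det i by (auto simp: algebra_simps)
  have no: False if "y \<in> Fracs_upto N" "a * snd y < fst y * b" "fst y * d < c * snd y" for y
    using between_neighbours[OF det that(2,3)] that(1) i unfolding Fracs_upto_iff by linarith
  show "Left N (fval (i, A)) = (a, b)"
  proof (rule Left_eqI[OF mem(1)])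
    show "fval (a, b) \<le> fval (i, A)" using mlr pos i by (simp add: fval_le_iff)
    fix y assume y: "y \<in> Fracs_upto N" "fval y \<le> fval (i, A)"
    show "fval y \<le> fval (a, b)"
    proof (rule ccontr)
      assume "\<not> ?thesis"
      hence "a * snd y < fst y * b" using Fracs_upto_pos[OF y(1)] pos by (simp add: fval_le_iff)
      moreover have "fst y * A \<le> i * snd y"
        using y(2) Fracs_upto_pos[OF y(1)] pos i by (simp add: fval_le_iff)
      hence "fst y * b + fst y * d \<le> a * snd y + c * snd y" unfolding i(1,2)[symmetric] by (simp add: algebra_simps)
      ultimately show False using no[OF y(1)] by linarith
    qed
  qed
  show "Right N (fval (i, A)) = (c, d)"
  proof (rule Right_eqI[OF mem(2)])
    show "fval (i, A) \<le> fval (c, d)" using mlr pos i by (simp add: fval_le_iff)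
    fix y assume y: "y \<in> Fracs_upto N" "fval (i, A) \<le> fval y"
    show "fval (c, d) \<le> fval y"
    proof (rule ccontr)
      assume "\<not> ?thesis"
      hence "fst y * d < c * snd y" using Fracs_upto_pos[OF y(1)] pos by (simp add: fval_le_iff)
      moreover have "i * snd y \<le> fst y * A"
        using y(2) Fracs_upto_pos[OF y(1)] pos i by (simp add: fval_le_iff)
      hence "a * snd y + c * snd y \<le> fst y * b + fst y * d" unfolding i(1,2)[symmetric] by (simp add: algebra_simps)
      ultimately show False using no[OF y(1)] by linarith
    qed
  qed
qed

text \<open>For \<open>N = a + b + c + d\<close> and \<open>i = a + c\<close> the determinant
  condition reads \<open>i * (a + b) = a * N + 1\<close>. So \<open>a + b\<close> is the inverse
  \<open>s\<close> of \<open>i\<close> modulo \<open>N\<close>, \<open>a\<close> is the quotient,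
  and the other entries are differences.\<close>

lemma neighbours_of_inverse:
  fixes i s N :: nat
  assumes "0 < i" "i < N" "s < N" "i * s mod N = 1"
  defines "a \<equiv> i * s div N"
  shows "a \<le> s" "a \<le> i" "i - a \<le> N - s" "(s - a) + (N - s - (i - a)) = N - i"
    "(s - a) * (i - a) = a * (N - s - (i - a)) + 1"
proof -
  have is_eq: "i * s = a * N + 1" unfolding a_def using assms(4) by (metis div_mult_mod_eq)
  have "a * N < s * N"
  proof -
    have "i * s \<le> N * s" using assms by simp
    hence "a * N + 1 \<le> s * N" unfolding is_eq by (simp add: mult.commute)
    thus ?thesis by linarith
  qed
  hence as: "a < s" by simp
  have "i * s < i * N" using assms by simp
  hence "a * N < i * N" using is_eq by linarith
  hence ai: "a < i" by simp
  show "a \<le> s" "a \<le> i" using as ai by simp_all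
  obtain b where b: "s = a + b" using as less_imp_add_positive by blast
  obtain c where c: "i = a + c" using ai less_imp_add_positive by blast
  obtain A where A: "N = i + A" "0 < A" using assms(2) less_imp_add_positive by blast
  \<comment> \<open>The aim is \<open>b <= A\<close>, which keeps the last entry
    \<open>d = A - b\<close> from being truncated.\<close>
  have "b * N = s * A + 1"
    using is_eq unfolding A(1) b by (simp add: algebra_simps)
  also have "s * A + 1 \<le> s * A + A" using A by simp
  also have "\<dots> \<le> N * A" using assms(3) by (metis Suc_leI add.commute mult_Suc mult_le_mono1)
  finally have "b * N \<le> A * N" by (simp add: mult.commute)
  hence "b \<le> A" using assms by simp
  then obtain d where d: "A = b + d" using le_Suc_ex by blast
  have N: "N - s = c + d" "N - i = b + d" unfolding A(1) b c d by simp_all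
  show "i - a \<le> N - s" unfolding N using c by simp
  show "(s - a) + (N - s - (i - a)) = N - i" unfolding N using b c by simp
  have "(a + c) * (a + b) = a * (a + c + (b + d)) + 1" using is_eq unfolding A(1) b c d .
  hence "b * c = a * d + 1" by (simp add: algebra_simps)
  thus "(s - a) * (i - a) = a * (N - s - (i - a)) + 1" unfolding N using b c by simp
qed

lemma neighbours_exist:
  fixes i A :: nat
  assumes "coprime i A" "0 < i" "0 < A"
  obtains a b c d where "a + c = i" "b + d = A" "b * c = a * d + 1"
proof -
  have "coprime i (i + A)" using assms(1) unfolding coprime_iff_gcd_eq_1 by simp
  then obtain s where s: "[i * s = 1] (mod i + A)" using cong_solve_coprime_nat[of i "i + A"] by auto
  have "i * (s mod (i + A)) mod (i + A) = 1"
  proof -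
    have "1 < i + A" using assms(2,3) by simp
    thus ?thesis using s unfolding Cong.cong_def by (simp add: mod_mult_right_eq)
  qed
  from neighbours_of_inverse[OF assms(2) _ _ this] assms(2,3) show ?thesis
    by (intro that[of "i * (s mod (i + A)) div (i + A)" "i - i * (s mod (i + A)) div (i + A)"]) simp_all
qed

subsection \<open>Lengths given by a cross\<close>

text \<open>\<open>cross\<close> handles a single row of one colour, \<open>middle\<close> two or
  more rows of each. The first alternative of \<open>middle\<close> makes the cut bound at least
  \<open>2 * (k + 1)\<close>; the second assures only \<open>2 * k = h\<close> and relies on the
  additional mismatch. \<open>witness\<close> is a cross that is still cheap one position
  earlier.\<close>

lemma threshold_piece:
  assumes cop: "coprime p q" and pq: "2 < p" "p < q" and xy: "x \<in> \<Sigma>" "y \<in> \<Sigma>" "x \<noteq> y"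
    and n: "2 * q \<le> n" "n \<le> p * q"
    and cross: "\<And>j. j < n \<Longrightarrow> h + 3 \<le> class_size p n j + class_size q n j"
    and k: "h = 2 * k \<or> h = 2 * k + 1"
    and middle: "(k + 1) * p + q \<le> n \<or> h = 2 * k \<and> 3 \<le> k \<and> (k + 1) * q \<le> n"
    and witness: "v < n - 1" "class_size p (n - 1) v + class_size q (n - 1) v \<le> h + 2"
  shows "threshold \<Sigma> h p q = n"
proof (rule threshold_eqI[OF cop _ _ xy])
  have p: "0 < p" "0 < q" using pq by auto
  show "0 < p" "0 < q" using p .
  have "0 < n" using n p by simp
  \<comment> \<open>The row and the column of cell 0 have at least \<open>h + 3\<close> cells in
    total and share only cell 0.\<close>
  show "h + 2 \<le> n"
  proof -
    define D where "D r = {v. v < n \<and> v mod r = 0 mod r}" for r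
    have fin: "finite (D r)" for r unfolding D_def by simp
    have "D p \<inter> D q \<subseteq> {0}"
    proof
      fix v assume "v \<in> D p \<inter> D q"
      hence v: "v < n" "v mod p = 0 mod p" "v mod q = 0 mod q" unfolding D_def by simp_all
      have "v < p * q" "0 < p * q" using v(1) n(2) by linarith+
      with eq_of_mod_eq[OF cop v(2,3)] have "v = 0" by simp
      thus "v \<in> {0}" by simp
    qed
    hence "card (D p \<inter> D q) \<le> card {0::nat}" by (rule card_mono[rotated]) simp
    moreover have "card (D p \<union> D q) \<le> card {..<n}" by (rule card_mono) (simp, simp add: D_def subset_iff)
    moreover have "card (D p) + card (D q) = card (D p \<union> D q) + card (D p \<inter> D q)"
      by (rule card_Un_Int[OF fin fin])
    ultimately have "class_size p n 0 + class_size q n 0 \<le> n + 1"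
      unfolding class_size_def D_def[symmetric] by simp
    thus ?thesis using cross[OF \<open>0 < n\<close>] by linarith
  qed
  show "\<not> separable p q n h"
  proof (rule not_separableI[OF cop pq n cross])
    fix \<alpha> \<beta> :: "nat \<Rightarrow> bool"
    assume u: "2 \<le> card {x. x < p \<and> \<alpha> x}" "card {x. x < p \<and> \<alpha> x} + 2 \<le> p"
    assume i: "\<exists>j<n. \<alpha> (j mod p) \<and> \<beta> (j mod q)"
    assume j: "\<exists>j<n. \<not> \<alpha> (j mod p) \<and> \<not> \<beta> (j mod q)"
    from middle show "h < card (mismatches p q n \<alpha> \<beta>)"
    proof
      assume "(k + 1) * p + q \<le> n"
      hence "k + 1 \<le> (n - q) div p" using p by (simp add: less_eq_div_iff_mult_less_eq)
      thus ?thesis using mismatches_middle[OF cop p(2) refl u, of n \<beta>] k by linarith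
    next
      assume A: "h = 2 * k \<and> 3 \<le> k \<and> (k + 1) * q \<le> n"
      from i j obtain i j where "i < n" "\<alpha> (i mod p)" "\<beta> (i mod q)"
        "j < n" "\<not> \<alpha> (j mod p)" "\<not> \<beta> (j mod q)" by blast
      from middle_strict[OF cop pq n(2) _ _ u this, of k] A show ?thesis by simp
    qed
  qed
  show "separable p q (n - 1) h"
    by (rule separable_cross[OF _ _ witness(1) _ witness(2)]) (use pq n in linarith)+
qed

text \<open>The cell has \<open>t * p - 1\<close> cells before it and \<open>(A - t) * p - 1\<close>
  behind it. Its row thus has \<open>A - 1\<close> cells, and its column fewer than \<open>w\<close>
  before and fewer than \<open>i - w\<close> behind it, hence at most \<open>i - 1\<close>.
  Exchanging \<open>p\<close> and \<open>q\<close> gives the witness for the length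
  \<open>i * q\<close>.\<close>

lemma cross_witness:
  fixes p q A i w t :: nat
  assumes p: "0 < p" "0 < q" and t: "0 < t" "t < A"
    and le: "t * p \<le> w * q" "(A - t) * p \<le> (i - w) * q"
  shows "t * p - 1 < A * p - 1"
    and "class_size p (A * p - 1) (t * p - 1) + class_size q (A * p - 1) (t * p - 1) + 2 \<le> A + i"
proof -
  obtain s where s: "A = t + s" "0 < s" using t less_imp_add_positive by blast
  have tp: "1 \<le> t * p" "1 \<le> s * p" using t s p by (simp_all add: Suc_le_eq)
  have Ap: "A * p = t * p + s * p" unfolding s(1) by (rule add_mult_distrib)
  show lt: "t * p - 1 < A * p - 1" using tp unfolding Ap by linarith
  have rest: "A * p - 1 - 1 - (t * p - 1) = s * p - 1" using tp unfolding Ap by linarith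
  have le': "s * p \<le> (i - w) * q" using le(2) s by simp
  have lt1: "(x - 1) div m < z" if "1 \<le> x" "x \<le> z * m" "0 < m" for x m z :: nat
    using that by (simp add: div_less_iff_less_mult)
  have "(t * p - 1) div p < t" "(s * p - 1) div p < s" "(t * p - 1) div q < w" "(s * p - 1) div q < i - w"
    using lt1[OF tp(1) _ p(1)] lt1[OF tp(2) _ p(1)] lt1[OF tp(1) le(1) p(2)] lt1[OF tp(2) le' p(2)] by simp_all
  thus "class_size p (A * p - 1) (t * p - 1) + class_size q (A * p - 1) (t * p - 1) + 2 \<le> A + i"
    using s(1) unfolding class_size_eq[OF p(1) lt] class_size_eq[OF p(2) lt] rest by linarith
qed

text \<open>Before the cell lie \<open>d * p - 1\<close> cells, with at most \<open>d - 1\<close> of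
  its row and \<open>c - 1\<close> of its column; behind it lie \<open>a * q - 1\<close>, with at
  most \<open>b - 1\<close> and \<open>a - 1\<close>. This is the origin of the length
  \<open>a * q + d * p\<close>.\<close>

lemma mixed_witness:
  fixes p q a b c d :: nat
  assumes p: "0 < p" "0 < q" and pos: "0 < a" "0 < d" and less: "a * q < b * p" "d * p < c * q"
  shows "d * p - 1 < a * q + d * p - 1"
    and "class_size p (a * q + d * p - 1) (d * p - 1) + class_size q (a * q + d * p - 1) (d * p - 1) + 2
      \<le> (a + c) + (b + d)"
proof -
  have aq: "1 \<le> a * q" "1 \<le> d * p" using pos p by (simp_all add: Suc_le_eq)
  show lt: "d * p - 1 < a * q + d * p - 1" using aq by linarith
  have rest: "a * q + d * p - 1 - 1 - (d * p - 1) = a * q - 1" using aq by linarith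
  have lt1: "(x - 1) div m < z" if "1 \<le> x" "x \<le> z * m" "0 < m" for x m z :: nat
    using that by (simp add: div_less_iff_less_mult)
  have "(d * p - 1) div p < d" "(a * q - 1) div p < b" "(d * p - 1) div q < c" "(a * q - 1) div q < a"
    using lt1[OF aq(2) _ p(1), of d] lt1[OF aq(1) _ p(1), of b] lt1[OF aq(2) _ p(2), of c]
      lt1[OF aq(1) _ p(2), of a] less by simp_all
  thus "class_size p (a * q + d * p - 1) (d * p - 1) + class_size q (a * q + d * p - 1) (d * p - 1) + 2
      \<le> (a + c) + (b + d)"
    unfolding class_size_eq[OF p(1) lt] class_size_eq[OF p(2) lt] rest by linarith
qed

text \<open>With \<open>(S, W) = l * (d, c) + m * (b, a)\<close> and \<open>(S', W') = (1 - l) * (d, c) + (1 - m) * (b, a)\<close>,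
  the excess of \<open>S * p + W' * q\<close> over \<open>d * p + a * q\<close> is
  \<open>(l - 1) * (d * p - c * q) + m * (b * p - a * q)\<close>.\<close>

lemma mixed_bound_aux:
  fixes a b c d p q S W S' W' :: int
  assumes det: "b * c = a * d + 1" and sums: "S + S' = b + d" "W + W' = a + c"
    and less: "a * q < b * p" "d * p < c * q" and pos: "0 < p" "0 < q" "0 < S" "0 < S'" "0 < b" "0 < d"
    and pq: "S * p \<le> W * q" "W' * q \<le> S' * p"
  shows "S * p + W' * q \<le> d * p + a * q"
proof -
  define l m where "l = b * W - a * S" and "m = c * S - d * W"
  have S: "S = l * d + m * b" and W: "W = l * c + m * a"
  proof -
    have "l * d + m * b = S * (b * c - a * d)" "l * c + m * a = W * (b * c - a * d)"
      unfolding l_def m_def by (simp_all add: algebra_simps)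
    thus "S = l * d + m * b" "W = l * c + m * a" using det by simp_all
  qed
  have "a * S * q < b * S * p" using less(1) pos(3) by (metis mult.commute mult.left_commute mult_strict_left_mono)
  also have "\<dots> \<le> b * W * q" using pq(1) pos(5) mult_left_mono[of "S * p" "W * q" b] by (simp add: algebra_simps)
  finally have "a * S < b * W" using pos(2) by simp
  hence l: "1 \<le> l" unfolding l_def by simp
  have "d * W' * q \<le> d * S' * p" using pq(2) pos(6) mult_left_mono[of "W' * q" "S' * p" d] by (simp add: algebra_simps)
  also have "\<dots> < c * S' * q" using less(2) pos(4) mult_strict_left_mono[of "d * p" "c * q" S'] by (simp add: algebra_simps)
  finally have "d * W' < c * S'" using pos(2) by simp
  moreover have "c * S' - d * W' = 1 - m"
  proof -
    have "c * S' - d * W' = c * (S + S') - d * (W + W') - m" unfolding m_def by (simp add: algebra_simps)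
    also have "\<dots> = b * c - a * d - m" unfolding sums by (simp add: algebra_simps)
    finally show ?thesis using det by simp
  qed
  ultimately have m: "m \<le> 0" by simp
  have W': "W' = a + c - W" using sums by simp
  have "d * p + a * q - (S * p + W' * q) = (l - 1) * (c * q - d * p) + (- m) * (b * p - a * q)"
    unfolding W' S W by (simp add: algebra_simps)
  also have "\<dots> \<ge> 0" using l m less by (intro add_nonneg_nonneg mult_nonneg_nonneg) auto
  finally show ?thesis by simp
qed

text \<open>\<open>b * W - a * S\<close> and its primed counterpart add up to 1, and each is
  positive if its minimum is attained by the row term, so the row terms cannot be minimal on both
  sides; dually for the column terms. One row term and one column term remain, as in
  \<open>mixed_bound_aux\<close>.\<close>

lemma mixed_bound:
  fixes a b c d p q S W S' W' :: int
  assumes det: "b * c = a * d + 1" and sums: "S + S' = b + d" "W + W' = a + c"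
    and less: "a * q < b * p" "d * p < c * q"
    and pos: "0 < p" "0 < q" "0 < S" "0 < S'" "0 < b" "0 < d"
  shows "min (S * p) (W * q) + min (S' * p) (W' * q) \<le> d * p + a * q"
proof -
  have one: "b * W - a * S + (b * W' - a * S') = 1" "c * S - d * W + (c * S' - d * W') = 1"
  proof -
    have "b * (W + W') - a * (S + S') = 1" "c * (S + S') - d * (W + W') = 1"
      using det unfolding sums by (simp_all add: algebra_simps)
    thus "b * W - a * S + (b * W' - a * S') = 1" "c * S - d * W + (c * S' - d * W') = 1"
      by (simp_all add: algebra_simps)
  qed
  have up: "a * S < b * W" if "S * p \<le> W * q" "0 < S" for S W :: int
  proof -
    have "a * S * q < b * S * p" using less(1) that(2) mult_strict_left_mono[of "a * q" "b * p" S] by (simp add: algebra_simps)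
    also have "\<dots> \<le> b * W * q" using that(1) pos(5) mult_left_mono[of "S * p" "W * q" b] by (simp add: algebra_simps)
    finally show ?thesis using pos(2) by simp
  qed
  have down: "d * W < c * S" if "W * q \<le> S * p" "0 < S" for S W :: int
  proof -
    have "d * W * q \<le> d * S * p" using that(1) pos(6) mult_left_mono[of "W * q" "S * p" d] by (simp add: algebra_simps)
    also have "\<dots> < c * S * q" using less(2) that(2) mult_strict_left_mono[of "d * p" "c * q" S] by (simp add: algebra_simps)
    finally show ?thesis using pos(2) by simp
  qed
  consider "S * p \<le> W * q" "S' * p \<le> W' * q" | "W * q \<le> S * p" "W' * q \<le> S' * p"
    | "S * p \<le> W * q" "W' * q \<le> S' * p" | "W * q \<le> S * p" "S' * p \<le> W' * q" by linarith
  thus ?thesis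
  proof cases
    case 1
    with up[of S W] up[of S' W'] one pos show ?thesis by linarith
  next
    case 2
    with down[of W S] down[of W' S'] one pos show ?thesis by linarith
  next
    case 3
    thus ?thesis using mixed_bound_aux[OF det sums less pos 3] by linarith
  next
    case 4
    have "S' + S = b + d" "W' + W = a + c" using sums by simp_all
    from mixed_bound_aux[OF det this less pos(1,2,4,3,5,6) 4(2,1)] 4 show ?thesis by linarith
  qed
qed

lemma mixed_cross:
  fixes p q a b c d :: nat
  assumes det: "b * c = a * d + 1" and less: "a * q < b * p" "d * p < c * q"
    and pos: "0 < p" "0 < q" "0 < d" and j: "j < a * q + d * p"
  shows "a + b + c + d \<le> class_size p (a * q + d * p) j + class_size q (a * q + d * p) j + 1"
    and "(a + c - 1) * q \<le> a * q + d * p"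
proof -
  let ?n = "a * q + d * p"
  have bc: "0 < b" "0 < c" using det by (auto intro: gr0I)
  have "c * ((b - 1) * p) \<le> a * d * p"
  proof -
    obtain b' where b': "b = Suc b'" using bc by (cases b) auto
    have "c + c * b' = a * d + 1" using det unfolding b' by (simp add: mult.commute)
    hence "c * b' \<le> a * d" using bc by linarith
    thus ?thesis unfolding b' by (simp add: mult.assoc[symmetric] del: mult_Suc mult_Suc_right)
  qed
  also have "\<dots> \<le> c * (a * q)" using mult_le_mono2[OF less_imp_le[OF less(2)], of a] by (simp only: ac_simps)
  finally have "(b - 1) * p \<le> a * q" using bc by (simp only: mult_le_cancel1)
  moreover have "b + d - 1 = (b - 1) + d" using bc by linarith
  ultimately have Ap: "(b + d - 1) * p \<le> ?n" by (simp only: add_mult_distrib)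
  have "b * ((c - 1) * q) \<le> a * d * q"
  proof -
    obtain c' where c': "c = Suc c'" using bc by (cases c) auto
    have "b + b * c' = a * d + 1" using det unfolding c' by simp
    hence "b * c' \<le> a * d" using bc by linarith
    thus ?thesis unfolding c' by (simp add: mult.assoc[symmetric] del: mult_Suc mult_Suc_right)
  qed
  also have "\<dots> \<le> b * (d * p)" using mult_le_mono2[OF less_imp_le[OF less(1)], of d] by (simp only: ac_simps)
  finally have "(c - 1) * q \<le> d * p" using bc by (simp only: mult_le_cancel1)
  moreover have "a + c - 1 = a + (c - 1)" using bc by linarith
  ultimately show Bq: "(a + c - 1) * q \<le> ?n" by (simp only: add_mult_distrib)
  have "b + d - 1 \<le> ?n div p" using Ap by (subst less_eq_div_iff_mult_less_eq[OF pos(1)])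
  hence ge_p: "b + d - 1 \<le> class_size p ?n j" using class_size_ge[OF pos(1), of ?n j] by linarith
  have "a + c - 1 \<le> ?n div q" using Bq by (subst less_eq_div_iff_mult_less_eq[OF pos(2)])
  hence ge_q: "a + c - 1 \<le> class_size q ?n j" using class_size_ge[OF pos(2), of ?n j] by linarith
  show "a + b + c + d \<le> class_size p ?n j + class_size q ?n j + 1"
  proof (rule ccontr)
    assume "\<not> ?thesis"
    \<comment> \<open>Rows have at least \<open>b + d - 1\<close> cells and columns at least
      \<open>a + c - 1\<close>, so too small a sum forces equality in both.\<close>
    hence eq: "class_size p ?n j + 1 = b + d" "class_size q ?n j + 1 = a + c"
      using ge_p ge_q bc by linarith+
    define j' where "j' = ?n - 1 - j"
    \<comment> \<open>\<open>S\<close> and \<open>W\<close> count the row and column cells up to and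
      including \<open>j\<close>, the primed numbers those from \<open>j\<close> on. As
      \<open>j\<close> belongs to both parts, \<open>mixed_bound\<close> would give
      \<open>?n + 1 <= ?n\<close>.\<close>
    define S S' W W' where "S = int (j div p + 1)" and "S' = int (j' div p + 1)"
      and "W = int (j div q + 1)" and "W' = int (j' div q + 1)"
    have sums: "S + S' = int b + int d" "W + W' = int a + int c"
      using eq unfolding class_size_eq[OF pos(1) j] class_size_eq[OF pos(2) j] j'_def[symmetric]
        S_def S'_def W_def W'_def by linarith+
    have mult: "int x + 1 \<le> int (x div m + 1) * int m" if "0 < m" for x m :: nat
    proof -
      have "x < (x div m + 1) * m" using that by (metis Suc_eq_plus1 dividend_less_div_times mult_Suc add.commute)
      hence "int (x + 1) \<le> int ((x div m + 1) * m)" by (simp only: of_nat_le_iff)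
      thus ?thesis by (simp only: of_nat_add of_nat_mult of_nat_1)
    qed
    have "int j + 1 \<le> min (S * int p) (W * int q)" "int j' + 1 \<le> min (S' * int p) (W' * int q)"
      using mult[OF pos(1)] mult[OF pos(2)] unfolding S_def S'_def W_def W'_def by simp_all
    moreover have "min (S * int p) (W * int q) + min (S' * int p) (W' * int q) \<le> int d * int p + int a * int q"
    proof (rule mixed_bound)
      show "int b * int c = int a * int d + 1" using arg_cong[OF det, of int] by simp
      show "int a * int q < int b * int p" "int d * int p < int c * int q"
        using less by (simp_all flip: of_nat_mult)
      show "0 < S" "0 < S'" unfolding S_def S'_def by simp_all
    qed (use sums pos bc in simp_all)
    moreover have "int j + int j' + 1 = int d * int p + int a * int q"
    proof -
      have "j + j' + 1 = d * p + a * q" using j unfolding j'_def by simp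
      hence "int (j + j' + 1) = int (d * p + a * q)" by simp
      thus ?thesis by simp
    qed
    ultimately show False by linarith
  qed
qed

subsection \<open>Comparing the cross lengths with the cut lengths\<close>

text \<open>The upper bound on \<open>i\<close> comes from \<open>p < q\<close>. For the lower one:
  \<open>i <= 2\<close> would mean p / q <= 2 / (h + 1), whereas p / q is at least 1 / ceiling (h /
  2).\<close>

lemma index_bounds:
  fixes h k i A p q :: nat
  assumes cop: "coprime p q" and pq: "2 < p" "p < q" and h: "4 < h" "h = 2 * k \<or> h = 2 * k + 1"
    and k: "q \<le> (h + 1) div 2 * p" and i: "0 < i" "0 < A" "i + A = h + 4"
    and l: "(i - 1) * q \<le> p * A" "p * (A - 1) \<le> i * q"
  shows "3 \<le> i" "i \<le> k + 2"
proof -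
  show "i \<le> k + 2"
  proof -
    have "(i - 1) * q < A * q" using l(1) pq i(2) by (metis le_less_trans mult.commute mult_less_cancel1)
    hence "i - 1 < A" by simp
    thus ?thesis using i h by linarith
  qed
  define m where "m = (h + 1) div 2"
  have kh: "2 * m = h + 1 \<or> 2 * m = h" unfolding m_def by linarith
  have k: "q \<le> m * p" using k unfolding m_def .
  have "i \<noteq> 1"
  proof
    assume "i = 1"
    hence "p * (h + 2) \<le> q" using l(2) i by simp
    hence "p * (h + 2) \<le> p * m" using k by (simp add: mult.commute)
    hence "h + 2 \<le> m" using pq by (simp only: mult_le_cancel1)
    thus False using kh by linarith
  qed
  moreover have "i \<noteq> 2"
  proof
    assume i2: "i = 2"
    hence A: "A - 1 = h + 1" using i by simp
    have "p * (h + 1) \<le> 2 * q" using l(2) unfolding A i2 .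
    moreover have "2 * q \<le> p * (2 * m)" using k by (simp add: algebra_simps)
    ultimately have "p * (h + 1) \<le> p * (2 * m)" by (rule le_trans)
    hence "h + 1 \<le> 2 * m" using pq by (simp only: mult_le_cancel1) 
    \<comment> \<open>For odd \<open>h\<close> these two bounds coincide, and then \<open>p\<close>
      would divide \<open>q\<close>.\<close>
    hence eq: "h + 1 = 2 * m" using kh by linarith
    have "2 * (p * m) \<le> 2 * q" using \<open>p * (h + 1) \<le> 2 * q\<close> unfolding eq by (simp add: mult.left_commute)
    hence "q = p * m" using k by (simp add: mult.commute)
    hence "p dvd q" by simp
    hence "p dvd 1" using cop by (metis coprime_common_divisor dvd_refl)
    thus False using pq by simp
  qed
  ultimately show "3 \<le> i" using i(1) by linarith
qed

text \<open>The second inequality says that the left end (i - 1) / A of the interval is at least 1 /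
  (A - (k + 1)), which gives \<open>(k + 1) * p + q <= A * p\<close>. It fails in the excluded
  cases. Slack variables turn it into a comparison of polynomials with natural coefficients.\<close>

lemma first_case_arith:
  fixes h k i A :: nat
  assumes "h = 2 * k \<or> h = 2 * k + 1" "4 < h" "3 \<le> i" "i \<le> k + 2" "i + A = h + 4"
    and ex: "\<not> (h = 2 * k \<and> (i = 3 \<or> i = k + 2))"
  shows "k + 1 \<le> A" "A \<le> (A - (k + 1)) * (i - 1)"
proof -
  obtain x where x: "i = 3 + x" using assms(3) le_Suc_ex by blast
  show "k + 1 \<le> A" using assms by linarith
  show "A \<le> (A - (k + 1)) * (i - 1)"
  proof (cases "h = 2 * k")
    case True
    hence "i \<noteq> 3" "i \<le> k + 1" using ex assms by auto
    then obtain y where y: "i = 4 + y" using assms(3) le_Suc_ex[of 4 i] by auto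
    obtain z where z: "k = 3 + y + z" using \<open>i \<le> k + 1\<close> y le_Suc_ex[of "3 + y" k] by auto
    have "A = 6 + y + 2 * z" using assms(5) True y z by simp
    thus ?thesis unfolding y z by (simp add: algebra_simps)
  next
    case False
    obtain z where z: "k = 1 + x + z" using assms(4) x le_Suc_ex[of "1 + x" k] by auto
    have "A = 4 + x + 2 * z" using assms(1,5) False x z by simp
    thus ?thesis unfolding x z by (simp add: algebra_simps)
  qed
qed

text \<open>With the right end i / (A - 1) of the interval this gives
  \<open>(k + 1) * p <= (i - 1) * q\<close>. It fails in the excluded cases.\<close>

lemma third_case_arith:
  fixes h k i A :: nat
  assumes "h = 2 * k \<or> h = 2 * k + 1" "4 < h" "3 \<le> i" "i \<le> k + 2" "i + A = h + 4"
    and ex: "\<not> (h = 2 * k \<and> (i = k + 1 \<or> i = k + 2))"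
  shows "(k + 1) * i \<le> (i - 1) * (A - 1)"
proof -
  obtain x where x: "i = 3 + x" using assms(3) le_Suc_ex by blast
  show ?thesis
  proof (cases "h = 2 * k")
    case True
    hence "i \<le> k" using ex assms by auto
    then obtain z where z: "k = 3 + x + z" using x le_Suc_ex[of "3 + x" k] by auto
    have "A = 7 + x + 2 * z" using assms(5) True x z by simp
    thus ?thesis unfolding x z by (simp add: algebra_simps)
  next
    case False
    obtain z where z: "k = 1 + x + z" using assms(4) x le_Suc_ex[of "1 + x" k] by auto
    have "A = 4 + x + 2 * z" using assms(1,5) False x z by simp
    thus ?thesis unfolding x z by (simp add: algebra_simps)
  qed
qed

lemma first_case_length:
  fixes h k i A p q :: nat
  assumes "h = 2 * k \<or> h = 2 * k + 1" "4 < h" "3 \<le> i" "i \<le> k + 2" "i + A = h + 4"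
    and k: "q \<le> (h + 1) div 2 * p" and l: "(i - 1) * q \<le> p * A"
  shows "(k + 1) * p + q \<le> A * p \<or> h = 2 * k \<and> 3 \<le> k \<and> (k + 1) * q \<le> A * p"
proof (cases "h = 2 * k \<and> (i = 3 \<or> i = k + 2)")
  case True
  hence h: "h = 2 * k" and i: "i = 3 \<or> i = k + 2" by auto
  have k3: "3 \<le> k" using h assms(2) by simp
  from i show ?thesis
  proof
    assume "i = 3"
    hence A: "A = k + 1 + k" using h assms(5) by simp
    have "q \<le> k * p" using k h by simp
    thus ?thesis unfolding A by (simp add: add_mult_distrib)
  next
    \<comment> \<open>Now \<open>i - 1 = k + 1\<close>, and \<open>l\<close> is the second
      alternative itself.\<close>
    assume "i = k + 2"
    thus ?thesis using h k3 l by (simp add: mult.commute)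
  qed
next
  case False
  note arith = first_case_arith[OF assms(1-5) False]
  have "(i - 1) * q \<le> p * A" by (rule l)
  also have "\<dots> \<le> p * ((A - (k + 1)) * (i - 1))" by (rule mult_le_mono2[OF arith(2)])
  finally have "(i - 1) * q \<le> (i - 1) * ((A - (k + 1)) * p)" by (simp only: ac_simps)
  hence "q \<le> (A - (k + 1)) * p" using assms(3) by (simp only: mult_le_cancel1)
  moreover have "A = (k + 1) + (A - (k + 1))" using arith(1) by linarith
  hence "A * p = (k + 1) * p + (A - (k + 1)) * p" by (metis add_mult_distrib)
  ultimately show ?thesis by linarith
qed

lemma third_case_length:
  fixes h k i A p q :: nat
  assumes "h = 2 * k \<or> h = 2 * k + 1" "4 < h" "3 \<le> i" "i \<le> k + 2" "i + A = h + 4"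
    and pq: "p < q" and m: "i * q \<le> A * p" and l: "p * (A - 1) \<le> i * q"
  shows "(k + 1) * p + q \<le> i * q \<or> h = 2 * k \<and> 3 \<le> k \<and> (k + 1) * q \<le> i * q"
proof (cases "h = 2 * k \<and> (i = k + 1 \<or> i = k + 2)")
  case True
  have "(k + 1) * q \<le> i * q" using True by (intro mult_le_mono1) auto
  thus ?thesis using True assms(2) by simp
next
  case False
  note arith = third_case_arith[OF assms(1-5) False]
  have "i * ((k + 1) * p) = (k + 1) * i * p" by (simp only: ac_simps)
  also have "\<dots> \<le> (i - 1) * (A - 1) * p" by (rule mult_le_mono1[OF arith])
  also have "\<dots> = (i - 1) * (p * (A - 1))" by (simp only: ac_simps)
  also have "\<dots> \<le> (i - 1) * (i * q)" by (rule mult_le_mono2[OF l])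
  also have "\<dots> = i * ((i - 1) * q)" by (simp only: ac_simps)
  finally have "(k + 1) * p \<le> (i - 1) * q" using assms(3) by (simp only: mult_le_cancel1)
  moreover have "i = (i - 1) + 1" using assms(3) by linarith
  hence "i * q = (i - 1) * q + q" by (metis add_mult_distrib nat_mult_1)
  ultimately show ?thesis by linarith
qed

text \<open>The excess \<open>a * q + d * p - ((k + 1) * p + q)\<close> is the combination of \<open>b * p - a * q\<close> and
  \<open>c * q - d * p\<close> with the coefficients \<open>d * (i - 1) - c * (k + 1)\<close> and
  \<open>a * (A - (k + 1)) - b\<close>.\<close>

lemma mixed_case_length:
  fixes h k i A p q a b c d :: nat
  assumes h: "h = 2 * k \<or> h = 2 * k + 1" "4 < h" "3 \<le> i" "i \<le> k + 2" "i + A = h + 4"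
    and det: "b * c = a * d + 1" and sums: "a + c = i" "b + d = A"
    and less: "a * q < b * p" "d * p < c * q"
  shows "(k + 1) * p + q \<le> a * q + d * p"
proof -
  have pos: "0 < b" "0 < c" using det by (auto intro: gr0I)
  \<comment> \<open>No fraction with sum at most \<open>h + 3\<close> lies strictly between the
    neighbours. This and \<open>no_between'\<close> are applied to 1 / 1, 1 / k and k / (k + 1) in
    the cases that the arithmetic lemmas exclude.\<close>
  have no_between: "x * b \<le> a * y" if "x * A \<le> i * y" "x + y \<le> h + 3" for x y
  proof (rule ccontr)
    assume "\<not> ?thesis"
    hence "a * y < x * b" by simp
    moreover have "x * b + x * d \<le> a * y + c * y" using that(1) unfolding sums[symmetric] by (simp add: algebra_simps)
    ultimately have "x * d < c * y" by linarith
    from between_neighbours[OF det \<open>a * y < x * b\<close> this] that(2) h(5) sums show False by linarith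
  qed
  have no_between': "c * y \<le> x * d" if "i * y \<le> x * A" "x + y \<le> h + 3" for x y
  proof (rule ccontr)
    assume "\<not> ?thesis"
    hence "x * d < c * y" by simp
    moreover have "a * y + c * y \<le> x * b + x * d" using that(1) unfolding sums[symmetric] by (simp add: algebra_simps)
    ultimately have "a * y < x * b" by linarith
    from between_neighbours[OF det this \<open>x * d < c * y\<close>] that(2) h(5) sums show False by linarith
  qed
  have kA: "k + 1 \<le> A" using h by linarith
  \<comment> \<open>Here \<open>i = A\<close>, so 1 / 1 would be at most \<open>a / b\<close> and at
    least \<open>c / d\<close>, against the determinant.\<close>
  have not_last: "\<not> (h = 2 * k \<and> i = k + 2)"
  proof
    assume "h = 2 * k \<and> i = k + 2"
    hence "a + c = b + d" "3 < i" using h sums by linarith+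
    moreover have "1 * b \<le> a * 1" by (rule no_between) (use h \<open>h = 2 * k \<and> i = k + 2\<close> in simp_all)
    moreover have "c * 1 \<le> 1 * d" by (rule no_between') (use h \<open>h = 2 * k \<and> i = k + 2\<close> in simp_all)
    ultimately have "b \<le> a" "c \<le> d" by simp_all
    hence "b * c \<le> a * d" by (rule mult_le_mono)
    thus False using det by simp
  qed
  have one: "b \<le> a * (A - (k + 1))"
  proof (cases "h = 2 * k \<and> i = 3")
    case True
    hence A: "A - (k + 1) = k" "A = 2 * k + 1" "i = 3" using h by linarith+
    have "1 * b \<le> a * k" by (rule no_between) (use A True h in simp_all)
    thus ?thesis unfolding A(1) by simp
  next
    case False
    hence "\<not> (h = 2 * k \<and> (i = 3 \<or> i = k + 2))" using not_last by blast
    note arith = first_case_arith(2)[OF h this]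
    have i: "i - 1 = a + (c - 1)" using sums pos by linarith
    \<comment> \<open>The determinant of \<open>a / b\<close> and the mediant \<open>i / A\<close>
      is again 1.\<close>
    have "(i - 1) * b + b = a * A + 1 "
    proof -
      obtain c' where c': "c = Suc c'" using pos by (cases c) auto
      show ?thesis unfolding i sums(2)[symmetric] using det unfolding c' by (simp add: algebra_simps)
    qed
    hence "(i - 1) * b \<le> a * A" using pos by linarith
    also have "\<dots> \<le> a * ((A - (k + 1)) * (i - 1))" by (rule mult_le_mono2[OF arith])
    finally have "(i - 1) * b \<le> (i - 1) * (a * (A - (k + 1)))" by (simp only: ac_simps)
    thus ?thesis using h(3) by (simp only: mult_le_cancel1)
  qed
  have two: "c * (k + 1) \<le> d * (i - 1)"
  proof (cases "h = 2 * k \<and> i = k + 1")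
    case True
    hence A: "A = k + 3" "i = k + 1" "i - 1 = k" "3 \<le> k" using h by linarith+
    have "c * (k + 1) \<le> k * d" by (rule no_between') (use A True in \<open>simp_all add: algebra_simps\<close>)
    thus ?thesis unfolding A(3) by (simp add: mult.commute)
  next
    case False
    hence "\<not> (h = 2 * k \<and> (i = k + 1 \<or> i = k + 2))" using not_last by blast
    note arith = third_case_arith[OF h this]
    have A: "A - 1 = (b - 1) + d" using sums pos by linarith
    have "c * (A - 1) + c = i * d + 1"
    proof -
      obtain b' where b': "b = Suc b'" using pos by (cases b) auto
      show ?thesis unfolding A sums(1)[symmetric] using det unfolding b' by (simp add: algebra_simps)
    qed
    hence le: "c * (A - 1) \<le> i * d" using pos by linarith
    have "i * (c * (k + 1)) = c * ((k + 1) * i)" by (simp only: ac_simps)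
    also have "\<dots> \<le> c * ((i - 1) * (A - 1))" by (rule mult_le_mono2[OF arith])
    also have "\<dots> = (i - 1) * (c * (A - 1))" by (simp only: ac_simps)
    also have "\<dots> \<le> (i - 1) * (i * d)" by (rule mult_le_mono2[OF le])
    finally have "i * (c * (k + 1)) \<le> i * (d * (i - 1))" by (simp only: ac_simps)
    thus ?thesis using h(3) by (simp only: mult_le_cancel1)
  qed
  define l m where "l = int d * (int i - 1) - int c * (int k + 1)"
    and "m = int a * (int A - (int k + 1)) - int b"
  have "0 \<le> l"
  proof -
    have "int (c * (k + 1)) \<le> int (d * (i - 1))" using two by (simp only: of_nat_le_iff)
    moreover have "int (d * (i - 1)) = int d * (int i - 1)" using h(3) by (simp add: of_nat_diff)
    moreover have "int (c * (k + 1)) = int c * (int k + 1)" by (simp add: algebra_simps)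
    ultimately show ?thesis unfolding l_def by linarith
  qed
  moreover have "0 \<le> m"
  proof -
    have "int b \<le> int (a * (A - (k + 1)))" using one by (simp only: of_nat_le_iff)
    moreover have "int (a * (A - (k + 1))) = int a * (int A - (int k + 1))" using kA by (simp add: of_nat_diff)
    ultimately show ?thesis unfolding m_def by linarith
  qed
  moreover have "0 \<le> int b * p - int a * q" "0 \<le> int c * q - int d * p"
    using less by (simp_all flip: of_nat_mult)
  ultimately have "0 \<le> l * (int b * p - int a * q) + m * (int c * q - int d * p)" by simp
  also have "\<dots> = int a * q + int d * p - ((int k + 1) * p + q)"
  proof -
    have D: "int b * c = int a * d + 1" using arg_cong[OF det, of int] by simp
    have "l * int b - m * int d = int d - (int k + 1)"
    proof -
      have "l * int b - m * int d = (int b * int d * int i - int a * int d * int A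
        - (int k + 1) * (int b * c - int a * d))"
        unfolding l_def m_def by (simp add: algebra_simps)
      also have "int b * int d * int i - int a * int d * int A = int d * (int b * c - int a * d)"
        unfolding sums[symmetric] by (simp add: algebra_simps)
      finally show ?thesis using D by simp
    qed
    moreover have "m * int c - l * int a = int a - 1"
    proof -
      have "m * int c - l * int a = (int a * int c * int A - int a * int d * int i) - (int b * c - int a * d)"
        unfolding l_def m_def by (simp add: algebra_simps)
      also have "int a * int c * int A - int a * int d * int i = int a * (int b * c - int a * d)"
        unfolding sums[symmetric] by (simp add: algebra_simps)
      finally show ?thesis using D by simp
    qed
    moreover have "l * (int b * p - int a * q) + m * (int c * q - int d * p)
      = (l * int b - m * int d) * p + (m * int c - l * int a) * q" by (simp add: algebra_simps)
    ultimately have "l * (int b * p - int a * q) + m * (int c * q - int d * p)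
      = (int d - (int k + 1)) * p + (int a - 1) * q" by (simp only:)
    also have "\<dots> = int a * q + int d * p - ((int k + 1) * p + q)" by (simp add: algebra_simps)
    finally show ?thesis .
  qed
  finally have "int ((k + 1) * p + q) \<le> int (a * q + d * p)" by (simp add: distrib_right)
  thus ?thesis by (simp only: of_nat_le_iff)
qed

text \<open>From \<open>i + A = h + 4 <= p + q + 1\<close> follows \<open>A <= q\<close> or
  \<open>i <= p\<close>. This is where \<open>h < p + q - 2\<close> enters.\<close>

lemma length_le_prod:
  fixes p q A i n h :: nat
  assumes "n \<le> A * p" "n \<le> i * q" "i + A = h + 4" "h < p + q - 2"
  shows "n \<le> p * q"
proof (cases "A \<le> q")
  case True
  hence "A * p \<le> p * q" unfolding mult.commute[of p q] by (rule mult_le_mono1)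
  with assms(1) show ?thesis by (rule le_trans)
next
  case False
  hence "i \<le> p" using assms by linarith
  hence "i * q \<le> p * q" by (rule mult_le_mono1)
  with assms(2) show ?thesis by (rule le_trans)
qed

context
  fixes \<Sigma> :: "'a set" and x y :: 'a and p q h i A :: nat
  assumes cop: "coprime p q" and pq: "2 < p" "p < q" and xy: "x \<in> \<Sigma>" "y \<in> \<Sigma>" "x \<noteq> y"
    and h: "4 < h" "h < p + q - 2" and ratio: "q \<le> (h + 1) div 2 * p"
    and i: "0 < i" "0 < A" "i + A = h + 4"
    and l: "(i - 1) * q \<le> p * A" "p * (A - 1) \<le> i * q"
begin

private lemma bounds:
  obtains k where "h = 2 * k \<or> h = 2 * k + 1" "3 \<le> i" "i \<le> k + 2" "i \<le> A"
proof -
  have k: "h = 2 * (h div 2) \<or> h = 2 * (h div 2) + 1" by linarith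
  note b = index_bounds[OF cop pq h(1) k ratio i l]
  have "i \<le> A" using b i k by linarith
  with that[OF k] b show ?thesis by blast
qed

private lemma p_pos: "0 < p" "0 < q"
  using pq by auto

text \<open>\<open>t\<close> and \<open>w\<close> split \<open>i / A\<close> into two fractions
  \<open>w / t\<close> and \<open>(i - w) / (A - t)\<close>, both at least \<open>p / q\<close>. At
  length \<open>A * p\<close> rows have \<open>A\<close> cells, and \<open>l_i <= p / q\<close>
  yields at least \<open>i - 1\<close> cells per column.\<close>

private lemma threshold_first:
  assumes t: "0 < t" "t < A" "t * p \<le> w * q" "(A - t) * p \<le> (i - w) * q" and le: "A * p \<le> i * q"
  shows "threshold \<Sigma> h p q = A * p"
proof -
  obtain k where k: "h = 2 * k \<or> h = 2 * k + 1" "3 \<le> i" "i \<le> k + 2" "i \<le> A" by (rule bounds)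
  note wit = cross_witness[OF p_pos t]
  show ?thesis
  proof (rule threshold_piece[OF cop pq xy _ _ _ k(1) _ wit(1)])
    have iq: "(i - 1) * q \<le> A * p" using l(1) by (simp only: mult.commute)
    have "2 * q \<le> (i - 1) * q" by (rule mult_le_mono1) (use k in linarith)
    thus "2 * q \<le> A * p" using iq by (rule le_trans)
    show "A * p \<le> p * q" by (rule length_le_prod[OF le_refl le i(3) h(2)])
    show "(k + 1) * p + q \<le> A * p \<or> h = 2 * k \<and> 3 \<le> k \<and> (k + 1) * q \<le> A * p"
      by (rule first_case_length[OF k(1) h(1) k(2,3) i(3) ratio l(1)])
    show "class_size p (A * p - 1) (t * p - 1) + class_size q (A * p - 1) (t * p - 1) \<le> h + 2"
      using wit(2) i(3) by linarith
    fix j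
    have "A \<le> A * p div p" "i - 1 \<le> A * p div q"
      using iq p_pos by (simp_all add: less_eq_div_iff_mult_less_eq)
    thus "h + 3 \<le> class_size p (A * p) j + class_size q (A * p) j"
      using class_size_ge[OF p_pos(1), of "A * p" j] class_size_ge[OF p_pos(2), of "A * p" j] i by linarith
  qed
qed

private lemma threshold_third:
  assumes w: "0 < w" "w < i" "w * q \<le> t * p" "(i - w) * q \<le> (A - t) * p" and le: "i * q \<le> A * p"
  shows "threshold \<Sigma> h p q = i * q"
proof -
  obtain k where k: "h = 2 * k \<or> h = 2 * k + 1" "3 \<le> i" "i \<le> k + 2" "i \<le> A" by (rule bounds)
  note wit = cross_witness[OF p_pos(2,1) w]
  show ?thesis
  proof (rule threshold_piece[OF cop pq xy _ _ _ k(1) _ wit(1)])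
    show "2 * q \<le> i * q" by (rule mult_le_mono1) (use k in linarith)
    show "i * q \<le> p * q" by (rule length_le_prod[OF le le_refl i(3) h(2)])
    show "(k + 1) * p + q \<le> i * q \<or> h = 2 * k \<and> 3 \<le> k \<and> (k + 1) * q \<le> i * q"
      by (rule third_case_length[OF k(1) h(1) k(2,3) i(3) pq(2) le l(2)])
    show "class_size p (i * q - 1) (w * q - 1) + class_size q (i * q - 1) (w * q - 1) \<le> h + 2"
      using wit(2) i(3) by linarith
    fix j
    have "(A - 1) * p \<le> i * q" using l(2) by (simp only: mult.commute)
    hence "i \<le> i * q div q" "A - 1 \<le> i * q div p"
      using p_pos by (simp_all add: less_eq_div_iff_mult_less_eq)
    thus "h + 3 \<le> class_size p (i * q) j + class_size q (i * q) j"
      using class_size_ge[OF p_pos(1), of "i * q" j] class_size_ge[OF p_pos(2), of "i * q" j] i by linarith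
  qed
qed

private lemma threshold_mixed:
  assumes det: "b * c = a * d + 1" and sums: "a + c = i" "b + d = A" and pos: "0 < a" "0 < d"
    and less: "a * q < b * p" "d * p < c * q"
  shows "threshold \<Sigma> h p q = a * q + d * p"
proof -
  obtain k where k: "h = 2 * k \<or> h = 2 * k + 1" "3 \<le> i" "i \<le> k + 2" "i \<le> A" by (rule bounds)
  note wit = mixed_witness[OF p_pos pos less]
  have n0: "0 < a * q + d * p" using pos p_pos by simp
  show ?thesis
  proof (rule threshold_piece[OF cop pq xy _ _ _ k(1) _ wit(1)])
    have "2 * q \<le> (a + c - 1) * q" by (rule mult_le_mono1) (use k sums in linarith)
    thus "2 * q \<le> a * q + d * p"
      using mixed_cross(2)[OF det less p_pos pos(2) n0] by (rule le_trans)
    have "a * q + d * p \<le> A * p" "a * q + d * p \<le> i * q"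
      using less unfolding sums[symmetric] by (simp_all add: add_mult_distrib)
    thus "a * q + d * p \<le> p * q" by (rule length_le_prod[OF _ _ i(3) h(2)])
    show "(k + 1) * p + q \<le> a * q + d * p \<or> h = 2 * k \<and> 3 \<le> k \<and> (k + 1) * q \<le> a * q + d * p"
      using mixed_case_length[OF k(1) h(1) k(2,3) i(3) det sums less] by simp
    show "class_size p (a * q + d * p - 1) (d * p - 1) + class_size q (a * q + d * p - 1) (d * p - 1) \<le> h + 2"
      using wit(2) i(3) unfolding sums by linarith
    show "h + 3 \<le> class_size p (a * q + d * p) j + class_size q (a * q + d * p) j"
      if "j < a * q + d * p" for j
      using mixed_cross(1)[OF det less p_pos pos(2) that] sums i by linarith
  qed
qed

lemma threshold_cases:
  assumes L: "Left (h + 3) (fval (i, A)) = (a, b)" and R: "Right (h + 3) (fval (i, A)) = (c, d)"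
  shows "p * b \<le> a * q \<Longrightarrow> threshold \<Sigma> h p q = A * p"
    and "a * q < p * b \<Longrightarrow> p * d < c * q \<Longrightarrow> threshold \<Sigma> h p q = a * q + d * p"
    and "c * q \<le> p * d \<Longrightarrow> threshold \<Sigma> h p q = i * q"
    and "0 < a + b" and "0 < c + d"
proof -
  obtain k where k: "h = 2 * k \<or> h = 2 * k + 1" "3 \<le> i" "i \<le> k + 2" "i \<le> A" by (rule bounds)
  have N: "i + A = Suc (h + 3)" using i by simp
  have "(p * b \<le> a * q \<longrightarrow> threshold \<Sigma> h p q = A * p) \<and>
    (a * q < p * b \<longrightarrow> p * d < c * q \<longrightarrow> threshold \<Sigma> h p q = a * q + d * p) \<and>
    (c * q \<le> p * d \<longrightarrow> threshold \<Sigma> h p q = i * q) \<and> 0 < a + b \<and> 0 < c + d"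
  proof (cases "coprime i A")
    case True
    obtain a' b' c' d' where n: "a' + c' = i" "b' + d' = A" "b' * c' = a' * d' + 1"
      using neighbours_exist[OF True i(1,2)] .
    have eq: "a' = a" "b' = b" "c' = c" "d' = d"
      using Left_Right_neighbours[OF n(3,1,2) N] L R by simp_all
    note sums = n(1,2)[unfolded eq] and det = n(3)[unfolded eq]
    have bc: "0 < b" "0 < c" using det by (auto intro: gr0I)
    \<comment> \<open>\<open>3 <= i\<close> and \<open>i <= A\<close> exclude the neighbours 0 / 1
      and 1 / 0, so both parts of the mixed length are positive.\<close>
    have a0: "0 < a"
    proof (rule gr0I)
      assume "a = 0"
      hence "c = 1" using det by simp
      thus False using \<open>a = 0\<close> sums k by simp
    qed
    have d0: "0 < d"
    proof (rule gr0I)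
      assume "d = 0"
      hence "b = 1" using det by simp
      thus False using \<open>d = 0\<close> sums k by simp
    qed
    have diff: "A - d = b" "i - c = a" "i - a = c" "A - b = d" using sums by linarith+
    \<comment> \<open>Since p / q <= a / b < c / d, both summands of the mediant are at least p / q
      and serve as the splitting.\<close>
    have one: "threshold \<Sigma> h p q = A * p" if le: "b * p \<le> a * q"
    proof -
      have "b * (d * p) \<le> d * (a * q)" using mult_le_mono2[OF le, of d] by (simp only: ac_simps)
      also have "\<dots> \<le> b * (c * q)"
      proof -
        have "a * d * q \<le> b * c * q" by (rule mult_le_mono1) (simp add: det)
        thus ?thesis by (simp only: ac_simps)
      qed
      finally have dp: "d * p \<le> c * q" using bc by (simp only: mult_le_cancel1)
      have "A * p \<le> i * q" using le dp unfolding sums[symmetric] add_mult_distrib by linarith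
      thus ?thesis using d0 bc sums le dp by (intro threshold_first[of d c]) (simp_all add: diff)
    qed
    have two: "threshold \<Sigma> h p q = i * q" if le: "c * q \<le> d * p"
    proof -
      have "c * (a * q) \<le> a * (d * p)" using mult_le_mono2[OF le, of a] by (simp only: ac_simps)
      also have "\<dots> \<le> c * (b * p)"
      proof -
        have "a * d * p \<le> b * c * p" by (rule mult_le_mono1) (simp add: det)
        thus ?thesis by (simp only: ac_simps)
      qed
      finally have aq: "a * q \<le> b * p" using bc by (simp only: mult_le_cancel1)
      have "i * q \<le> A * p" using le aq unfolding sums[symmetric] add_mult_distrib by linarith
      thus ?thesis using a0 bc sums le aq by (intro threshold_third[of a b]) (simp_all add: diff)
    qed
    show ?thesis using one two threshold_mixed[OF det sums a0 d0] bc by (simp add: mult.commute)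
  next
    \<comment> \<open>Here \<open>a / b = c / d\<close> has the value of \<open>i / A\<close>, so
      the middle interval is empty. The splitting takes one of the \<open>g\<close> copies of
      \<open>(a, b)\<close> away from \<open>(i, A)\<close>.\<close>
    case False
    define g where "g = gcd i A"
    have eq: "a = i div g" "b = A div g" "c = i div g" "d = A div g"
      using Left_Right_not_coprime[OF i(1) False N] L R unfolding g_def by simp_all
    have iA: "i = g * a" "A = g * b" unfolding eq g_def by simp_all
    have "g \<noteq> 0" using i(1) unfolding g_def by simp
    moreover have "g \<noteq> 1" using False unfolding g_def coprime_iff_gcd_eq_1 .
    ultimately obtain g' where g': "g = Suc g'" "0 < g'" by (cases g) auto
    have ab: "0 < a" "0 < b" using i(1,2) unfolding iA by simp_all
    have diff: "A - b = g' * b" "i - a = g' * a" unfolding iA g' by simp_all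
    have lt: "b < A" "a < i" unfolding iA g' using ab g' by simp_all
    have one: "threshold \<Sigma> h p q = A * p" if le: "b * p \<le> a * q"
    proof (rule threshold_first[OF ab(2) lt(1) le])
      show "(A - b) * p \<le> (i - a) * q" unfolding diff using mult_le_mono2[OF le, of g'] by (simp only: ac_simps)
      show "A * p \<le> i * q" unfolding iA using mult_le_mono2[OF le, of g] by (simp only: ac_simps)
    qed
    have two: "threshold \<Sigma> h p q = i * q" if le: "a * q \<le> b * p"
    proof (rule threshold_third[OF ab(1) lt(2) le])
      show "(i - a) * q \<le> (A - b) * p" unfolding diff using mult_le_mono2[OF le, of g'] by (simp only: ac_simps)
      show "i * q \<le> A * p" unfolding iA using mult_le_mono2[OF le, of g] by (simp only: ac_simps)
    qed
    have cd: "c = a" "d = b" using eq by simp_all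
    show ?thesis unfolding cd using one two ab by (simp add: mult.commute)
  qed
  thus "p * b \<le> a * q \<Longrightarrow> threshold \<Sigma> h p q = A * p"
    and "a * q < p * b \<Longrightarrow> p * d < c * q \<Longrightarrow> threshold \<Sigma> h p q = a * q + d * p"
    and "c * q \<le> p * d \<Longrightarrow> threshold \<Sigma> h p q = i * q"
    and "0 < a + b" and "0 < c + d" by blast+
qed

end

subsection \<open>The first piece\<close>

text \<open>A colouring of the rows whose only changes are at the rows \<open>p - 2\<close> and \<open>p - 1\<close>: the cycle of
  rows is cut behind \<open>p - 1\<close>, and \<open>\<tau> x\<close> is the index of the row \<open>x\<close> on the resulting path.\<close>

lemma two_change_colouring:
  fixes p q :: nat
  assumes cop: "coprime p q" and p: "2 < p"
  obtains \<alpha> where "\<alpha> (p - 2)" "\<not> \<alpha> (p - 1)"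
    "\<And>v. \<alpha> (v mod p) \<noteq> \<alpha> ((v + q) mod p) \<Longrightarrow> v mod p = p - 2 \<or> v mod p = p - 1"
proof -
  obtain w where w: "[q * w = 1] (mod p)" using cong_solve_coprime_nat[of q p] cop by (auto simp: coprime_commute)
  have wq: "(w * q) mod p = 1" using w p unfolding Cong.cong_def by (simp add: mult.commute)
  \<comment> \<open>The offset gives row \<open>p - 1\<close> the index \<open>p - 1\<close>, so
    that adding \<open>q\<close> raises the index by one except at this row, where it wraps
    around.\<close>
  define \<tau> where "\<tau> v = (w * (v + 1) + (p - 1)) mod p" for v
  define \<alpha> where "\<alpha> v = (\<tau> v \<le> \<tau> (p - 2))" for v
  have \<tau>_less: "\<tau> v < p" for v unfolding \<tau>_def using p by simp
  have \<tau>_mod: "\<tau> (v mod p) = \<tau> v" for v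
  proof -
    have "[w * (v mod p + 1) + (p - 1) = w * (v + 1) + (p - 1)] (mod p)"
      by (intro cong_add cong_mult cong_refl) (simp add: Cong.cong_def)
    thus ?thesis unfolding \<tau>_def Cong.cong_def .
  qed
  have "\<tau> (v + q) = (\<tau> v + w * q) mod p" for v
  proof -
    have "w * (v + q + 1) + (p - 1) = (w * (v + 1) + (p - 1)) + w * q" by (simp add: algebra_simps)
    thus ?thesis unfolding \<tau>_def by (simp only: mod_add_left_eq)
  qed
  hence \<tau>_step: "\<tau> (v + q) = (\<tau> v + 1) mod p" for v using wq by (metis mod_add_right_eq)
  have \<tau>_inj: "u = v" if "\<tau> u = \<tau> v" "u < p" "v < p" for u v
  proof -
    have "[w * (u + 1) + (p - 1) = w * (v + 1) + (p - 1)] (mod p)" using that unfolding \<tau>_def Cong.cong_def by simp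
    hence "[w * (u + 1) = w * (v + 1)] (mod p)" by (simp only: cong_add_rcancel_nat)
    hence "[q * (w * (u + 1)) = q * (w * (v + 1))] (mod p)" by (rule cong_scalar_left)
    moreover have "[q * (w * z) = z] (mod p)" for z
      using cong_scalar_right[OF w, of z] by (simp add: mult.assoc)
    ultimately have "[u + 1 = v + 1] (mod p)" by (meson cong_sym cong_trans)
    hence "[u = v] (mod p)" by (simp only: cong_add_rcancel_nat)
    thus ?thesis using that unfolding Cong.cong_def by simp
  qed
  have last: "\<tau> (p - 1) = p - 1"
  proof -
    have "w * (p - 1 + 1) + (p - 1) = (p - 1) + w * p" using p by simp
    thus ?thesis unfolding \<tau>_def using p by (simp only: mod_mult_self1 mod_less)
  qed
  show ?thesis
  proof (rule that[of \<alpha>])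
    show "\<alpha> (p - 2)" unfolding \<alpha>_def by simp
    have "\<tau> (p - 2) \<noteq> \<tau> (p - 1)"
    proof
      assume "\<tau> (p - 2) = \<tau> (p - 1)"
      hence "p - 2 = p - 1" by (rule \<tau>_inj) (use p in simp_all)
      thus False using p by simp
    qed
    thus "\<not> \<alpha> (p - 1)" unfolding \<alpha>_def last using \<tau>_less[of "p - 2"] by simp
    fix v assume "\<alpha> (v mod p) \<noteq> \<alpha> ((v + q) mod p)"
    hence ne: "(\<tau> v \<le> \<tau> (p - 2)) \<noteq> ((\<tau> v + 1) mod p \<le> \<tau> (p - 2))"
      unfolding \<alpha>_def \<tau>_mod \<tau>_step .
    have "\<tau> v = \<tau> (p - 2) \<or> \<tau> v = p - 1"
    proof (cases "\<tau> v = p - 1")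
      case False
      hence "\<tau> v + 1 < p" using \<tau>_less[of v] by linarith
      thus ?thesis using ne by auto
    qed simp
    hence "\<tau> (v mod p) = \<tau> (p - 2) \<or> \<tau> (v mod p) = \<tau> (p - 1)" unfolding \<tau>_mod last .
    thus "v mod p = p - 2 \<or> v mod p = p - 1" using \<tau>_inj[of "v mod p"] p by auto
  qed
qed

text \<open>For \<open>n <= 3 * q\<close> a column has at most three cells. Giving it the colour of
  its second cell, if there is one, charges each colour change to an outer cell. The rows
  \<open>p - 2\<close> and \<open>p - 1\<close> are those with the fewest cells below
  \<open>n - q\<close>.\<close>

lemma separable_two_changes:
  fixes p q n h :: nat
  assumes cop: "coprime p q" and pq: "2 < p" "p < q" and n: "q + p \<le> n" "n \<le> 3 * q"
    and h: "(n - q + 1) div p + (n - q) div p \<le> h"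
  shows "separable p q n h"
proof -
  obtain \<alpha> where \<alpha>: "\<alpha> (p - 2)" "\<not> \<alpha> (p - 1)"
    "\<And>v. \<alpha> (v mod p) \<noteq> \<alpha> ((v + q) mod p) \<Longrightarrow> v mod p = p - 2 \<or> v mod p = p - 1"
    using two_change_colouring[OF cop pq(1)] by blast
  define \<beta> where "\<beta> y = (if y + q < n then \<alpha> ((y + q) mod p) else \<alpha> (y mod p))" for y
  let ?S = "{v. v < n - q \<and> (v mod p = p - 2 \<or> v mod p = p - 1)}"
  have q: "0 < q" using pq by simp
  have mid: "\<beta> (v mod q) = \<alpha> (v mod p)" if "q \<le> v" "v < n" "v < 2 * q" for v
  proof -
    have "v mod q = v - q" using that by (simp add: le_mod_geq)
    thus ?thesis unfolding \<beta>_def using that by simp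
  qed
  \<comment> \<open>A change from \<open>v\<close> to \<open>v + q\<close> is paid by
    \<open>v\<close> if it is the first cell of its column, and by \<open>v + q\<close> if
    \<open>v\<close> is the second.\<close>
  have "mismatches p q n \<alpha> \<beta> \<subseteq> (\<lambda>v. if v < q then v else v + q) ` ?S"
  proof
    fix v assume "v \<in> mismatches p q n \<alpha> \<beta>"
    hence v: "v < n" "\<alpha> (v mod p) \<noteq> \<beta> (v mod q)" unfolding mismatches_def by auto
    consider "v < q" | "q \<le> v" "v < 2 * q" | "2 * q \<le> v" by linarith
    thus "v \<in> (\<lambda>v. if v < q then v else v + q) ` ?S"
    proof cases
      case 1
      hence \<beta>v: "\<beta> (v mod q) = (if v + q < n then \<alpha> ((v + q) mod p) else \<alpha> (v mod p))"
        unfolding \<beta>_def by simp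
      hence "v + q < n" using v(2) by (cases "v + q < n") simp_all
      hence "\<alpha> (v mod p) \<noteq> \<alpha> ((v + q) mod p)" using v(2) \<beta>v by simp
      hence "v \<in> ?S" using \<alpha>(3)[of v] \<open>v + q < n\<close> by simp
      thus ?thesis using 1 by (intro image_eqI[of _ _ v]) simp_all
    next
      case 2
      thus ?thesis using mid[OF 2(1) v(1) 2(2)] v by simp
    next
      case 3
      have m: "v mod q = v - 2 * q"
      proof -
        have "v = (v - 2 * q) + 2 * q" "v - 2 * q < q" using 3 v n by linarith+
        hence "v mod q = (v - 2 * q) mod q" by (metis mod_mult_self1)
        thus ?thesis using \<open>v - 2 * q < q\<close> by simp
      qed
      have eq: "v - 2 * q + q = v - q" "v - q + q = v" using 3 by linarith+
      have "v - q < n" using v(1) by linarith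
      hence "\<beta> (v mod q) = \<alpha> ((v - q) mod p)" unfolding \<beta>_def m eq by simp
      hence "\<alpha> ((v - q) mod p) \<noteq> \<alpha> ((v - q + q) mod p)" using v(2) unfolding eq(2) by simp
      hence "v - q \<in> ?S" using \<alpha>(3)[of "v - q"] v(1) 3 q by simp
      moreover have "v = (if v - q < q then v - q else v - q + q)" using 3 by simp
      ultimately show ?thesis by (rule rev_image_eqI)
    qed
  qed
  moreover have "finite ?S" by simp
  ultimately have "card (mismatches p q n \<alpha> \<beta>) \<le> card ?S"
    by (meson card_image_le card_mono finite_imageI le_trans)
  also have "card ?S = (n - q + 1) div p + (n - q) div p"
  proof -
    have "card ?S = (n - q + p - 1 - (p - 2)) div p + (n - q + p - 1 - (p - 1)) div p"
      by (rule card_two_residue_classes) (use pq in linarith)+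
    moreover have "n - q + p - 1 - (p - 2) = n - q + 1" "n - q + p - 1 - (p - 1) = n - q" using pq by linarith+
    ultimately show ?thesis by simp
  qed
  also note h
  finally have "card (mismatches p q n \<alpha> \<beta>) \<le> h" .
  moreover have ex: "\<exists>v<n. q \<le> v \<and> v < 2 * q \<and> v mod p = r" if "r < p" for r
  proof -
    have "coprime p (1::nat)" by simp
    then obtain s where "s < p" "(q + s * 1) mod p = r" by (rule orbit_surj[OF _ \<open>r < p\<close>])
    hence s: "s < p" "(q + s) mod p = r" by simp_all
    thus ?thesis using n pq by (intro exI[of _ "q + s"]) auto
  qed
  have "\<exists>v<n. \<alpha> (v mod p) \<and> \<beta> (v mod q)"
  proof -
    obtain v where v: "v < n" "q \<le> v" "v < 2 * q" "v mod p = p - 2" using ex[of "p - 2"] pq by auto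
    thus ?thesis using mid[OF v(2,1,3)] \<alpha>(1) by auto
  qed
  moreover have "\<exists>v<n. \<not> \<alpha> (v mod p) \<and> \<not> \<beta> (v mod q)"
  proof -
    obtain v where v: "v < n" "q \<le> v" "v < 2 * q" "v mod p = p - 1" using ex[of "p - 1"] pq by auto
    thus ?thesis using mid[OF v(2,1,3)] \<alpha>(2) by auto
  qed
  ultimately show ?thesis unfolding separable_def by blast
qed

text \<open>Parity fixes the last unit. For odd \<open>h\<close> every row has \<open>k + 1\<close>
  cells below \<open>n - q = (k + 1) * p\<close>, so two rows have \<open>h + 1\<close>. For even
  \<open>h\<close> one position less suffices: only row \<open>p - 1\<close> drops to
  \<open>k\<close> cells. At \<open>n - 1\<close> the rows \<open>p - 2\<close> and
  \<open>p - 1\<close> have exactly \<open>h\<close> in both cases.\<close>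

lemma threshold_first_piece:
  fixes \<Sigma> :: "'a set" and p q h k :: nat
  assumes cop: "coprime p q" and pq: "2 < p" "p < q" and xy: "x \<in> \<Sigma>" "y \<in> \<Sigma>" "x \<noteq> y"
    and h: "4 < h" "h = 2 * k \<or> h = 2 * k + 1" and ratio: "(h + 1) div 2 * p < q"
    and n: "n + (h + 1) mod 2 = (k + 1) * p + q"
  shows "threshold \<Sigma> h p q = n"
proof (rule threshold_eqI[OF cop _ _ xy])
  have p: "0 < p" "0 < q" using pq by auto
  show "0 < p" "0 < q" using p .
  have k: "2 \<le> k" using h by linarith
  have kp: "3 * k \<le> k * p" using pq by simp
  have np: "(k + 1) * p = k * p + p" by simp
  have kq: "k * p < q"
  proof -
    have "k * p \<le> (h + 1) div 2 * p" by (rule mult_le_mono1) (use h in linarith)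
    thus ?thesis using ratio by linarith
  qed
  have odd: "(k + 1) * p < q" "n = (k + 1) * p + q" if "h = 2 * k + 1" using ratio n that by simp_all
  have even: "n + 1 = (k + 1) * p + q" if "h = 2 * k" using n that by simp
  have n_ge: "(k + 1) * p + q \<le> n + 1" using n by linarith
  have npos: "0 < n" using n_ge np p kp by linarith
  show "h + 2 \<le> n" using n_ge np kp kq pq k h by linarith
  have count: "h + 1 \<le> (n - q + p - 1 - x) div p + (n - q + p - 1 - y) div p"
    if "x < p" "y < p" "x \<noteq> y" for x y
  proof -
    have nq: "n - q + (h + 1) mod 2 = (k + 1) * p" using n np kp k p by linarith
    have ge: "k + 1 \<le> (n - q + p - 1 - x) div p" if "h = 2 * k + 1 \<or> x < p - 1" "x < p" for x
    proof -
      have "(k + 1) * p \<le> n - q + p - 1 - x" using nq that h(2) by (auto simp: mod_simps)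
      thus ?thesis using p by (simp add: less_eq_div_iff_mult_less_eq)
    qed
    have ge': "k \<le> (n - q + p - 1 - x) div p" if "x < p" for x
    proof -
      have "k * p \<le> n - q + p - 1 - x" using nq np that by linarith
      thus ?thesis using p by (simp add: less_eq_div_iff_mult_less_eq)
    qed
    show ?thesis
    proof (cases "h = 2 * k + 1")
      case True
      thus ?thesis using ge[of x] ge[of y] that by linarith
    next
      case False
      hence "h = 2 * k" using h by simp
      moreover have "x < p - 1 \<or> y < p - 1" using that by linarith
      ultimately show ?thesis using ge[of x] ge[of y] ge'[of x] ge'[of y] that by auto
    qed
  qed
  show "\<not> separable p q n h"
  \<comment> \<open>Up to \<open>2 * q\<close> the pairs of any two changes are disjoint, so one
    count covers cuts and crosses. Longer \<open>n\<close> occur only for even \<open>h\<close>, and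
    there a separate bound on the crosses is needed.\<close>
  proof (cases "n \<le> 2 * q")
    case True
    show ?thesis
    proof
      assume "separable p q n h"
      then obtain \<alpha> \<beta> i j where ij: "\<alpha> (i mod p)" "\<not> \<alpha> (j mod p)"
        and c: "card (mismatches p q n \<alpha> \<beta>) \<le> h" unfolding separable_def by blast
      obtain u v where uv: "u < p" "v < p" "u \<noteq> v" "\<alpha> u \<noteq> \<alpha> ((u + q) mod p)" "\<alpha> v \<noteq> \<alpha> ((v + q) mod p)"
        by (rule two_changes[where \<alpha> = \<alpha>, OF cop mod_less_divisor[OF p(1)] ij(1) mod_less_divisor[OF p(1)] ij(2)])
      from mismatches_two_changes[OF p(2) uv disjI1[OF True], of \<beta>] count[OF uv(1-3)] c
      show False by linarith
    qed
  next
    case False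
    hence ev: "h = 2 * k" using odd h by linarith
    have n2: "2 * q \<le> n" using False by simp
    have "n \<le> p * q"
    proof -
      have "n \<le> 3 * q" using even[OF ev] np kq pq by linarith
      also have "3 * q \<le> p * q" by (rule mult_le_mono1) (use pq in linarith)
      finally show ?thesis .
    qed
    show ?thesis
    proof (rule not_separableI[OF cop pq n2 \<open>n \<le> p * q\<close>])
      fix j
      have "(2 * k + 1) * p \<le> n" using even[OF ev] np kq by (simp add: add_mult_distrib)
      hence "2 * k + 1 \<le> n div p" using p by (simp add: less_eq_div_iff_mult_less_eq)
      moreover have "2 \<le> n div q" using n2 p by (simp add: less_eq_div_iff_mult_less_eq)
      ultimately show "h + 3 \<le> class_size p n j + class_size q n j"
        using class_size_ge[OF p(1), of n j] class_size_ge[OF p(2), of n j] ev by linarith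
    next
      fix \<alpha> \<beta> :: "nat \<Rightarrow> bool"
      assume u: "2 \<le> card {x. x < p \<and> \<alpha> x}" "card {x. x < p \<and> \<alpha> x} + 2 \<le> p"
      obtain b t where t: "2 \<le> t" "Suc t < p"
        "\<alpha> (b mod p) \<noteq> \<alpha> ((b + q) mod p)" "\<alpha> ((b + t * q) mod p) \<noteq> \<alpha> ((b + Suc t * q) mod p)"
        by (rule disjoint_changes[OF cop refl u])
      let ?x = "\<lambda>t. (b + t * q) mod p"
      have step: "(?x s + q) mod p = ?x (Suc s)" for s by (simp add: mod_simps add.commute add.left_commute)
      have ne: "?x s = ?x s' \<longleftrightarrow> s = s'" if "s < p" "s' < p" for s s' using orbit_inj[OF cop that] by auto
      have c: "\<alpha> (?x 0) \<noteq> \<alpha> ((?x 0 + q) mod p)" "\<alpha> (?x t) \<noteq> \<alpha> ((?x t + q) mod p)" "?x 0 \<noteq> ?x t"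
        unfolding step using t(3,4) ne[of 0 t] t(1,2) by simp_all
      have d: "(?x 0 + q) mod p \<noteq> ?x t \<and> (?x t + q) mod p \<noteq> ?x 0"
        unfolding step using ne[of 1 t] ne[of "Suc t" 0] t(1,2) by simp
      have xp: "?x 0 < p" "?x t < p" using p by simp_all
      from mismatches_two_changes[OF p(2) xp c(3,1,2) disjI2[OF d], of n \<beta>] count[OF xp c(3)]
      show "h < card (mismatches p q n \<alpha> \<beta>)" by linarith
    qed
  qed
  show "separable p q (n - 1) h"
  proof (rule separable_two_changes[OF cop pq])
    show "q + p \<le> n - 1" using n_ge np kp pq k by linarith
    show "n - 1 \<le> 3 * q" using n np kq pq by linarith
    have less: "u div p < z" if "u < z * p" for u z :: nat using that p by (simp add: div_less_iff_less_mult)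
    show "(n - 1 - q + 1) div p + (n - 1 - q) div p \<le> h"
      using h(2)
    proof
      assume ev: "h = 2 * k"
      have "n - 1 - q + 1 < (k + 1) * p" "n - 1 - q < (k + 1) * p" using even[OF ev] npos np kp k pq by linarith+
      thus ?thesis using less[of "n - 1 - q + 1" "k + 1"] less[of "n - 1 - q" "k + 1"] ev by linarith
    next
      assume od: "h = 2 * k + 1"
      have "n - 1 - q + 1 < (k + 2) * p" "n - 1 - q < (k + 1) * p"
        using odd(2)[OF od] npos np kp k pq by (simp_all add: algebra_simps)
      thus ?thesis using less[of "n - 1 - q + 1" "k + 2"] less[of "n - 1 - q" "k + 1"] od by linarith
    qed
  qed
qed

subsection \<open>Computing the representation\<close>

definition block :: "com list \<Rightarrow> com" where
  "block cs = foldr Seq cs Skip"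

text \<open>For commands of unit cost whose effect is a function, the final state of a block is a
  \<open>fold\<close> that rewriting can evaluate. The closing \<open>Skip\<close> of
  \<open>block\<close> costs one more step.\<close>

fun straight :: "com \<Rightarrow> bool" where
  "straight (Arith x f a b) = True"
| "straight (Store a b) = True"
| "straight _ = False"

fun effect :: "com \<Rightarrow> state \<Rightarrow> state" where
  "effect (Arith x f a b) (r, m) = (r(x := arith_val f (opd_val a r) (opd_val b r)), m)"
| "effect (Store a b) (r, m) = (r, m(opd_val a r := opd_val b r))"
| "effect _ s = s"

lemma exec_straight: "straight c \<Longrightarrow> exec c s 1 (effect c s)"
  by (cases c; cases s) (auto intro: exec.Arith[unfolded One_nat_def] exec.Store[unfolded One_nat_def])

lemma exec_block:
  "list_all straight cs \<Longrightarrow> exec (block cs) s (Suc (length cs)) (fold effect cs s)"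
proof (induction cs arbitrary: s)
  case Nil
  thus ?case using exec.Skip[of s] by (simp add: block_def)
next
  case (Cons c cs)
  hence "exec c s 1 (effect c s)" "exec (block cs) (effect c s) (Suc (length cs)) (fold effect cs (effect c s))"
    using exec_straight[of c s] by simp_all
  from exec.Seq[OF this] show ?case by (simp add: block_def)
qed

lemma exec_blockI:
  assumes "list_all straight cs" "fold effect cs s = s'" "n = Suc (length cs)"
  shows "exec (block cs) s n s'"
  using exec_block[OF assms(1), of s] assms(2,3) by simp

section \<open>Writing the output\<close>

definition emit :: "operand list \<Rightarrow> com list" where
  "emit os = concat (map (\<lambda>v. [Store (Reg 2) v, Arith 2 Add (Reg 2) (Const 1)]) os)"

definition written :: "nat list \<Rightarrow> state \<Rightarrow> bool" where
  "written out s \<longleftrightarrow> fst s 2 = length out \<and> (\<forall>j < length out. snd s j = out ! j)"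

lemma straight_emit: "list_all straight (emit os)"
  unfolding emit_def by (induction os) simp_all

lemma length_emit: "length (emit os) = 2 * length os"
  unfolding emit_def by (induction os) simp_all

text \<open>The memory \<open>m'\<close> stays abstract, since only its written prefix matters
  afterwards. Register 2 must not be an operand because it moves during the writing.\<close>

lemma effect_emit:
  assumes "written out (r, m)" "Reg 2 \<notin> set os"
  obtains m' where "fold effect (emit os) (r, m) = (r(2 := r 2 + length os), m')"
    "written (out @ map (\<lambda>v. opd_val v r) os) (r(2 := r 2 + length os), m')"
proof -
  have "\<exists>m'. fold effect (emit os) (r, m) = (r(2 := r 2 + length os), m') \<and>
    written (out @ map (\<lambda>v. opd_val v r) os) (r(2 := r 2 + length os), m')"
    using assms
  proof (induction os arbitrary: out r m)
    case Nil
    thus ?case by (simp add: emit_def)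
  next
    case (Cons v os)
    let ?r = "r(2 := r 2 + 1)" and ?m = "m(r 2 := opd_val v r)"
    have "written (out @ [opd_val v r]) (?r, ?m)"
      using Cons.prems(1) unfolding written_def by (auto simp: nth_append less_Suc_eq)
    then obtain m' where m': "fold effect (emit os) (?r, ?m) = (?r(2 := ?r 2 + length os), m')"
      "written ((out @ [opd_val v r]) @ map (\<lambda>v. opd_val v ?r) os) (?r(2 := ?r 2 + length os), m')"
      using Cons.IH Cons.prems(2) by (metis list.set_intros(2))
    have same: "opd_val w ?r = opd_val w r" if "w \<in> set os" for w
    proof (cases w)
      case (Reg x)
      hence "x \<noteq> 2" using that Cons.prems(2) by auto
      thus ?thesis using Reg by simp
    qed simp
    have "map (\<lambda>v. opd_val v ?r) os = map (\<lambda>v. opd_val v r) os" using same by simp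
    moreover have "?r(2 := ?r 2 + length os) = r(2 := r 2 + length (v # os))" by simp
    moreover have "fold effect (emit (v # os)) (r, m) = fold effect (emit os) (?r, ?m)"
      by (simp add: emit_def)
    ultimately show ?case using m' by (metis append.assoc append_Cons append_Nil list.simps(9))
  qed
  thus ?thesis using that by blast
qed

text \<open>Registers: 0 holds \<open>h\<close>, 1 holds \<open>h + 4\<close>, 2 the next output address, 3 the index \<open>i\<close>,
  4 to 7 the remainders and cofactors of the Euclidean algorithm, 8 and 9 intermediate results, 10 to 13
  the neighbours \<open>a / b\<close> and \<open>c / d\<close>, 14 holds \<open>h + 4 - i\<close>. Cofactors are kept modulo \<open>h + 4\<close>, so
  that they stay natural numbers.\<close>

definition euclid_body :: com where
  "euclid_body = block
    [Arith 8 Div (Reg 4) (Reg 5), Arith 9 Sub (Reg 1) (Reg 8), Arith 9 Mul (Reg 9) (Reg 7),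
     Arith 9 Add (Reg 9) (Reg 6), Arith 6 Add (Reg 7) (Const 0), Arith 7 Mod (Reg 9) (Reg 1),
     Arith 9 Mod (Reg 4) (Reg 5), Arith 4 Add (Reg 5) (Const 0), Arith 5 Add (Reg 9) (Const 0)]"

definition euclid_loop :: com where
  "euclid_loop = While (Less (Const 0) (Reg 5)) euclid_body"

definition neighbours_code :: com where
  "neighbours_code = If (Equal (Reg 4) (Const 1))
    (block [Arith 10 Mul (Reg 3) (Reg 6), Arith 10 Div (Reg 10) (Reg 1), Arith 11 Sub (Reg 6) (Reg 10),
       Arith 12 Sub (Reg 3) (Reg 10), Arith 13 Sub (Reg 1) (Reg 6), Arith 13 Sub (Reg 13) (Reg 12)])
    (block [Arith 10 Div (Reg 3) (Reg 4), Arith 11 Div (Reg 14) (Reg 4), Arith 12 Div (Reg 3) (Reg 4),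
       Arith 13 Div (Reg 14) (Reg 4)])"

definition setup_code :: com where
  "setup_code = block
    [Arith 4 Add (Reg 1) (Const 0), Arith 5 Add (Reg 3) (Const 0), Arith 6 Add (Const 0) (Const 0),
     Arith 7 Add (Const 1) (Const 0), Arith 14 Sub (Reg 1) (Reg 3)]"

definition piece_cells :: "operand list" where
  "piece_cells = [Reg 9, Reg 14, Reg 10, Reg 11, Reg 12, Reg 13,
     Reg 14, Const 0, Const 0, Reg 13, Reg 10, Const 0, Const 0, Reg 3, Const 0]"

definition output_code :: com where
  "output_code = block (Arith 9 Sub (Reg 3) (Const 1) # emit piece_cells @ [Arith 3 Add (Reg 3) (Const 1)])"

definition main_loop :: com where
  "main_loop = While (Less (Reg 3) (Reg 1))
     (Seq setup_code (Seq euclid_loop (Seq neighbours_code output_code)))"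

definition representation_code :: com where
  "representation_code =
     Seq (block ([Arith 1 Add (Reg 0) (Const 4), Arith 8 Add (Reg 0) (Const 1), Arith 8 Div (Reg 8) (Const 2),
            Arith 9 Add (Reg 0) (Const 2), Arith 9 Div (Reg 9) (Const 2), Arith 10 Add (Reg 0) (Const 1),
            Arith 10 Mod (Reg 10) (Const 2)] @
          emit [Const 1, Reg 8, Reg 9, Const 1, Reg 10] @ [Arith 3 Add (Const 1) (Const 0)]))
     (Seq main_loop
       (block (Arith 9 Sub (Reg 1) (Const 1) # emit [Reg 9, Const 0, Const 1, Const 0, Const 1, Const 0])))"

section \<open>The extended Euclidean algorithm modulo h + 4\<close>

definition euclid_inv :: "nat \<Rightarrow> nat \<Rightarrow> (nat \<Rightarrow> nat) \<Rightarrow> bool" where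
  "euclid_inv N i r \<longleftrightarrow> r 1 = N \<and> r 5 < r 4 \<and> r 4 \<le> N \<and> r 6 < N \<and> r 7 < N \<and>
     [r 6 * i = r 4] (mod N) \<and> [r 7 * i = r 5] (mod N) \<and> gcd (r 4) (r 5) = gcd N i"

text \<open>\<open>N - q\<close> stands for -q modulo \<open>N\<close>; the quotient is at most
  \<open>N\<close>, so it is exact. The cofactor of \<open>N\<close> vanishes modulo
  \<open>N\<close>, hence one cofactor per remainder.\<close>

lemma cofactor_step:
  fixes N i r0 r1 t0 t1 :: nat
  assumes "[t0 * i = r0] (mod N)" "[t1 * i = r1] (mod N)" "r0 div r1 \<le> N"
  shows "[((N - r0 div r1) * t1 + t0) mod N * i = r0 mod r1] (mod N)"
proof -
  define q where "q = r0 div r1"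
  have "((N - q) * t1 + t0) * i + q * (t1 * i) = (N - q + q) * (t1 * i) + t0 * i"
    by (simp add: algebra_simps)
  also have "N - q + q = N" using assms(3) unfolding q_def by simp
  finally have eq: "((N - q) * t1 + t0) * i + q * (t1 * i) = N * (t1 * i) + t0 * i" .
  have "[((N - q) * t1 + t0) * i + q * r1 = ((N - q) * t1 + t0) * i + q * (t1 * i)] (mod N)"
    by (intro cong_add cong_mult cong_refl cong_sym[OF assms(2)])
  also have "[((N - q) * t1 + t0) * i + q * (t1 * i) = t0 * i] (mod N)"
    unfolding eq Cong.cong_def by simp
  also have "[t0 * i = r0] (mod N)" by (rule assms(1))
  also have "r0 = r0 mod r1 + q * r1" unfolding q_def by simp
  finally have "[((N - q) * t1 + t0) * i = r0 mod r1] (mod N)" by (simp only: cong_add_rcancel_nat)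
  thus ?thesis unfolding q_def[symmetric] Cong.cong_def by (simp add: mod_mult_left_eq)
qed

text \<open>\<open>x mod y\<close> is at most half of \<open>x\<close>, so each round at least
  halves the product of successive remainders.\<close>

lemma euclid_potential:
  fixes x y :: nat
  assumes "0 < y" "y < x" "x * y < 2 * k"
  shows "y * (x mod y) < k"
proof -
  have "1 \<le> x div y" using assms by (simp add: Suc_le_eq div_greater_zero_iff)
  hence "1 * y \<le> x div y * y" by (rule mult_le_mono1)
  moreover have "x div y * y + x mod y = x" by simp
  ultimately have "2 * (x mod y) \<le> x" using mod_less_divisor[OF assms(1), of x] by linarith
  hence "y * (2 * (x mod y)) \<le> y * x" by (rule mult_le_mono2)
  hence "2 * (y * (x mod y)) \<le> x * y" by (simp only: ac_simps)
  thus ?thesis using assms(3) by linarith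
qed

text \<open>\<open>e\<close> bounds the remaining rounds: a product below 2 ^ 0 means that the
  smaller remainder is 0. A round costs one test and the ten steps of the body.\<close>

lemma exec_euclid_loop:
  assumes "euclid_inv N i r" "r 4 * r 5 < 2 ^ e"
  shows "\<exists>t r'. t \<le> 11 * e + 1 \<and> exec euclid_loop (r, m) t (r', m) \<and> r' 4 = gcd N i \<and>
    [r' 6 * i = r' 4] (mod N) \<and> r' 6 < N \<and> (\<forall>x \<in> {0, 1, 2, 3, 14}. r' x = r x)"
  using assms
proof (induction e arbitrary: r)
  case (0 r)
  hence "r 5 = 0" unfolding euclid_inv_def by auto
  moreover from this have "exec euclid_loop (r, m) 1 (r, m)"
    unfolding euclid_loop_def by (intro exec.WhileFalse) simp
  ultimately show ?case using 0 unfolding euclid_inv_def by (intro exI[of _ 1] exI[of _ r]) auto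
next
  case (Suc e r)
  show ?case
  proof (cases "r 5 = 0")
    case True
    moreover from this have "exec euclid_loop (r, m) 1 (r, m)"
      unfolding euclid_loop_def by (intro exec.WhileFalse) simp
    ultimately show ?thesis using Suc.prems unfolding euclid_inv_def by (intro exI[of _ 1] exI[of _ r]) auto
  next
    case False
    define t2 where "t2 = ((r 1 - r 4 div r 5) * r 7 + r 6) mod r 1"
    define r' where "r' = r(8 := r 4 div r 5, 9 := r 4 mod r 5, 6 := r 7, 7 := t2, 4 := r 5, 5 := r 4 mod r 5)"
    have "exec euclid_body (r, m) 10 (r', m)"
      unfolding euclid_body_def
      by (rule exec_blockI) (simp_all add: r'_def t2_def fun_upd_def fun_eq_iff)
    moreover have "euclid_inv N i r'"
    proof -
      have inv: "r 1 = N" "r 5 < r 4" "r 4 \<le> N" "r 6 < N" "r 7 < N" "[r 6 * i = r 4] (mod N)"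
        "[r 7 * i = r 5] (mod N)" "gcd (r 4) (r 5) = gcd N i"
        using Suc.prems(1) unfolding euclid_inv_def by blast+
      have "r 4 div r 5 \<le> N" using inv(3) by (meson div_le_dividend le_trans)
      note step = cofactor_step[OF inv(6,7) this]
      have "gcd (r 5) (r 4 mod r 5) = gcd N i" using inv(8) by (simp add: gcd.commute gcd_red_nat[symmetric])
      moreover have "r 4 mod r 5 < r 5" using False by simp
      moreover have "t2 < N" unfolding t2_def inv(1) using inv by (intro mod_less_divisor) linarith
      ultimately show ?thesis using inv step unfolding euclid_inv_def r'_def t2_def by simp
    qed
    moreover have "r' 4 * r' 5 < 2 ^ e"
      using euclid_potential[of "r 5" "r 4" "2 ^ e"] Suc.prems False
      unfolding r'_def euclid_inv_def by (simp add: mult.commute)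
    ultimately obtain t r'' where t: "t \<le> 11 * e + 1" "exec euclid_loop (r', m) t (r'', m)" "r'' 4 = gcd N i"
      "[r'' 6 * i = r'' 4] (mod N)" "r'' 6 < N" "\<forall>x \<in> {0, 1, 2, 3, 14}. r'' x = r' x"
      using Suc.IH by blast
    have "exec euclid_loop (r, m) (Suc (10 + t)) (r'', m)"
      using \<open>exec euclid_body (r, m) 10 (r', m)\<close> t(2) False unfolding euclid_loop_def
      by (intro exec.WhileTrue) simp_all
    moreover have "\<forall>x \<in> {0, 1, 2, 3, 14}. r'' x = r x" using t(6) unfolding r'_def by auto
    ultimately show ?thesis using t(1,3-5) by (intro exI[of _ "Suc (10 + t)"] exI[of _ r'']) auto
  qed
qed

text \<open>If the gcd is 1, the final cofactor is the inverse of \<open>i\<close> modulo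
  \<open>N\<close>, as required by \<open>neighbours_of_inverse\<close>. Otherwise
  \<open>i / (N - i)\<close> is reduced, its gcd being \<open>gcd N i\<close>.\<close>

lemma exec_neighbours_code:
  assumes "r 1 = N" "r 3 = i" "r 14 = N - i" "0 < i" "i < N" "r 4 = gcd N i"
    "[r 6 * i = r 4] (mod N)" "r 6 < N"
  shows "\<exists>t r'. t \<le> 8 \<and> exec neighbours_code (r, m) t (r', m) \<and>
    Left (N - 1) (fval (i, N - i)) = (r' 10, r' 11) \<and> Right (N - 1) (fval (i, N - i)) = (r' 12, r' 13) \<and>
    (\<forall>x \<in> {0, 1, 2, 3, 14}. r' x = r x)"
proof (cases "r 4 = 1")
  case True
  let ?a = "i * r 6 div N"
  define r' where "r' = r(10 := ?a, 11 := r 6 - ?a, 12 := i - ?a, 13 := N - r 6 - (i - ?a))"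
  have "exec neighbours_code (r, m) (Suc (Suc 6)) (r', m)"
    unfolding neighbours_code_def
  proof (rule exec.IfTrue)
    show "exec (block [Arith 10 Mul (Reg 3) (Reg 6), Arith 10 Div (Reg 10) (Reg 1), Arith 11 Sub (Reg 6) (Reg 10),
       Arith 12 Sub (Reg 3) (Reg 10), Arith 13 Sub (Reg 1) (Reg 6), Arith 13 Sub (Reg 13) (Reg 12)]) (r, m) (Suc 6) (r', m)"
      by (rule exec_blockI) (simp_all add: r'_def assms(1,2)[unfolded One_nat_def])
  qed (use True in simp)
  moreover have "i * r 6 mod N = 1" using assms(4,5,7) True unfolding Cong.cong_def by (simp add: mult.commute)
  from neighbours_of_inverse[OF assms(4,5,8) this]
  have n: "(r 6 - ?a) * (i - ?a) = ?a * (N - r 6 - (i - ?a)) + 1" "?a + (i - ?a) = i"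
    "r 6 - ?a + (N - r 6 - (i - ?a)) = N - i" by simp_all
  have "i + (N - i) = Suc (N - 1)" using assms(4,5) by simp
  note Left_Right_neighbours[OF n this]
  ultimately show ?thesis unfolding r'_def by (intro exI[of _ "Suc (Suc 6)"] exI[of _ r']) (simp add: r'_def)
next
  case False
  define r' where "r' = r(10 := i div r 4, 11 := (N - i) div r 4, 12 := i div r 4, 13 := (N - i) div r 4)"
  have "exec neighbours_code (r, m) (Suc (Suc 4)) (r', m)"
    unfolding neighbours_code_def
  proof (rule exec.IfFalse)
    show "exec (block [Arith 10 Div (Reg 3) (Reg 4), Arith 11 Div (Reg 14) (Reg 4), Arith 12 Div (Reg 3) (Reg 4),
       Arith 13 Div (Reg 14) (Reg 4)]) (r, m) (Suc 4) (r', m)"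
      by (rule exec_blockI) (simp_all add: r'_def assms(2,3))
  qed (use False in simp)
  moreover have g: "gcd i (N - i) = r 4"
  proof -
    have "gcd N i = gcd (N - i + i) i" using assms(5) by simp
    also have "\<dots> = gcd (N - i) i" by (rule gcd_add1)
    finally show ?thesis using assms(6) by (simp add: gcd.commute)
  qed
  have "\<not> coprime i (N - i)" using False unfolding coprime_iff_gcd_eq_1 g .
  moreover have "i + (N - i) = Suc (N - 1)" using assms(4,5) by simp
  ultimately show ?thesis using Left_Right_not_coprime[OF assms(4), of "N - i" "N - 1"] unfolding g
    by (intro exI[of _ "Suc (Suc 4)"] exI[of _ r']) (simp add: r'_def)
qed

lemma exec_piece:
  assumes r: "r 1 = h + 4" "r 3 = i" and i: "0 < i" "i < h + 4" and e: "(h + 4) * (h + 4) < 2 ^ e"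
    and out: "written out (r, m)"
  shows "\<exists>t r' m'. t \<le> 11 * e + 50 \<and>
    exec (Seq setup_code (Seq euclid_loop (Seq neighbours_code output_code))) (r, m) t (r', m') \<and>
    r' 1 = h + 4 \<and> r' 3 = Suc i \<and> written (out @ fractions_at h i @ expressions_at h i) (r', m')"
proof -
  let ?N = "h + 4"
  define r1 where "r1 = r(4 := ?N, 5 := i, 6 := 0, 7 := 1, 14 := ?N - i)"
  have 1: "exec setup_code (r, m) (Suc 5) (r1, m)"
    unfolding setup_code_def by (rule exec_blockI) (simp_all add: r1_def r[unfolded One_nat_def])
  have "euclid_inv ?N i r1" using i r unfolding euclid_inv_def r1_def Cong.cong_def by simp
  moreover have "r1 4 * r1 5 < 2 ^ e"
  proof -
    have "?N * i \<le> ?N * ?N" by (rule mult_le_mono2) (use i in simp)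
    moreover have "r1 4 * r1 5 = ?N * i" unfolding r1_def by simp
    ultimately show ?thesis using e by linarith
  qed
  ultimately obtain t2 r2 where 2: "t2 \<le> 11 * e + 1" "exec euclid_loop (r1, m) t2 (r2, m)" "r2 4 = gcd ?N i"
    "[r2 6 * i = r2 4] (mod ?N)" "r2 6 < ?N" "\<forall>x \<in> {0, 1, 2, 3, 14}. r2 x = r1 x"
    using exec_euclid_loop[of ?N i r1 e m] by blast
  have r2: "r2 1 = ?N" "r2 3 = i" "r2 14 = ?N - i" "r2 2 = r 2" using 2(6) r unfolding r1_def by simp_all
  obtain t3 r3 where 3: "t3 \<le> 8" "exec neighbours_code (r2, m) t3 (r3, m)"
    "Left (?N - 1) (fval (i, ?N - i)) = (r3 10, r3 11)" "Right (?N - 1) (fval (i, ?N - i)) = (r3 12, r3 13)"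
    "\<forall>x \<in> {0, 1, 2, 3, 14}. r3 x = r2 x"
    using exec_neighbours_code[OF r2(1-3) i 2(3-5), of m] by blast
  have r3: "r3 1 = ?N" "r3 3 = i" "r3 14 = ?N - i" "r3 2 = r 2" using 3(5) r2 by simp_all
  define r4 where "r4 = r3(9 := i - 1)"
  have "written out (r4, m)" using out r3 unfolding written_def r4_def by simp
  moreover have "Reg 2 \<notin> set piece_cells" unfolding piece_cells_def by simp
  ultimately obtain m' where m': "fold effect (emit piece_cells) (r4, m) = (r4(2 := r4 2 + length piece_cells), m')"
    "written (out @ map (\<lambda>v. opd_val v r4) piece_cells) (r4(2 := r4 2 + length piece_cells), m')"
    by (rule effect_emit)
  define r5 where "r5 = r4(2 := r4 2 + length piece_cells, 3 := Suc i)"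
  \<comment> \<open>Fifteen cells at two steps each, two more assignments and the closing
    \<open>Skip\<close>.\<close>
  have 4: "exec output_code (r3, m) 33 (r5, m')"
  proof -
    have "fold effect (Arith 9 Sub (Reg 3) (Const 1) # emit piece_cells @ [Arith 3 Add (Reg 3) (Const 1)]) (r3, m) = (r5, m')"
      using m'(1) r3 unfolding r5_def r4_def by simp
    moreover have "length (Arith 9 Sub (Reg 3) (Const 1) # emit piece_cells @ [Arith 3 Add (Reg 3) (Const 1)]) = 32"
      by (simp add: length_emit piece_cells_def)
    moreover have "list_all straight (Arith 9 Sub (Reg 3) (Const 1) # emit piece_cells @ [Arith 3 Add (Reg 3) (Const 1)])"
      by (simp add: straight_emit)
    ultimately show ?thesis unfolding output_code_def by (intro exec_blockI) simp_all
  qed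
  have "?N - 1 = h + 3" by simp
  hence "left_frac h i = (r3 10, r3 11)" "right_frac h i = (r3 12, r3 13)"
    using 3(3,4) unfolding left_frac_def right_frac_def m_frac_def by (simp_all only:)
  hence "map (\<lambda>v. opd_val v r4) piece_cells = fractions_at h i @ expressions_at h i"
    using r3 unfolding piece_cells_def r4_def fractions_at_def expressions_at_def frac_cells_def
      linear_cells_def l_frac_def by simp
  hence "written (out @ fractions_at h i @ expressions_at h i) (r5, m')"
    using m'(2) unfolding r5_def written_def by simp
  moreover have "r5 1 = h + 4" "r5 3 = Suc i" unfolding r5_def r4_def using r3 by simp_all
  moreover have "exec (Seq setup_code (Seq euclid_loop (Seq neighbours_code output_code))) (r, m)
      (Suc 5 + (t2 + (t3 + 33))) (r5, m')"
    by (intro exec.Seq[OF 1] exec.Seq[OF 2(2)] exec.Seq[OF 3(2)] 4)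
  moreover have "Suc 5 + (t2 + (t3 + 33)) \<le> 11 * e + 50" using 2(1) 3(1) by simp
  ultimately show ?thesis by blast
qed

lemma exec_main_loop:
  assumes "r 1 = h + 4" "r 3 = i" "0 < i" "i \<le> h + 4" "(h + 4) * (h + 4) < 2 ^ e" "written out (r, m)"
  shows "\<exists>t r' m'. t \<le> (h + 4 - i) * (11 * e + 51) + 1 \<and> exec main_loop (r, m) t (r', m') \<and>
    r' 1 = h + 4 \<and> written (out @ concat (map (\<lambda>i. fractions_at h i @ expressions_at h i) [i..<h + 4])) (r', m')"
  using assms
proof (induction "h + 4 - i" arbitrary: i r m out)
  case 0
  hence "exec main_loop (r, m) 1 (r, m)" unfolding main_loop_def by (intro exec.WhileFalse) simp
  thus ?case using 0 by (intro exI[of _ 1] exI[of _ r] exI[of _ m]) simp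
next
  case (Suc k)
  hence lt: "i < h + 4" by simp
  obtain t1 r1 m1 where 1: "t1 \<le> 11 * e + 50"
    "exec (Seq setup_code (Seq euclid_loop (Seq neighbours_code output_code))) (r, m) t1 (r1, m1)"
    "r1 1 = h + 4" "r1 3 = Suc i" "written (out @ fractions_at h i @ expressions_at h i) (r1, m1)"
    using exec_piece[OF Suc.prems(1-3) lt Suc.prems(5,6)] by blast
  have "k = h + 4 - Suc i" using Suc.hyps(2) by simp
  then obtain t2 r2 m2 where 2: "t2 \<le> k * (11 * e + 51) + 1" "exec main_loop (r1, m1) t2 (r2, m2)" "r2 1 = h + 4"
    "written ((out @ fractions_at h i @ expressions_at h i) @
      concat (map (\<lambda>i. fractions_at h i @ expressions_at h i) [Suc i..<h + 4])) (r2, m2)"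
    using Suc.hyps(1)[of "Suc i" r1 "out @ fractions_at h i @ expressions_at h i" m1] 1 lt Suc.prems(5) by auto
  have "exec main_loop (r, m) (Suc (t1 + t2)) (r2, m2)"
    using 1(2) 2(2) Suc.prems(1,2) lt unfolding main_loop_def by (intro exec.WhileTrue) simp_all
  moreover have "Suc (t1 + t2) \<le> (h + 4 - i) * (11 * e + 51) + 1"
    using 1(1) 2(1) unfolding Suc.hyps(2)[symmetric] by simp
  moreover have "written (out @ concat (map (\<lambda>i. fractions_at h i @ expressions_at h i) [i..<h + 4])) (r2, m2)"
    using 2(4) lt by (simp add: upt_conv_Cons)
  ultimately show ?case using 2(3) by blast
qed

lemma ceiling_half: "\<lceil>real n / 2\<rceil> = int ((n + 1) div 2)"
proof (rule ceiling_unique)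
  have "2 * ((n + 1) div 2) \<le> n + 1" "n \<le> 2 * ((n + 1) div 2)" by linarith+
  hence "2 * real ((n + 1) div 2) \<le> real n + 1" "real n \<le> 2 * real ((n + 1) div 2)"
    by linarith+
  thus "real_of_int (int ((n + 1) div 2)) - 1 < real n / 2" "real n / 2 \<le> real_of_int (int ((n + 1) div 2))"
    by simp_all
qed

lemma first_piece_eq: "first_piece h = [1, (h + 1) div 2, (h + 2) div 2, 1, (h + 1) mod 2]"
  using ceiling_half[of h] ceiling_half[of "h + 1"]
  unfolding first_piece_def frac_cells_def linear_cells_def by (simp add: add.commute)

text \<open>(h + 4) / 0 has the reduced form 1 / 0 on both sides. The program writes these
  neighbours as constants after its loop, which ends with the index \<open>h + 3\<close>.\<close>

lemma fractions_at_last: "fractions_at h (h + 4) = [h + 3, 0, 1, 0, 1, 0]"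
proof -
  have "\<not> coprime (h + 4) (0::nat)" by simp
  from Left_Right_not_coprime[OF _ this, of "h + 3"] show ?thesis
    unfolding fractions_at_def frac_cells_def l_frac_def left_frac_def right_frac_def m_frac_def by simp
qed

lemma representation_code_correct:
  assumes e: "(h + 4) * (h + 4) < 2 ^ e"
  shows "computes_within representation_code h (representation h) ((h + 4) * (11 * e + 51) + 40)"
proof -
  define r0 :: "nat \<Rightarrow> nat" where "r0 = (\<lambda>_. 0)(0 := h)"
  define m0 :: "nat \<Rightarrow> nat" where "m0 = (\<lambda>_. 0)"
  let ?pre = "[Arith 1 Add (Reg 0) (Const 4), Arith 8 Add (Reg 0) (Const 1), Arith 8 Div (Reg 8) (Const 2),
            Arith 9 Add (Reg 0) (Const 2), Arith 9 Div (Reg 9) (Const 2), Arith 10 Add (Reg 0) (Const 1),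
            Arith 10 Mod (Reg 10) (Const 2)]"
  let ?first = "[Const 1, Reg 8, Reg 9, Const 1, Reg 10]" and ?last = "[Reg 9, Const 0, Const 1, Const 0, Const 1, Const 0]"
  define r1 where "r1 = r0(1 := h + 4, 8 := (h + 1) div 2, 9 := (h + 2) div 2, 10 := (h + 1) mod 2)"
  have "written [] (r1, m0)" unfolding written_def r1_def r0_def by simp
  moreover have "Reg 2 \<notin> set ?first" by simp
  ultimately obtain m1 where m1: "fold effect (emit ?first) (r1, m0) = (r1(2 := r1 2 + length ?first), m1)"
    "written ([] @ map (\<lambda>v. opd_val v r1) ?first) (r1(2 := r1 2 + length ?first), m1)"
    by (rule effect_emit)
  define r2 where "r2 = r1(2 := r1 2 + length ?first, 3 := 1)"
  have 1: "exec (block (?pre @ emit ?first @ [Arith 3 Add (Const 1) (Const 0)])) (r0, m0) 19 (r2, m1)"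
  proof -
    have pre: "fold effect ?pre (r0, m0) = (r1, m0)" unfolding r1_def r0_def by simp
    have "fold effect (?pre @ emit ?first @ [Arith 3 Add (Const 1) (Const 0)]) (r0, m0) = (r2, m1)"
      unfolding fold_append comp_def pre m1(1) r2_def by simp
    moreover have "length (?pre @ emit ?first @ [Arith 3 Add (Const 1) (Const 0)]) = 18"
      by (simp add: length_emit)
    moreover have "list_all straight (?pre @ emit ?first @ [Arith 3 Add (Const 1) (Const 0)])"
      by (simp add: straight_emit)
    ultimately show ?thesis by (intro exec_blockI) simp_all
  qed
  have "written (first_piece h) (r2, m1)"
    using m1(2) unfolding first_piece_eq written_def r2_def r1_def by simp
  moreover have "r2 1 = h + 4" "r2 3 = 1" unfolding r2_def r1_def by simp_all
  ultimately obtain t3 r3 m3 where 3: "t3 \<le> (h + 4 - 1) * (11 * e + 51) + 1" "exec main_loop (r2, m1) t3 (r3, m3)"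
    "r3 1 = h + 4"
    "written (first_piece h @ concat (map (\<lambda>i. fractions_at h i @ expressions_at h i) [1..<h + 4])) (r3, m3)"
    using exec_main_loop[of r2 h 1 e "first_piece h" m1] e by auto
  define out where "out = first_piece h @ concat (map (\<lambda>i. fractions_at h i @ expressions_at h i) [1..<h + 4])"
  define r4 where "r4 = r3(9 := h + 3)"
  have "written out (r4, m3)" using 3(4) unfolding out_def written_def r4_def by simp
  moreover have "Reg 2 \<notin> set ?last" by simp
  ultimately obtain m4 where m4: "fold effect (emit ?last) (r4, m3) = (r4(2 := r4 2 + length ?last), m4)"
    "written (out @ map (\<lambda>v. opd_val v r4) ?last) (r4(2 := r4 2 + length ?last), m4)"
    by (rule effect_emit)
  define r5 where "r5 = r4(2 := r4 2 + length ?last)"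
  have 4: "exec (block (Arith 9 Sub (Reg 1) (Const 1) # emit ?last)) (r3, m3) 14 (r5, m4)"
  proof -
    have "fold effect (Arith 9 Sub (Reg 1) (Const 1) # emit ?last) (r3, m3) = (r5, m4)"
    proof -
      have "effect (Arith 9 Sub (Reg 1) (Const 1)) (r3, m3) = (r4, m3)"
        unfolding r4_def using 3(3) by (simp add: add.commute)
      thus ?thesis using m4(1) unfolding r5_def by (simp only: fold_simps)
    qed
    moreover have "length (Arith 9 Sub (Reg 1) (Const 1) # emit ?last) = 13"
      by (simp add: length_emit)
    moreover have "list_all straight (Arith 9 Sub (Reg 1) (Const 1) # emit ?last)"
      by (simp add: straight_emit)
    ultimately show ?thesis by (intro exec_blockI) simp_all
  qed
  have "out @ map (\<lambda>v. opd_val v r4) ?last = representation h"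
    unfolding out_def representation_def fractions_at_last r4_def by simp
  hence "\<forall>j < length (representation h). m4 j = representation h ! j"
    using m4(2) unfolding written_def by simp
  moreover have "exec representation_code (initial_state h) (19 + (t3 + 14)) (r5, m4)"
  proof -
    have "initial_state h = (r0, m0)" unfolding initial_state_def r0_def m0_def ..
    thus ?thesis unfolding representation_code_def by (simp only:) (intro exec.Seq[OF 1] exec.Seq[OF 3(2)] 4)
  qed
  moreover have "19 + (t3 + 14) \<le> (h + 4) * (11 * e + 51) + 40"
  proof -
    have "(h + 4 - 1) * (11 * e + 51) \<le> (h + 4) * (11 * e + 51)" by (rule mult_le_mono1) simp
    thus ?thesis using 3(1) by linarith
  qed
  ultimately show ?thesis unfolding computes_within_def by blast
qed

section \<open>Size and running time\<close>

lemma length_representation: "length (representation h) = 15 * h + 56"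
proof -
  have "length (concat (map (\<lambda>i. fractions_at h i @ expressions_at h i) [1..<h + 4])) = 15 * (h + 3)"
    by (simp add: length_concat comp_def fractions_at_def expressions_at_def frac_cells_def
        linear_cells_def sum_list_triv)
  thus ?thesis
    unfolding representation_def first_piece_def by (simp add: frac_cells_def linear_cells_def fractions_at_def)
qed

lemma representation_bigo: "(\<lambda>h. real (length (representation h))) \<in> O(\<lambda>h. real h)"
  unfolding length_representation of_nat_add of_nat_mult by real_asymp

text \<open>The exponent comes from the potential \<open>(h + 4) * (h + 4)\<close>; the additional 1
  makes the bound by the power of two strict.\<close>

definition running_time :: "nat \<Rightarrow> nat" where
  "running_time h = (h + 4) * (11 * (nat \<lceil>2 * log 2 (real h + 4)\<rceil> + 1) + 51) + 40"

lemma running_time_bigo: "(\<lambda>h. real (running_time h)) \<in> O(\<lambda>h. real h * ln (real h))"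
proof -
  have "real (running_time h) \<le> (real h + 4) * (11 * (2 * log 2 (real h + 4) + 2) + 51) + 40" for h
  proof -
    have "0 \<le> log 2 (real h + 4)" by simp
    hence "real (nat \<lceil>2 * log 2 (real h + 4)\<rceil>) \<le> 2 * log 2 (real h + 4) + 1" by linarith
    moreover have "11 * (u + 1) + 51 \<le> 11 * (v + 2) + 51" if "u \<le> v + 1" for u v :: real using that by simp
    ultimately have "11 * (real (nat \<lceil>2 * log 2 (real h + 4)\<rceil>) + 1) + 51 \<le> 11 * (2 * log 2 (real h + 4) + 2) + 51" by blast
    hence "(real h + 4) * (11 * (real (nat \<lceil>2 * log 2 (real h + 4)\<rceil>) + 1) + 51)
      \<le> (real h + 4) * (11 * (2 * log 2 (real h + 4) + 2) + 51)" by (rule mult_left_mono) simp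
    thus ?thesis unfolding running_time_def by simp
  qed
  hence "norm (real (running_time h)) \<le> norm ((real h + 4) * (11 * (2 * log 2 (real h + 4) + 2) + 51) + 40)" for h
    unfolding real_norm_def abs_of_nat by (rule order_trans[OF _ abs_ge_self])
  hence "(\<lambda>h. real (running_time h)) \<in> O(\<lambda>h. (real h + 4) * (11 * (2 * log 2 (real h + 4) + 2) + 51) + 40)"
    by (intro landau_o.big_mono always_eventually allI)
  also have "(\<lambda>h::nat. (real h + 4) * (11 * (2 * log 2 (real h + 4) + 2) + 51) + 40) \<in> O(\<lambda>h. real h * ln (real h))"
    by real_asymp
  finally show ?thesis .
qed

lemma computes_within_running_time:
  "computes_within representation_code h (representation h) (running_time h)"
  unfolding running_time_def
proof (rule representation_code_correct)
  let ?l = "2 * log 2 (real h + 4)" let ?e = "nat \<lceil>?l\<rceil> + 1"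
  have "real ((h + 4) * (h + 4)) = 2 powr ?l"
  proof -
    have "2 powr ?l = (2 powr log 2 (real h + 4)) powr 2" unfolding powr_powr by (simp only: mult.commute)
    also have "\<dots> = (real h + 4) * (real h + 4)" by (simp add: powr_numeral power2_eq_square)
    finally have "2 powr ?l = (real h + 4) * (real h + 4)" .
    moreover have "real ((h + 4) * (h + 4)) = (real h + 4) * (real h + 4)" by simp
    ultimately show ?thesis by (simp only:)
  qed
  also have "\<dots> < 2 powr real ?e"
  proof -
    have "?l < real ?e" by linarith
    thus ?thesis by simp
  qed
  also have "\<dots> = 2 ^ ?e" by (rule powr_realpow) simp
  also have "\<dots> = real (2 ^ ?e)" by (simp only: of_nat_power of_nat_numeral)
  finally show "(h + 4) * (h + 4) < 2 ^ ?e" by (simp only: of_nat_less_iff)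
qed

section \<open>From inequalities between natural numbers to the stated fractions\<close>

lemma index_exists:
  fixes p q h :: nat
  assumes "0 < q"
  obtains i where "i \<in> {1..h + 3}" "(i - 1) * q \<le> p * (h + 4 - i)" "p * (h + 3 - i) \<le> i * q"
proof -
  \<comment> \<open>The largest index with \<open>l_i <= p / q\<close> works: \<open>l_1 = 0\<close>
    puts 1 into the set, and maximality gives the upper bound except at \<open>h + 3\<close>, where
    the right end is infinite.\<close>
  define I where "I = {i \<in> {1..h + 3}. (i - 1) * q \<le> p * (h + 4 - i)}"
  have fin: "finite I" and "1 \<in> I" unfolding I_def by simp_all
  hence mem: "Max I \<in> I" using Max_in by blast
  let ?i = "Max I"
  have "p * (h + 3 - ?i) \<le> ?i * q"
  proof (cases "?i = h + 3")
    case False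
    have "?i + 1 \<notin> I" using Max_ge[OF fin, of "?i + 1"] by auto
    moreover have "?i + 1 \<in> {1..h + 3}" using mem False unfolding I_def by auto
    ultimately have "\<not> (?i + 1 - 1) * q \<le> p * (h + 4 - (?i + 1))" unfolding I_def by blast
    moreover have "h + 4 - (?i + 1) = h + 3 - ?i" by simp
    ultimately show ?thesis by simp
  qed simp
  thus ?thesis using that mem unfolding I_def by blast
qed

lemma first_piece_ratio:
  fixes p q h :: nat
  assumes "0 < q" "0 < h"
  shows "real p / real q < 1 / real_of_int \<lceil>real h / 2\<rceil> \<longleftrightarrow> (h + 1) div 2 * p < q"
proof -
  define k where "k = (h + 1) div 2"
  have "0 < k" using assms(2) unfolding k_def by (simp add: div_greater_zero_iff)
  hence "real p / real q < 1 / real k \<longleftrightarrow> real p * real k < real q"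
    using assms(1) by (simp add: field_simps)
  also have "\<dots> \<longleftrightarrow> k * p < q" by (simp add: mult.commute flip: of_nat_mult)
  finally show ?thesis unfolding ceiling_half k_def[symmetric] by simp
qed

lemma threshold_first_piece_formula:
  fixes \<Sigma> :: "'a set" and h p q :: nat
  assumes xy: "x \<in> \<Sigma>" "y \<in> \<Sigma>" "x \<noteq> y"
    and cop: "coprime p q" and pq: "2 < p" "p < q" and h: "4 < h" and ratio: "(h + 1) div 2 * p < q"
  shows "int (threshold \<Sigma> h p q) = \<lceil>(real h + 1) / 2\<rceil> * int p + int q - int ((h + 1) mod 2)"
proof -
  define k where "k = h div 2"
  define n where "n = (k + 1) * p + q - (h + 1) mod 2"
  have k: "h = 2 * k \<or> h = 2 * k + 1" unfolding k_def by linarith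
  have n: "n + (h + 1) mod 2 = (k + 1) * p + q" unfolding n_def using pq by (simp add: mod_2_eq_odd)
  have "(h + 1 + 1) div 2 = k + 1" unfolding k_def by simp
  hence ceil: "\<lceil>(real h + 1) / 2\<rceil> = int (k + 1)" using ceiling_half[of "h + 1"] by (simp add: add.commute)
  have "int n + int ((h + 1) mod 2) = int (k + 1) * int p + int q"
    using arg_cong[OF n, of int] by (simp only: of_nat_add of_nat_mult)
  thus ?thesis unfolding threshold_first_piece[OF cop pq xy h k ratio n] ceil by linarith
qed

lemma l_frac_bounds_iff:
  assumes "0 < q" "i \<in> {1..h + 3}"
  shows "fval (l_frac h i) \<le> fval (p, q) \<longleftrightarrow> (i - 1) * q \<le> p * (h + 4 - i)"
    and "fval (p, q) \<le> fval (l_frac h (i + 1)) \<longleftrightarrow> p * (h + 3 - i) \<le> i * q"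
proof -
  have "h + 4 - (i + 1) = h + 3 - i" by linarith
  hence "l_frac h (i + 1) = (i, h + 3 - i)" unfolding l_frac_def by simp
  thus "fval (p, q) \<le> fval (l_frac h (i + 1)) \<longleftrightarrow> p * (h + 3 - i) \<le> i * q"
    using assms by (simp add: fval_le_iff)
  show "fval (l_frac h i) \<le> fval (p, q) \<longleftrightarrow> (i - 1) * q \<le> p * (h + 4 - i)"
    using assms unfolding l_frac_def by (subst fval_le_iff) auto
qed

lemma threshold_pieces_formula:
  fixes \<Sigma> :: "'a set" and h p q i a b c d :: nat
  assumes xy: "x \<in> \<Sigma>" "y \<in> \<Sigma>" "x \<noteq> y"
    and cop: "coprime p q" and pq: "2 < p" "p < q" and h: "4 < h" "h < p + q - 2"
    and ratio: "q \<le> (h + 1) div 2 * p" and i: "i \<in> {1..h + 3}"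
    and l: "fval (l_frac h i) \<le> fval (p, q)" "fval (p, q) \<le> fval (l_frac h (i + 1))"
    and L: "(a, b) = Left (h + 3) (fval (m_frac h i))" and R: "(c, d) = Right (h + 3) (fval (m_frac h i))"
  shows "(fval (l_frac h i) \<le> fval (p, q) \<and> fval (p, q) \<le> fval (a, b) \<longrightarrow>
        threshold \<Sigma> h p q = (h + 4 - i) * p) \<and>
      (fval (a, b) < fval (p, q) \<and> fval (p, q) < fval (c, d) \<longrightarrow>
        threshold \<Sigma> h p q = a * q + d * p) \<and>
      (fval (c, d) \<le> fval (p, q) \<and> fval (p, q) \<le> fval (l_frac h (i + 1)) \<longrightarrow>
        threshold \<Sigma> h p q = i * q)"
proof -
  define A where "A = h + 4 - i"
  have A: "0 < i" "0 < A" "i + A = h + 4" using i unfolding A_def by auto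
  have "0 < q" using pq by simp
  moreover have "A - 1 = h + 3 - i" unfolding A_def by linarith
  ultimately have l': "(i - 1) * q \<le> p * A" "p * (A - 1) \<le> i * q"
    using l l_frac_bounds_iff[OF _ i] unfolding A_def by simp_all
  have L': "Left (h + 3) (fval (i, A)) = (a, b)" and R': "Right (h + 3) (fval (i, A)) = (c, d)"
    using L R unfolding m_frac_def A_def by simp_all
  note cases = threshold_cases[OF cop pq xy h ratio A l' L' R']
  \<comment> \<open>Facts 4 and 5 exclude 0 / 0, so the comparisons may be cross-multiplied.\<close>
  show ?thesis using cases(1-3) cases(4,5) pq unfolding A_def[symmetric]
    by (simp add: fval_le_iff fval_less_iff)
qed

lemma interval_exists:
  fixes h p q :: nat
  assumes "0 < q"
  shows "\<exists>i \<in> {1..h + 3}. fval (l_frac h i) \<le> fval (p, q) \<and> fval (p, q) \<le> fval (l_frac h (i + 1))"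
proof -
  obtain i where i: "i \<in> {1..h + 3}" "(i - 1) * q \<le> p * (h + 4 - i)" "p * (h + 3 - i) \<le> i * q"
    using index_exists[OF assms] .
  thus ?thesis using l_frac_bounds_iff[OF assms i(1)] by blast
qed

lemma threshold_formula:
  fixes \<Sigma> :: "'a set" and h p q :: nat
  assumes xy: "x \<in> \<Sigma>" "y \<in> \<Sigma>" "x \<noteq> y"
    and A: "coprime p q" "2 < p" "p < q" "4 < h" "h < p + q - 2"
  shows "if 0 < real p / real q \<and> real p / real q < 1 / real_of_int \<lceil>real h / 2\<rceil>
         then int (threshold \<Sigma> h p q) =
                \<lceil>(real h + 1) / 2\<rceil> * int p + int q - int ((h + 1) mod 2)
         else
           (\<exists>i \<in> {1..h + 3}. fval (l_frac h i) \<le> fval (p, q) \<and> fval (p, q) \<le> fval (l_frac h (i + 1))) \<and>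
           (\<forall>i \<in> {1..h + 3}. \<forall>a b c d.
              fval (l_frac h i) \<le> fval (p, q) \<and> fval (p, q) \<le> fval (l_frac h (i + 1)) \<and>
              (a, b) = Left (h + 3) (fval (m_frac h i)) \<and>
              (c, d) = Right (h + 3) (fval (m_frac h i)) \<longrightarrow>
                (fval (l_frac h i) \<le> fval (p, q) \<and> fval (p, q) \<le> fval (a, b) \<longrightarrow>
                   threshold \<Sigma> h p q = (h + 4 - i) * p) \<and>
                (fval (a, b) < fval (p, q) \<and> fval (p, q) < fval (c, d) \<longrightarrow>
                   threshold \<Sigma> h p q = a * q + d * p) \<and>
                (fval (c, d) \<le> fval (p, q) \<and> fval (p, q) \<le> fval (l_frac h (i + 1)) \<longrightarrow>
                   threshold \<Sigma> h p q = i * q))"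
proof (cases "(h + 1) div 2 * p < q")
  case True
  moreover have "0 < real p / real q \<and> real p / real q < 1 / real_of_int \<lceil>real h / 2\<rceil>"
    using first_piece_ratio[of q h p] A True by simp
  ultimately show ?thesis using threshold_first_piece_formula[OF xy A(1-4)] by (simp only: if_True simp_thms)
next
  case False
  hence ratio: "q \<le> (h + 1) div 2 * p" by simp
  have no: "\<not> (0 < real p / real q \<and> real p / real q < 1 / real_of_int \<lceil>real h / 2\<rceil>)"
    using first_piece_ratio[of q h p] A False by simp
  have "0 < q" using A by simp
  show ?thesis unfolding if_not_P[OF no]
    using interval_exists[OF \<open>0 < q\<close>, of h p] threshold_pieces_formula[OF xy A ratio] by blast
qed

theorem theorem33:
  fixes \<Sigma> :: "'a set"
  assumes "\<exists>x \<in> \<Sigma>. \<exists>y \<in> \<Sigma>. x \<noteq> y"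
  shows
    "(\<forall>h p q :: nat. coprime p q \<and> 2 < p \<and> p < q \<and> 4 < h \<and> h < p + q - 2 \<longrightarrow>
        (if 0 < real p / real q \<and> real p / real q < 1 / real_of_int \<lceil>real h / 2\<rceil>
         then int (threshold \<Sigma> h p q) =
                \<lceil>(real h + 1) / 2\<rceil> * int p + int q - int ((h + 1) mod 2)
         else
           (\<exists>i \<in> {1..h + 3}. fval (l_frac h i) \<le> fval (p, q) \<and> fval (p, q) \<le> fval (l_frac h (i + 1))) \<and>
           (\<forall>i \<in> {1..h + 3}. \<forall>a b c d.
              fval (l_frac h i) \<le> fval (p, q) \<and> fval (p, q) \<le> fval (l_frac h (i + 1)) \<and>
              (a, b) = Left (h + 3) (fval (m_frac h i)) \<and>
              (c, d) = Right (h + 3) (fval (m_frac h i)) \<longrightarrow>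
                (fval (l_frac h i) \<le> fval (p, q) \<and> fval (p, q) \<le> fval (a, b) \<longrightarrow>
                   threshold \<Sigma> h p q = (h + 4 - i) * p) \<and>
                (fval (a, b) < fval (p, q) \<and> fval (p, q) < fval (c, d) \<longrightarrow>
                   threshold \<Sigma> h p q = a * q + d * p) \<and>
                (fval (c, d) \<le> fval (p, q) \<and> fval (p, q) \<le> fval (l_frac h (i + 1)) \<longrightarrow>
                   threshold \<Sigma> h p q = i * q))))
     \<and> (\<lambda>h. real (length (representation h))) \<in> O(\<lambda>h. real h)
     \<and> (\<exists>prog T. (\<lambda>h. real (T h)) \<in> O(\<lambda>h. real h * ln (real h)) \<and>
          (\<forall>h > 4. computes_within prog h (representation h) (T h)))"
proof -
  obtain x y where xy: "x \<in> \<Sigma>" "y \<in> \<Sigma>" "x \<noteq> y" using assms by blast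
  show ?thesis
    using threshold_formula[OF xy] representation_bigo running_time_bigo computes_within_running_time by blast
qed

end
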